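(* Suppose $\lambda_{\min}(E[b_w^K(X_i)b_w^K(X_i)'])>0$ for each $K$ and $n$. If $\{X_i\}_{i=-\infty}^\infty$ is strictly stationary and $\beta$-mixing with mixing coefficients such that one can choose an integer $q=q(n)\le n/2$ with $\beta(q)n/q=o(1)$, then $$\|(\widetilde B_w'\widetilde B_w/n)-I_K\|=O_p\big(\zeta_{K,n}\lambda_{K,n}\sqrt{(q\log K)/n}\big)=o_p(1)$$ provided $\zeta_{K,n}\lambda_{K,n}\sqrt{(q\log K)/n}=o(1)$.
   Context: Asymptotics are as $n\to\infty$ with $K=K(n)\to\infty$; $q\ge1$. $\|\cdot\|$ is the Euclidean norm of a vector or the spectral norm of a matrix; $\lambda_{\min}$ is the smallest eigenvalue. $X_i$ takes values in $\mathcal X\subseteq\mathbb R^d$; $\mathcal D_n\subseteq\mathcal X$ is compact, convex, with nonempty interior and $\mathcal D_n\subseteq\mathcal D_{n+1}$; $w_n(x)=1$ if $x\in\mathcal D_n$ and $0$ otherwise. For basis functions $b_{K1},\ldots,b_{KK}$, $b_w^K(x)=(b_{K1}(x)w_n(x),\ldots,b_{KK}(x)w_n(x))'$; $\zeta_{K,n}=\sup_x\|b_w^K(x)\|$; $\lambda_{K,n}=[\lambda_{\min}(E[b_w^K(X_i)b_w^K(X_i)'])]^{-1/2}$; $\widetilde b_w^K(x)=E[b_w^K(X_i)b_w^K(X_i)']^{-1/2}b_w^K(x)$; $\widetilde B_w=(\widetilde b_w^K(X_1),\ldots,\widetilde b_w^K(X_n))'$. $\beta$-mixing coefficients: $\beta(\mathcal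 A,\mathcal B)=\frac12\sup\sum_{i,j}|\mathbb P(A_i\cap B_j)-\mathbb P(A_i)\mathbb P(B_j)|$ over finite partitions $\{A_i\}\subset\mathcal A$, $\{B_j\}\subset\mathcal B$ of the sample space; $\beta(q)=\sup_i\beta(\sigma(\ldots,X_{i-1},X_i),\sigma(X_{i+q},X_{i+q+1},\ldots))$; $\beta$-mixing means $\beta(q)\to0$ as $q\to\infty$. *)

theory Defs
  imports
    "HOL-Probability.Probability"
    "Jordan_Normal_Form.Spectral_Radius"
begin

text \<open>Vectors and matrices whose dimension varies with the sample size are those of
  \<^theory>\<open>Jordan_Normal_Form.Matrix\<close>; their entries are indexed from 0.\<close>

definition euclidean_norm :: "real Matrix.vec \<Rightarrow> real" where
  "euclidean_norm v = sqrt (scalar_prod v v)"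

text \<open>The spectral norm is the operator norm induced by the Euclidean norm. The supremum is over
  a nonempty set as soon as the matrix has at least one column.\<close>

definition spectral_norm :: "real mat \<Rightarrow> real" where
  "spectral_norm A =
     (SUP v\<in>{v \<in> carrier_vec (dim_col A). euclidean_norm v = 1}. euclidean_norm (A *\<^sub>v v))"

definition lambda_min :: "real mat \<Rightarrow> real" where
  "lambda_min A = Min (spectrum A)"

definition positive_definite_mat :: "real mat \<Rightarrow> bool" where
  "positive_definite_mat A \<longleftrightarrow>
     square_mat A \<and> transpose_mat A = A \<and>
     (\<forall>v\<in>carrier_vec (dim_row A). v \<noteq> 0\<^sub>v (dim_row A) \<longrightarrow> scalar_prod v (A *\<^sub>v v) > 0)"

text \<open>For positive definite \<open>A\<close>, the matrix \<open>A\<^sup>-\<^sup>1\<^sup>/\<^sup>2\<close> is the unique positive definite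
  matrix whose square is the inverse of \<open>A\<close>. The value is unspecified for other \<open>A\<close>.\<close>

definition inv_sqrt_mat :: "real mat \<Rightarrow> real mat" where
  "inv_sqrt_mat A =
     (THE S. S \<in> carrier_mat (dim_row A) (dim_row A) \<and> positive_definite_mat S \<and>
             inverts_mat A (S * S) \<and> inverts_mat (S * S) A)"

text \<open>\<open>b K k\<close> is the \<open>k\<close>-th of the \<open>K\<close> basis functions \<open>b\<^sub>K\<^sub>1, \<dots>, b\<^sub>K\<^sub>K\<close>, numbered from 1, which
  explains the shift of the vector index.\<close>

definition weighted_basis ::
  "(nat \<Rightarrow> nat \<Rightarrow> 'x \<Rightarrow> real) \<Rightarrow> (nat \<Rightarrow> 'x set) \<Rightarrow> nat \<Rightarrow> nat \<Rightarrow> 'x \<Rightarrow> real Matrix.vec" where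
  "weighted_basis b \<D> K n x = Matrix.vec K (\<lambda>j. b K (Suc j) x * indicator (\<D> n) x)"

text \<open>The matrix \<open>E[g(Y) g(Y)']\<close> for a random element \<open>Y\<close> and a \<open>K\<close>-vector valued function \<open>g\<close>.\<close>

definition second_moment_mat ::
  "'a measure \<Rightarrow> nat \<Rightarrow> ('x \<Rightarrow> real Matrix.vec) \<Rightarrow> ('a \<Rightarrow> 'x) \<Rightarrow> real mat" where
  "second_moment_mat M K g Y =
     Matrix.mat K K (\<lambda>(j, k). \<integral>\<omega>. vec_index (g (Y \<omega>)) j * vec_index (g (Y \<omega>)) k \<partial>M)"

text \<open>An extended real: the supremum is infinite for an unbounded basis, whereas a supremum in the
  reals would then be unspecified.\<close>

definition zeta_Kn ::
  "'x set \<Rightarrow> (nat \<Rightarrow> nat \<Rightarrow> 'x \<Rightarrow> real) \<Rightarrow> (nat \<Rightarrow> 'x set) \<Rightarrow> nat \<Rightarrow> nat \<Rightarrow> ennreal" where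
  "zeta_Kn \<X> b \<D> K n = (SUP x\<in>\<X>. ennreal (euclidean_norm (weighted_basis b \<D> K n x)))"

text \<open>Under stationarity the matrix \<open>E[b(X\<^sub>i) b(X\<^sub>i)']\<close> does not depend on \<open>i\<close>; the first
  observation \<open>X\<^sub>1\<close> is used.\<close>

definition basis_gram ::
  "'a measure \<Rightarrow> (int \<Rightarrow> 'a \<Rightarrow> 'x) \<Rightarrow> (nat \<Rightarrow> nat \<Rightarrow> 'x \<Rightarrow> real) \<Rightarrow> (nat \<Rightarrow> 'x set)
    \<Rightarrow> nat \<Rightarrow> nat \<Rightarrow> real mat" where
  "basis_gram M X b \<D> K n = second_moment_mat M K (weighted_basis b \<D> K n) (X 1)"

definition lambda_Kn ::
  "'a measure \<Rightarrow> (int \<Rightarrow> 'a \<Rightarrow> 'x) \<Rightarrow> (nat \<Rightarrow> nat \<Rightarrow> 'x \<Rightarrow> real) \<Rightarrow> (nat \<Rightarrow> 'x set)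
    \<Rightarrow> nat \<Rightarrow> nat \<Rightarrow> real" where
  "lambda_Kn M X b \<D> K n = lambda_min (basis_gram M X b \<D> K n) powr (- 1 / 2)"

definition orthonormalized_basis ::
  "'a measure \<Rightarrow> (int \<Rightarrow> 'a \<Rightarrow> 'x) \<Rightarrow> (nat \<Rightarrow> nat \<Rightarrow> 'x \<Rightarrow> real) \<Rightarrow> (nat \<Rightarrow> 'x set)
    \<Rightarrow> nat \<Rightarrow> nat \<Rightarrow> 'x \<Rightarrow> real Matrix.vec" where
  "orthonormalized_basis M X b \<D> K n x =
     inv_sqrt_mat (basis_gram M X b \<D> K n) *\<^sub>v weighted_basis b \<D> K n x"

definition orthonormalized_design ::
  "'a measure \<Rightarrow> (int \<Rightarrow> 'a \<Rightarrow> 'x) \<Rightarrow> (nat \<Rightarrow> nat \<Rightarrow> 'x \<Rightarrow> real) \<Rightarrow> (nat \<Rightarrow> 'x set)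
    \<Rightarrow> nat \<Rightarrow> nat \<Rightarrow> 'a \<Rightarrow> real mat" where
  "orthonormalized_design M X b \<D> K n \<omega> =
     mat_of_rows K (map (\<lambda>i. orthonormalized_basis M X b \<D> K n (X i \<omega>)) [1..int n])"

text \<open>Equality of the joint laws of \<open>(X\<^sub>i)\<^sub>i\<^sub>\<in>\<^sub>I\<close> and \<open>(X\<^sub>i\<^sub>+\<^sub>h)\<^sub>i\<^sub>\<in>\<^sub>I\<close> for every finite set of times
  \<open>I\<close> and every shift \<open>h\<close>.\<close>

definition strictly_stationary ::
  "'a measure \<Rightarrow> (int \<Rightarrow> 'a \<Rightarrow> 'x::topological_space) \<Rightarrow> bool" where
  "strictly_stationary M X \<longleftrightarrow>
     (\<forall>I h. finite I \<longrightarrow>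
        distr M (\<Pi>\<^sub>M i\<in>I. borel) (\<lambda>\<omega>. \<lambda>i\<in>I. X i \<omega>) =
        distr M (\<Pi>\<^sub>M i\<in>I. borel) (\<lambda>\<omega>. \<lambda>i\<in>I. X (i + h) \<omega>))"

definition sigma_gen_by ::
  "'a measure \<Rightarrow> ('i \<Rightarrow> 'a \<Rightarrow> 'x::topological_space) \<Rightarrow> 'i set \<Rightarrow> 'a set set" where
  "sigma_gen_by M X I =
     sigma_sets (space M) (\<Union>i\<in>I. {X i -` A \<inter> space M |A. A \<in> sets borel})"

definition beta_dependence :: "'a measure \<Rightarrow> 'a set set \<Rightarrow> 'a set set \<Rightarrow> real" where
  "beta_dependence M \<A> \<B> =
     1 / 2 * (SUP (P, Q)\<in>{(P, Q). finite P \<and> P \<subseteq> \<A> \<and> partition_on (space M) P \<and>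
                                 finite Q \<and> Q \<subseteq> \<B> \<and> partition_on (space M) Q}.
        \<Sum>A\<in>P. \<Sum>B\<in>Q. \<bar>measure M (A \<inter> B) - measure M A * measure M B\<bar>)"

definition beta_mixing_coeff ::
  "'a measure \<Rightarrow> (int \<Rightarrow> 'a \<Rightarrow> 'x::topological_space) \<Rightarrow> nat \<Rightarrow> real" where
  "beta_mixing_coeff M X q =
     (SUP i::int. beta_dependence M (sigma_gen_by M X {..i}) (sigma_gen_by M X {i + int q..}))"

definition beta_mixing :: "'a measure \<Rightarrow> (int \<Rightarrow> 'a \<Rightarrow> 'x::topological_space) \<Rightarrow> bool" where
  "beta_mixing M X \<longleftrightarrow> beta_mixing_coeff M X \<longlonglongrightarrow> 0"

definition big_O_p :: "'a measure \<Rightarrow> (nat \<Rightarrow> 'a \<Rightarrow> real) \<Rightarrow> (nat \<Rightarrow> real) \<Rightarrow> bool" where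
  "big_O_p M Z r \<longleftrightarrow>
     (\<forall>\<epsilon>>0. \<exists>C>0. \<forall>\<^sub>F n in sequentially.
        measure M {\<omega> \<in> space M. \<bar>Z n \<omega>\<bar> > C * r n} < \<epsilon>)"

definition small_o_p :: "'a measure \<Rightarrow> (nat \<Rightarrow> 'a \<Rightarrow> real) \<Rightarrow> (nat \<Rightarrow> real) \<Rightarrow> bool" where
  "small_o_p M Z r \<longleftrightarrow>
     (\<forall>\<epsilon>>0. (\<lambda>n. measure M {\<omega> \<in> space M. \<bar>Z n \<omega>\<bar> > \<epsilon> * r n}) \<longlonglongrightarrow> 0)"

end

theory Submission
  imports Defs
begin

text \<open>The vector \<open>v\<^sub>i = G\<^sup>-\<^sup>1\<^sup>/\<^sup>2 b(X\<^sub>i)\<close>, where \<open>G\<close> is the Gram matrix of the basis, satisfies \<open>E v\<^sub>i v\<^sub>i' = I\<close> and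
\<open>|v\<^sub>i| \<le> B = \<zeta> \<lambda>\<close>, and the deviation in question is \<open>n\<^sup>-\<^sup>1 \<Sum> v\<^sub>i v\<^sub>i' - I\<close>. Cut \<open>{1..n}\<close> into blocks of length
\<open>q\<close> and treat the even and the odd blocks separately. Two consecutive blocks of the same parity are
\<open>q\<close> apart, so replacing the joint law of these blocks by the product of its marginals changes
probabilities by at most twice the number of blocks times \<open>\<beta>(q)\<close>, which is of the order \<open>\<beta>(q) n / q\<close>
and hence negligible (\<open>decoupled_event_bound\<close>). Under the product law one has a sum of independent
positive semidefinite matrices, the block averages, each bounded by \<open>R = q B\<^sup>2 / n\<close>, whose
expectations add up to a bounded multiple of the identity.

For such a sum, centred to \<open>X = \<Sum> X\<^sub>j\<close>, a noncommutative moment inequality takes the place of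
Bernstein's inequality. With \<open>Y = X - X\<^sub>j\<close> independent of \<open>X\<^sub>j\<close>,
\<open>E tr X\<^sub>j X\<^sup>r = E tr X\<^sub>j (X\<^sup>r - Y\<^sup>r)\<close>, and for odd \<open>r\<close> a mean value inequality for traces
(\<open>trace_mean_value\<close>) bounds this by \<open>r E tr X\<^sub>j\<^sup>2 (X\<^sup>r\<^sup>-\<^sup>1 + Y\<^sup>r\<^sup>-\<^sup>1)\<close>. Since \<open>X\<^sub>j\<^sup>2\<close> is dominated by
\<open>R\<close> times a linear expression in the summand and its mean, summing over \<open>j\<close> gives a recursion for
the even trace moments (\<open>moment_step\<close>), whence
\<open>E tr X\<^sup>2\<^sup>P \<le> K (16 P\<^sup>2 R\<^sup>2 + 80 P R)\<^sup>P\<close>. Markov's inequality with \<open>P\<close> the integer above \<open>ln K\<close>, so that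
the dimension costs only a factor \<open>K \<le> e\<^sup>P\<close>, gives the rate \<open>sqrt (R ln K) = \<zeta> \<lambda> sqrt (q ln K / n)\<close>
(\<open>tail_bound\<close>, \<open>moment_order_choice\<close>).

The mixing coefficient is defined through finite partitions. The vectors \<open>v\<^sub>i\<close> are therefore rounded to
a fine grid first: the block averages then take finitely many values, the product law is a finite sum
of weights, and the rounding error is as small as desired (\<open>parity_sum_tail\<close>, \<open>deviation_norm_le\<close>).

Since the dimension varies with \<open>n\<close>, vectors and matrices are represented by functions on the natural
numbers of which only the first \<open>K\<close> arguments matter. The trace inequalities are stated through
eigenvalues and eigenvectors, so that no matrix powers occur.\<close>

section \<open>Symmetric matrices and the spectral theorem\<close>

definition dot :: "nat \<Rightarrow> (nat \<Rightarrow> real) \<Rightarrow> (nat \<Rightarrow> real) \<Rightarrow> real" where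
  "dot K x y = (\<Sum>i<K. x i * y i)"

definition mulv :: "nat \<Rightarrow> (nat \<Rightarrow> nat \<Rightarrow> real) \<Rightarrow> (nat \<Rightarrow> real) \<Rightarrow> nat \<Rightarrow> real" where
  "mulv K A x = (\<lambda>i. \<Sum>j<K. A i j * x j)"

definition qform :: "nat \<Rightarrow> (nat \<Rightarrow> nat \<Rightarrow> real) \<Rightarrow> (nat \<Rightarrow> real) \<Rightarrow> real" where
  "qform K A x = dot K x (mulv K A x)"

definition sym_mat :: "nat \<Rightarrow> (nat \<Rightarrow> nat \<Rightarrow> real) \<Rightarrow> bool" where
  "sym_mat K A \<longleftrightarrow> (\<forall>i<K. \<forall>j<K. A i j = A j i)"

definition orthonormal :: "nat \<Rightarrow> nat \<Rightarrow> (nat \<Rightarrow> nat \<Rightarrow> real) \<Rightarrow> bool" where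
  "orthonormal K m u \<longleftrightarrow> (\<forall>i<m. \<forall>j<m. dot K (u i) (u j) = (if i = j then 1 else 0))"

definition eigensystem ::
  "nat \<Rightarrow> (nat \<Rightarrow> nat \<Rightarrow> real) \<Rightarrow> nat \<Rightarrow> (nat \<Rightarrow> real) \<Rightarrow> (nat \<Rightarrow> nat \<Rightarrow> real) \<Rightarrow> bool" where
  "eigensystem K A m d u \<longleftrightarrow>
     orthonormal K m u \<and> (\<forall>i<m. \<forall>l<K. mulv K A (u i) l = d i * u i l)"

lemma dot_commute: "dot K x y = dot K y x"
  by (simp add: dot_def mult.commute)

lemma dot_add_left: "dot K (\<lambda>i. x i + y i) z = dot K x z + dot K y z"
  and dot_add_right: "dot K z (\<lambda>i. x i + y i) = dot K z x + dot K z y"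
  and dot_diff_left: "dot K (\<lambda>i. x i - y i) z = dot K x z - dot K y z"
  and dot_diff_right: "dot K z (\<lambda>i. x i - y i) = dot K z x - dot K z y"
  and dot_scale_left: "dot K (\<lambda>i. c * x i) z = c * dot K x z"
  and dot_scale_right: "dot K z (\<lambda>i. c * x i) = c * dot K z x"
  by (simp_all add: dot_def algebra_simps sum.distrib sum_subtractf sum_distrib_left)

lemma dot_sum_left: "dot K (\<lambda>i. \<Sum>j\<in>J. f j i) z = (\<Sum>j\<in>J. dot K (f j) z)"
  and dot_sum_right: "dot K z (\<lambda>i. \<Sum>j\<in>J. f j i) = (\<Sum>j\<in>J. dot K z (f j))"
  unfolding dot_def
  by (simp_all add: sum_distrib_left sum_distrib_right) (rule sum.swap)+

lemmas dot_simps = dot_add_left dot_add_right dot_diff_left dot_diff_right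
  dot_scale_left dot_scale_right dot_sum_left dot_sum_right

lemma dot_cong:
  assumes "\<And>i. i < K \<Longrightarrow> x i = x' i" "\<And>i. i < K \<Longrightarrow> y i = y' i"
  shows "dot K x y = dot K x' y'"
  using assms by (simp add: dot_def)

lemma dot_self_nonneg [simp]: "0 \<le> dot K x x"
  by (simp add: dot_def sum_nonneg)

lemma dot_self_eq_0: "dot K x x = 0 \<longleftrightarrow> (\<forall>i<K. x i = 0)"
  by (auto simp: dot_def sum_nonneg_eq_0_iff)

lemma mulv_cong: "(\<And>i. i < K \<Longrightarrow> x i = y i) \<Longrightarrow> mulv K A x = mulv K A y"
  by (auto simp: mulv_def)

lemma qform_cong: "(\<And>i. i < K \<Longrightarrow> x i = y i) \<Longrightarrow> qform K A x = qform K A y"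
  unfolding qform_def by (metis (no_types, lifting) dot_cong mulv_cong)

lemma mulv_add: "mulv K A (\<lambda>i. x i + y i) = (\<lambda>i. mulv K A x i + mulv K A y i)"
  and mulv_diff: "mulv K A (\<lambda>i. x i - y i) = (\<lambda>i. mulv K A x i - mulv K A y i)"
  and mulv_scale: "mulv K A (\<lambda>i. c * x i) = (\<lambda>i. c * mulv K A x i)"
  by (simp_all add: mulv_def algebra_simps sum.distrib sum_subtractf sum_distrib_left)

lemma mulv_sum_mat: "mulv K (\<lambda>a b. \<Sum>j\<in>J. F j a b) x = (\<lambda>i. \<Sum>j\<in>J. mulv K (F j) x i)"
  and mulv_diff_mat: "mulv K (\<lambda>a b. F1 a b - F2 a b) x = (\<lambda>i. mulv K F1 x i - mulv K F2 x i)"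
  and mulv_add_mat: "mulv K (\<lambda>a b. F1 a b + F2 a b) x = (\<lambda>i. mulv K F1 x i + mulv K F2 x i)"
  and mulv_scale_mat: "mulv K (\<lambda>a b. c * F1 a b) x = (\<lambda>i. c * mulv K F1 x i)"
  by (simp_all add: mulv_def algebra_simps sum.distrib sum_subtractf sum_distrib_left
      sum_distrib_right) (subst sum.swap, rule refl)

lemma qform_sum_mat: "qform K (\<lambda>a b. \<Sum>j\<in>J. F j a b) x = (\<Sum>j\<in>J. qform K (F j) x)"
  and qform_diff_mat: "qform K (\<lambda>a b. F1 a b - F2 a b) x = qform K F1 x - qform K F2 x"
  and qform_add_mat: "qform K (\<lambda>a b. F1 a b + F2 a b) x = qform K F1 x + qform K F2 x"
  and qform_scale_mat: "qform K (\<lambda>a b. c * F1 a b) x = c * qform K F1 x"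
  by (simp_all add: qform_def mulv_sum_mat mulv_diff_mat mulv_add_mat mulv_scale_mat dot_simps)

lemma dot_mulv_sym:
  assumes "sym_mat K A"
  shows "dot K x (mulv K A y) = dot K (mulv K A x) y"
proof -
  have "dot K x (mulv K A y) = (\<Sum>i<K. \<Sum>j<K. x i * A i j * y j)"
    by (simp add: dot_def mulv_def sum_distrib_left mult.assoc)
  also have "\<dots> = (\<Sum>j<K. \<Sum>i<K. x i * A i j * y j)" by (rule sum.swap)
  also have "\<dots> = (\<Sum>j<K. \<Sum>i<K. A j i * x i * y j)"
    using assms by (intro sum.cong) (auto simp: sym_mat_def)
  also have "\<dots> = dot K (mulv K A x) y"
    by (simp add: dot_def mulv_def sum_distrib_right)
  finally show ?thesis .
qed

lemma dot_unit_vector: "i < K \<Longrightarrow> dot K x (\<lambda>j. if j = i then 1 else 0) = x i"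
  by (simp add: dot_def if_distrib[of "(*) _"] cong: if_cong)

lemma residual_orthogonal:
  assumes "orthonormal K m u" "i < m"
  shows "dot K (u i) (\<lambda>l. x l - (\<Sum>j<m. dot K (u j) x * u j l)) = 0"
proof -
  have "(\<Sum>j<m. dot K (u j) x * dot K (u i) (u j)) = (\<Sum>j<m. if j = i then dot K (u i) x else 0)"
    using assms by (intro sum.cong) (auto simp: orthonormal_def)
  then show ?thesis
    using assms(2) by (simp add: dot_simps)
qed

lemma residual_norm:
  assumes "orthonormal K m u"
  defines "r \<equiv> \<lambda>x l. x l - (\<Sum>j<m. dot K (u j) x * u j l)"
  shows "dot K (r x) (r x) = dot K x x - (\<Sum>j<m. (dot K (u j) x)\<^sup>2)"
proof -
  have "dot K (r x) (r x) = dot K x (r x) - (\<Sum>j<m. dot K (u j) x * dot K (u j) (r x))"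
    by (subst r_def) (simp add: dot_simps)
  also have "(\<Sum>j<m. dot K (u j) x * dot K (u j) (r x)) = 0"
    using residual_orthogonal[OF assms(1)] by (simp add: r_def)
  also have "dot K x (r x) = dot K x x - (\<Sum>j<m. (dot K (u j) x)\<^sup>2)"
    by (simp add: r_def dot_simps dot_commute[of K x "u j" for j] power2_eq_square)
  finally show ?thesis by simp
qed

text \<open>The squared residual of the \<open>i\<close>-th unit vector is \<open>1 - \<Sum>\<^sub>j (u\<^sub>j)\<^sub>i\<^sup>2\<close>. This trace computation replaces
the theory of dimension: for \<open>m < K\<close> some residual is nonzero, which yields a vector orthogonal to
the system, and for \<open>m = K\<close> all residuals vanish, which yields Parseval's identity.\<close>

lemma sum_residuals_unit_vectors:
  assumes "orthonormal K m u"
  defines "r \<equiv> \<lambda>x l. x l - (\<Sum>j<m. dot K (u j) x * u j l)"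
  defines "e \<equiv> \<lambda>i j. if j = i then 1 else (0::real)"
  shows "(\<Sum>i<K. dot K (r (e i)) (r (e i))) = real K - real m"
proof -
  have "(\<Sum>i<K. dot K (r (e i)) (r (e i))) = (\<Sum>i<K. 1 - (\<Sum>j<m. (u j i)\<^sup>2))"
    unfolding r_def residual_norm[OF assms(1)]
    by (intro sum.cong refl) (simp add: e_def dot_unit_vector)
  also have "\<dots> = real K - (\<Sum>j<m. \<Sum>i<K. (u j i)\<^sup>2)"
    by (simp add: sum_subtractf) (rule sum.swap)
  also have "(\<Sum>j<m. \<Sum>i<K. (u j i)\<^sup>2) = (\<Sum>j<m. dot K (u j) (u j))"
    by (simp add: dot_def power2_eq_square)
  also have "\<dots> = real m" using assms(1) by (simp add: orthonormal_def)
  finally show ?thesis .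
qed

lemma parseval:
  assumes "orthonormal K K u"
  shows "dot K x y = (\<Sum>i<K. dot K (u i) x * dot K (u i) y)"
proof -
  define e where "e = (\<lambda>i j::nat. if j = i then 1 else (0::real))"
  define r where "r = (\<lambda>x l. x l - (\<Sum>j<K. dot K (u j) x * u j l))"
  have "(\<Sum>i<K. dot K (r (e i)) (r (e i))) = 0"
    using sum_residuals_unit_vectors[OF assms] unfolding r_def e_def by simp
  then have "\<And>i. i < K \<Longrightarrow> dot K (r (e i)) (r (e i)) = 0"
    by (subst (asm) sum_nonneg_eq_0_iff) auto
  then have zero: "r (e i) l = 0" if "i < K" "l < K" for i l
    using that by (auto simp: dot_self_eq_0)
  then have delta: "(\<Sum>j<K. u j i * u j l) = (if l = i then 1 else 0)" if "i < K" "l < K" for i l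
    using zero[OF that] that
    by (simp add: r_def e_def dot_unit_vector split: if_splits)
  have "(\<Sum>i<K. dot K (u i) x * dot K (u i) y)
      = (\<Sum>i<K. \<Sum>a<K. \<Sum>b<K. x a * y b * (u i a * u i b))"
    by (simp add: dot_def sum_product algebra_simps)
  also have "\<dots> = (\<Sum>a<K. \<Sum>b<K. \<Sum>i<K. x a * y b * (u i a * u i b))"
    by (subst sum.swap) (intro sum.cong refl sum.swap)
  also have "\<dots> = (\<Sum>a<K. \<Sum>b<K. x a * y b * (if b = a then 1 else 0))"
    by (simp only: sum_distrib_left[symmetric]) (intro sum.cong refl, simp add: delta)
  also have "\<dots> = dot K x y"
    by (simp add: dot_def if_distrib[of "(*) _"] cong: if_cong)
  finally show ?thesis by simp
qed

lemma exists_unit_orthogonal: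
  assumes "orthonormal K m u" "m < K"
  shows "\<exists>x. dot K x x = 1 \<and> (\<forall>i<m. dot K (u i) x = 0)"
proof -
  define e where "e = (\<lambda>i j::nat. if j = i then 1 else (0::real))"
  define r where "r = (\<lambda>x l. x l - (\<Sum>j<m. dot K (u j) x * u j l))"
  have "(\<Sum>i<K. dot K (r (e i)) (r (e i))) > 0"
    using sum_residuals_unit_vectors[OF assms(1)] assms(2) unfolding r_def e_def by simp
  then obtain i where i: "dot K (r (e i)) (r (e i)) \<noteq> 0"
    by (metis (no_types, lifting) less_irrefl sum.neutral)
  define c where "c = 1 / sqrt (dot K (r (e i)) (r (e i)))"
  have pos: "dot K (r (e i)) (r (e i)) > 0" using i dot_self_nonneg[of K "r (e i)"] by linarith
  have "dot K (\<lambda>l. c * r (e i) l) (\<lambda>l. c * r (e i) l) = c * c * dot K (r (e i)) (r (e i))"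
    by (simp add: dot_simps)
  also have "\<dots> = 1" using pos by (simp add: c_def divide_simps)
  finally have "dot K (\<lambda>l. c * r (e i) l) (\<lambda>l. c * r (e i) l) = 1" .
  moreover have "\<forall>j<m. dot K (u j) (\<lambda>l. c * r (e i) l) = 0"
    using residual_orthogonal[OF assms(1)] by (simp add: dot_scale_right r_def)
  ultimately show ?thesis by blast
qed

lemma continuous_dot:
  assumes "\<And>i. continuous_on S (\<lambda>x. f x i)" "\<And>i. continuous_on S (\<lambda>x. g x i)"
  shows "continuous_on S (\<lambda>x. dot K (f x) (g x))"
  unfolding dot_def by (intro continuous_intros assms)

lemma continuous_mulv:
  assumes "\<And>i. continuous_on S (\<lambda>x. f x i)"
  shows "continuous_on S (\<lambda>x. mulv K A (f x) i)"
  unfolding mulv_def by (intro continuous_intros assms)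

text \<open>Restricted to vectors supported on the first \<open>K\<close> coordinates, the unit vectors orthogonal to the
system form a closed subset of a cube, which is compact in the product topology by Tychonoff's theorem.\<close>

lemma rayleigh_maximizer:
  assumes "orthonormal K m u" "m < K"
  shows "\<exists>x. dot K x x = 1 \<and> (\<forall>i<m. dot K (u i) x = 0) \<and>
    (\<forall>y. (\<forall>i<m. dot K (u i) y = 0) \<longrightarrow> qform K A y \<le> qform K A x * dot K y y)"
proof -
  define cube where "cube = Pi\<^sub>E (UNIV :: nat set) (\<lambda>i. {-1..1::real})"
  define S where "S = cube \<inter> {x. dot K x x = 1} \<inter> (\<Inter>i\<in>{..<m}. {x. dot K (u i) x = 0})"
  have "compactin (product_topology (\<lambda>i. euclidean) UNIV) cube"
    unfolding cube_def by (subst compactin_PiE) auto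
  then have "compact cube"
    by (simp add: euclidean_product_topology)
  moreover have coord: "continuous_on UNIV (\<lambda>x :: nat \<Rightarrow> real. x i)" for i
    by (intro continuous_on_product_coordinates)
  have "closed {x. dot K x x = 1}"
    by (intro closed_Collect_eq continuous_dot coord continuous_on_const)
  moreover have "closed {x. dot K (u i) x = 0}" for i
    by (intro closed_Collect_eq continuous_dot coord continuous_on_const)
  ultimately have comp: "compact S" unfolding S_def
    by (intro compact_Int_closed closed_INT) auto
  have trunc: "\<exists>z\<in>S. \<forall>i<K. z i = x i" if x: "dot K x x = 1" "\<forall>i<m. dot K (u i) x = 0" for x
  proof -
    define z where "z = (\<lambda>i. if i < K then x i else 0)"
    have "(z i)\<^sup>2 \<le> 1" for i
    proof (cases "i < K")
      case True
      then have "(x i)\<^sup>2 \<le> (\<Sum>i<K. (x i)\<^sup>2)" by (intro member_le_sum) auto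
      then show ?thesis using x by (simp add: z_def dot_def power2_eq_square True)
    qed (simp add: z_def)
    then have "z \<in> cube" by (auto simp: cube_def abs_square_le_1 abs_le_iff)
    moreover have "dot K z z = 1" using x(1) by (subst dot_cong[of K z x z x]) (auto simp: z_def)
    moreover have "dot K (u i) z = 0" if "i < m" for i
      using x(2) that by (subst dot_cong[of K "u i" "u i" z x]) (auto simp: z_def)
    ultimately have "z \<in> S" by (auto simp: S_def)
    moreover have "\<forall>i<K. z i = x i" by (simp add: z_def)
    ultimately show ?thesis by blast
  qed
  from exists_unit_orthogonal[OF assms] trunc have ne: "S \<noteq> {}" by blast
  have "continuous_on S (qform K A)" unfolding qform_def
    by (intro continuous_dot continuous_mulv continuous_on_subset[OF coord]) auto
  from continuous_attains_sup[OF comp ne this] obtain x where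
    x: "x \<in> S" "\<And>y. y \<in> S \<Longrightarrow> qform K A y \<le> qform K A x" by blast
  have "qform K A y \<le> qform K A x * dot K y y" if y: "\<forall>i<m. dot K (u i) y = 0" for y
  proof (cases "dot K y y = 0")
    case True
    then have "qform K A y = qform K A (\<lambda>_. 0)" by (intro qform_cong) (auto simp: dot_self_eq_0)
    then show ?thesis using True by (simp add: qform_def dot_def)
  next
    case False
    then have pos: "dot K y y > 0" using dot_self_nonneg[of K y] by linarith
    define c where "c = 1 / sqrt (dot K y y)"
    have "c * (c * dot K y y) = 1" using pos by (simp add: c_def divide_simps)
    then have "dot K (\<lambda>l. c * y l) (\<lambda>l. c * y l) = 1" by (simp add: dot_simps)
    moreover have "\<forall>j<m. dot K (u j) (\<lambda>l. c * y l) = 0"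
      using y by (simp add: dot_scale_right)
    ultimately obtain z where z: "z \<in> S" "\<forall>i<K. z i = c * y i" using trunc by blast
    have "c * c * qform K A y = qform K A (\<lambda>l. c * y l)"
      by (simp add: qform_def mulv_scale dot_simps)
    also have "\<dots> = qform K A z" using z by (intro qform_cong) auto
    also have "\<dots> \<le> qform K A x" by (rule x(2)[OF z(1)])
    finally show ?thesis using pos by (simp add: c_def field_simps)
  qed
  with x(1) show ?thesis unfolding S_def by blast
qed

lemma nonpos_quadratic_linear_coeff:
  fixes a b :: real
  assumes "\<And>t. 2 * t * a + t\<^sup>2 * b \<le> 0"
  shows "a = 0"
proof (rule ccontr)
  assume "a \<noteq> 0"
  define s where "s = \<bar>b\<bar> + 1"
  define t where "t = a / s"
  have s: "s > 0" "2 * s + b > 0" by (auto simp: s_def)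
  then have "2 * t * a + t\<^sup>2 * b = a\<^sup>2 * (2 * s + b) / s\<^sup>2"
    unfolding t_def by (simp add: field_simps power2_eq_square)
  also have "\<dots> > 0" using \<open>a \<noteq> 0\<close> s by (intro divide_pos_pos mult_pos_pos) auto
  finally show False using assms[of t] by linarith
qed

text \<open>The maximizer \<open>x\<close> of the Rayleigh quotient on the orthogonal complement is an eigenvector: with
\<open>y = A x - c x\<close>, where \<open>c\<close> is the maximum, the first-order condition in the direction \<open>y\<close> reads
\<open>y \<bullet> A x = 0\<close>, and \<open>y \<bullet> A x = |y|\<^sup>2\<close>.\<close>

lemma eigensystem_extend:
  assumes "sym_mat K A" and sys: "eigensystem K A m d u" and "m < K"
  shows "\<exists>d u. eigensystem K A (Suc m) d u"
proof -
  have on: "orthonormal K m u" and ev: "\<And>i l. i < m \<Longrightarrow> l < K \<Longrightarrow> mulv K A (u i) l = d i * u i l"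
    using sys by (auto simp: eigensystem_def)
  obtain x where x1: "dot K x x = 1" and xu: "\<And>i. i < m \<Longrightarrow> dot K (u i) x = 0"
    and max: "\<And>y. (\<forall>i<m. dot K (u i) y = 0) \<Longrightarrow> qform K A y \<le> qform K A x * dot K y y"
    using rayleigh_maximizer[OF on \<open>m < K\<close>, of A] by blast
  define c where "c = qform K A x"
  define y where "y = (\<lambda>l. mulv K A x l - c * x l)"
  have yx: "dot K y x = 0"
    using x1 by (simp add: y_def dot_simps c_def qform_def dot_commute)
  have yu: "dot K (u i) y = 0" if "i < m" for i
  proof -
    have "dot K (u i) (mulv K A x) = dot K (mulv K A (u i)) x"
      by (rule dot_mulv_sym[OF assms(1)])
    also have "\<dots> = dot K (\<lambda>l. d i * u i l) x" using ev that by (intro dot_cong) auto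
    also have "\<dots> = 0" using xu that by (simp add: dot_simps)
    finally show ?thesis using xu that by (simp add: y_def dot_simps)
  qed
  have "2 * t * dot K y (mulv K A x) + t\<^sup>2 * (qform K A y - c * dot K y y) \<le> 0" for t
  proof -
    have "qform K A (\<lambda>l. x l + t * y l) \<le> c * dot K (\<lambda>l. x l + t * y l) (\<lambda>l. x l + t * y l)"
      unfolding c_def by (rule max) (use xu yu in \<open>auto simp: dot_simps\<close>)
    also have "dot K (\<lambda>l. x l + t * y l) (\<lambda>l. x l + t * y l) = 1 + t\<^sup>2 * dot K y y"
      using x1 yx by (simp add: dot_simps dot_commute[of K x y] power2_eq_square)
    also have "qform K A (\<lambda>l. x l + t * y l)
        = c + 2 * t * dot K y (mulv K A x) + t\<^sup>2 * qform K A y"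
      using dot_mulv_sym[OF assms(1), of x y]
      by (simp add: qform_def mulv_add mulv_scale dot_simps c_def power2_eq_square
          dot_commute[of K "mulv K A x" y] algebra_simps)
    finally show ?thesis by (simp add: algebra_simps)
  qed
  then have "dot K y (mulv K A x) = 0" by (rule nonpos_quadratic_linear_coeff)
  moreover have "dot K y y = dot K y (mulv K A x) - c * dot K y x"
    by (subst (2) y_def) (simp add: dot_simps)
  ultimately have "dot K y y = 0" using yx by simp
  then have xe: "mulv K A x l = c * x l" if "l < K" for l
    using that by (simp add: dot_self_eq_0 y_def)
  have "eigensystem K A (Suc m) (d(m := c)) (u(m := x))"
    using on ev xe x1 xu
    by (auto simp: eigensystem_def orthonormal_def less_Suc_eq dot_commute[of K x "u j" for j])
  then show ?thesis by blast
qed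

lemma spectral_theorem:
  assumes "sym_mat K A"
  shows "\<exists>d u. eigensystem K A K d u"
proof -
  have "\<exists>d u. eigensystem K A m d u" if "m \<le> K" for m
    using that
  proof (induction m)
    case 0
    have "eigensystem K A 0 d u" for d u by (simp add: eigensystem_def orthonormal_def)
    then show ?case by blast
  next
    case (Suc m)
    then show ?case using eigensystem_extend[OF assms] by fastforce
  qed
  then show ?thesis by blast
qed

section \<open>Trace inequalities\<close>

lemma eigensystem_orthonormal: "eigensystem K A m d u \<Longrightarrow> orthonormal K m u"
  by (simp add: eigensystem_def)

lemma orthonormal_self: "orthonormal K m u \<Longrightarrow> i < m \<Longrightarrow> dot K (u i) (u i) = 1"
  by (simp add: orthonormal_def)

lemma eigensystem_mulv_left:
  assumes "eigensystem K A m d u" "i < m"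
  shows "dot K (mulv K A (u i)) x = d i * dot K (u i) x"
  using assms dot_cong[of K "mulv K A (u i)" "\<lambda>l. d i * u i l" x x]
  by (simp add: eigensystem_def dot_simps)

lemma eigensystem_mulv_right:
  assumes "sym_mat K A" "eigensystem K A m d u" "i < m"
  shows "dot K (u i) (mulv K A x) = d i * dot K (u i) x"
  using eigensystem_mulv_left[OF assms(2,3)] by (simp add: dot_mulv_sym[OF assms(1)])

lemma qform_eigensystem:
  assumes "sym_mat K A" "eigensystem K A K d u"
  shows "qform K A x = (\<Sum>i<K. d i * (dot K (u i) x)\<^sup>2)"
  using parseval[OF eigensystem_orthonormal[OF assms(2)], of x "mulv K A x"]
  by (simp add: qform_def eigensystem_mulv_right[OF assms] power2_eq_square algebra_simps)

lemma mulv_norm_eigensystem: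
  assumes "sym_mat K A" "eigensystem K A K d u"
  shows "dot K (mulv K A x) (mulv K A x) = (\<Sum>i<K. (d i)\<^sup>2 * (dot K (u i) x)\<^sup>2)"
  using parseval[OF eigensystem_orthonormal[OF assms(2)], of "mulv K A x" "mulv K A x"]
  by (simp add: eigensystem_mulv_right[OF assms] power2_eq_square algebra_simps)

lemma norm_orthonormal:
  assumes "orthonormal K K u"
  shows "dot K x x = (\<Sum>i<K. (dot K (u i) x)\<^sup>2)"
  using parseval[OF assms, of x x] by (simp add: power2_eq_square)

text \<open>The operator inequality \<open>A\<^sup>2 \<le> R A\<close> for \<open>0 \<le> A \<le> R I\<close>.\<close>

lemma mulv_norm_le_qform:
  assumes "sym_mat K A"
    and "\<And>x. 0 \<le> qform K A x" and "\<And>x. qform K A x \<le> R * dot K x x"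
  shows "dot K (mulv K A x) (mulv K A x) \<le> R * qform K A x"
proof -
  obtain d u where sys: "eigensystem K A K d u" using spectral_theorem[OF assms(1)] by blast
  have "qform K A (u i) = d i" if "i < K" for i
    using that eigensystem_mulv_right[OF assms(1) sys that, of "u i"]
      orthonormal_self[OF eigensystem_orthonormal[OF sys] that]
    by (simp add: qform_def)
  then have d: "0 \<le> d i" "d i \<le> R" if "i < K" for i
    using that assms(2)[of "u i"] assms(3)[of "u i"]
      orthonormal_self[OF eigensystem_orthonormal[OF sys] that] by auto
  have "(\<Sum>i<K. (d i)\<^sup>2 * (dot K (u i) x)\<^sup>2) \<le> (\<Sum>i<K. R * (d i * (dot K (u i) x)\<^sup>2))"
    unfolding power2_eq_square[of "d _"] mult.assoc
    by (intro sum_mono mult_right_mono d) (auto intro!: mult_nonneg_nonneg d)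
  then show ?thesis
    by (simp add: mulv_norm_eigensystem[OF assms(1) sys] qform_eigensystem[OF assms(1) sys]
        sum_distrib_left)
qed

definition eigval :: "nat \<Rightarrow> (nat \<Rightarrow> nat \<Rightarrow> real) \<Rightarrow> nat \<Rightarrow> real" where
  "eigval K A = fst (SOME p. eigensystem K A K (fst p) (snd p))"

definition eigvec :: "nat \<Rightarrow> (nat \<Rightarrow> nat \<Rightarrow> real) \<Rightarrow> nat \<Rightarrow> nat \<Rightarrow> real" where
  "eigvec K A = snd (SOME p. eigensystem K A K (fst p) (snd p))"

lemma eigensystem_eig:
  assumes "sym_mat K A"
  shows "eigensystem K A K (eigval K A) (eigvec K A)"
proof -
  obtain d u where "eigensystem K A K (fst (d, u)) (snd (d, u))"
    using spectral_theorem[OF assms] by auto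
  then show ?thesis unfolding eigval_def eigvec_def by (rule someI)
qed

lemma eigvec_orthonormal: "sym_mat K A \<Longrightarrow> orthonormal K K (eigvec K A)"
  using eigensystem_eig eigensystem_orthonormal by blast

lemma eigvec_unit: "sym_mat K A \<Longrightarrow> i < K \<Longrightarrow> dot K (eigvec K A i) (eigvec K A i) = 1"
  using orthonormal_self[OF eigvec_orthonormal] by blast

text \<open>The three definitions below are \<open>tr A\<^sup>s\<close>, \<open>tr (A B\<^sup>s)\<close> and \<open>tr (A\<^sup>2 B\<^sup>s)\<close>, evaluated in an eigenbasis of the
matrix that carries the power. The last two are linear and quadratic in \<open>A\<close> whatever its spectrum.\<close>

definition trace_pow :: "nat \<Rightarrow> nat \<Rightarrow> (nat \<Rightarrow> nat \<Rightarrow> real) \<Rightarrow> real" where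
  "trace_pow K s A = (\<Sum>i<K. eigval K A i ^ s)"

definition trace_mult_pow ::
  "nat \<Rightarrow> nat \<Rightarrow> (nat \<Rightarrow> nat \<Rightarrow> real) \<Rightarrow> (nat \<Rightarrow> nat \<Rightarrow> real) \<Rightarrow> real" where
  "trace_mult_pow K s A B = (\<Sum>i<K. eigval K B i ^ s * qform K A (eigvec K B i))"

definition trace_sq_mult_pow ::
  "nat \<Rightarrow> nat \<Rightarrow> (nat \<Rightarrow> nat \<Rightarrow> real) \<Rightarrow> (nat \<Rightarrow> nat \<Rightarrow> real) \<Rightarrow> real" where
  "trace_sq_mult_pow K s A B =
     (\<Sum>i<K. eigval K B i ^ s * dot K (mulv K A (eigvec K B i)) (mulv K A (eigvec K B i)))"

lemma trace_pow_0: "trace_pow K 0 A = real K"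
  by (simp add: trace_pow_def)

lemma trace_pow_nonneg: "even s \<Longrightarrow> 0 \<le> trace_pow K s A"
  by (auto simp: trace_pow_def intro!: sum_nonneg zero_le_even_power)

lemma qform_eigvec:
  assumes "sym_mat K A" "i < K"
  shows "qform K A (eigvec K A i) = eigval K A i"
  using eigensystem_mulv_right[OF assms(1) eigensystem_eig[OF assms(1)] assms(2), of "eigvec K A i"]
  by (simp add: qform_def eigvec_unit[OF assms])

lemma trace_mult_pow_self:
  "sym_mat K A \<Longrightarrow> trace_mult_pow K s A A = trace_pow K (Suc s) A"
  by (simp add: trace_mult_pow_def trace_pow_def qform_eigvec mult.commute)

lemma trace_mult_pow_sum:
  "trace_mult_pow K s (\<lambda>a b. \<Sum>j\<in>J. F j a b) B = (\<Sum>j\<in>J. trace_mult_pow K s (F j) B)"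
  unfolding trace_mult_pow_def qform_sum_mat sum_distrib_left by (rule sum.swap)

lemma trace_mult_pow_scale:
  "trace_mult_pow K s (\<lambda>a b. c * A a b) B = c * trace_mult_pow K s A B"
  by (simp add: trace_mult_pow_def qform_scale_mat sum_distrib_left algebra_simps)

lemma trace_mult_pow_le:
  assumes "even s" "sym_mat K B" "\<And>x. qform K A x \<le> c * dot K x x"
  shows "trace_mult_pow K s A B \<le> c * trace_pow K s B"
proof -
  have "qform K A (eigvec K B i) \<le> c" if "i < K" for i
    using assms(3)[of "eigvec K B i"] eigvec_unit[OF assms(2) that] by simp
  then show ?thesis unfolding trace_mult_pow_def trace_pow_def sum_distrib_left
    using assms(1)
    by (intro sum_mono) (simp add: mult.commute[of c] mult_left_mono zero_le_even_power)
qed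

text \<open>In the eigenbases \<open>u\<^sub>i\<close> of \<open>X\<close> and \<open>v\<^sub>j\<close> of \<open>Y\<close>, the traces below become averages of scalar expressions
in the eigenvalues \<open>x\<^sub>i\<close>, \<open>y\<^sub>j\<close> with the nonnegative weights \<open>(u\<^sub>i \<bullet> v\<^sub>j)\<^sup>2\<close>. Scalar inequalities in two
variables thereby carry over to traces of noncommuting matrices.\<close>

lemma double_spectral_sums:
  assumes X: "sym_mat K X" and Y: "sym_mat K Y"
  defines "w \<equiv> \<lambda>i j. (dot K (eigvec K X i) (eigvec K Y j))\<^sup>2"
    and "x \<equiv> eigval K X" and "y \<equiv> eigval K Y" and "D \<equiv> \<lambda>a b. X a b - Y a b"
  shows trace_pow_double1: "trace_pow K s X = (\<Sum>i<K. \<Sum>j<K. w i j * x i ^ s)"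
    and trace_pow_double2: "trace_pow K s Y = (\<Sum>i<K. \<Sum>j<K. w i j * y j ^ s)"
    and trace_mult_pow_double1:
      "trace_mult_pow K s D X = (\<Sum>i<K. \<Sum>j<K. w i j * (x i ^ s * (x i - y j)))"
    and trace_mult_pow_double2:
      "trace_mult_pow K s D Y = (\<Sum>i<K. \<Sum>j<K. w i j * (y j ^ s * (x i - y j)))"
    and trace_sq_mult_pow_double1:
      "trace_sq_mult_pow K s D X = (\<Sum>i<K. \<Sum>j<K. w i j * (x i ^ s * (x i - y j)\<^sup>2))"
    and trace_sq_mult_pow_double2:
      "trace_sq_mult_pow K s D Y = (\<Sum>i<K. \<Sum>j<K. w i j * (y j ^ s * (x i - y j)\<^sup>2))"
proof -
  let ?u = "eigvec K X" and ?v = "eigvec K Y"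
  note sx = eigensystem_eig[OF X] and sy = eigensystem_eig[OF Y]
  note ox = eigvec_orthonormal[OF X] and oy = eigvec_orthonormal[OF Y]
  have wx: "(\<Sum>j<K. w i j) = 1" if "i < K" for i
    using norm_orthonormal[OF oy, of "?u i"] eigvec_unit[OF X that]
    by (simp add: w_def dot_commute)
  have wy: "(\<Sum>i<K. w i j) = 1" if "j < K" for j
    using norm_orthonormal[OF ox, of "?v j"] eigvec_unit[OF Y that]
    by (simp add: w_def)
  show "trace_pow K s X = (\<Sum>i<K. \<Sum>j<K. w i j * x i ^ s)"
    by (simp add: sum_distrib_right[symmetric] wx trace_pow_def x_def)
  show "trace_pow K s Y = (\<Sum>i<K. \<Sum>j<K. w i j * y j ^ s)"
    by (subst sum.swap) (simp add: sum_distrib_right[symmetric] wy trace_pow_def y_def)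
  \<comment> \<open>Weights that sum to one leave the eigenvalue of the other matrix unchanged.\<close>
  have split: "(\<Sum>j\<in>J. f j * (c - g j)) = c * (\<Sum>j\<in>J. f j) - (\<Sum>j\<in>J. g j * f j)"
    and split': "(\<Sum>j\<in>J. f j * (g j - c)) = (\<Sum>j\<in>J. g j * f j) - c * (\<Sum>j\<in>J. f j)"
    for J :: "nat set" and f g :: "nat \<Rightarrow> real" and c
    by (simp_all add: algebra_simps sum_subtractf sum_distrib_left)
  have qx: "qform K D (?u i) = (\<Sum>j<K. w i j * (x i - y j))" if "i < K" for i
    using wx[OF that] qform_eigvec[OF X that] qform_eigensystem[OF Y sy, of "?u i"]
    unfolding split by (simp add: D_def qform_diff_mat x_def y_def w_def dot_commute)
  have qy: "qform K D (?v j) = (\<Sum>i<K. w i j * (x i - y j))" if "j < K" for j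
    using wy[OF that] qform_eigvec[OF Y that] qform_eigensystem[OF X sx, of "?v j"]
    unfolding split' by (simp add: D_def qform_diff_mat x_def y_def w_def)
  have ux: "dot K z (mulv K D (?u i)) = x i * dot K z (?u i) - dot K z (mulv K Y (?u i))"
    if "i < K" for i z
    using eigensystem_mulv_left[OF sx that, of z]
    by (simp add: D_def mulv_diff_mat dot_simps x_def dot_commute[of K _ z])
  have vy: "dot K z (mulv K D (?v j)) = dot K z (mulv K X (?v j)) - y j * dot K z (?v j)"
    if "j < K" for j z
    using eigensystem_mulv_left[OF sy that, of z]
    by (simp add: D_def mulv_diff_mat dot_simps y_def dot_commute[of K _ z])
  have mx: "dot K (mulv K D (?u i)) (mulv K D (?u i)) = (\<Sum>j<K. w i j * (x i - y j)\<^sup>2)"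
    if "i < K" for i
    unfolding norm_orthonormal[OF oy, of "mulv K D (?u i)"]
  proof (intro sum.cong refl)
    fix j assume "j \<in> {..<K}"
    then have "dot K (?v j) (mulv K D (?u i)) = (x i - y j) * dot K (?u i) (?v j)"
      using eigensystem_mulv_right[OF Y sy, of j "?u i"]
      by (simp add: ux[OF that] y_def dot_commute[of K "?v j" "?u i"] left_diff_distrib)
    then show "(dot K (?v j) (mulv K D (?u i)))\<^sup>2 = w i j * (x i - y j)\<^sup>2"
      by (simp add: w_def power_mult_distrib)
  qed
  have my: "dot K (mulv K D (?v j)) (mulv K D (?v j)) = (\<Sum>i<K. w i j * (x i - y j)\<^sup>2)"
    if "j < K" for j
    unfolding norm_orthonormal[OF ox, of "mulv K D (?v j)"]
  proof (intro sum.cong refl)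
    fix i assume "i \<in> {..<K}"
    then have "dot K (?u i) (mulv K D (?v j)) = (x i - y j) * dot K (?u i) (?v j)"
      using eigensystem_mulv_right[OF X sx, of i "?v j"]
      by (simp add: vy[OF that] x_def left_diff_distrib)
    then show "(dot K (?u i) (mulv K D (?v j)))\<^sup>2 = w i j * (x i - y j)\<^sup>2"
      by (simp add: w_def power_mult_distrib)
  qed
  show "trace_mult_pow K s D X = (\<Sum>i<K. \<Sum>j<K. w i j * (x i ^ s * (x i - y j)))"
    unfolding trace_mult_pow_def
    by (intro sum.cong refl) (simp add: qx sum_distrib_left x_def mult.left_commute)
  show "trace_mult_pow K s D Y = (\<Sum>i<K. \<Sum>j<K. w i j * (y j ^ s * (x i - y j)))"
    unfolding trace_mult_pow_def
    by (subst sum.swap, intro sum.cong refl) (simp add: qy sum_distrib_left y_def mult.left_commute)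
  show "trace_sq_mult_pow K s D X = (\<Sum>i<K. \<Sum>j<K. w i j * (x i ^ s * (x i - y j)\<^sup>2))"
    unfolding trace_sq_mult_pow_def
    by (intro sum.cong refl) (simp add: mx sum_distrib_left x_def mult.left_commute)
  show "trace_sq_mult_pow K s D Y = (\<Sum>i<K. \<Sum>j<K. w i j * (y j ^ s * (x i - y j)\<^sup>2))"
    unfolding trace_sq_mult_pow_def
    by (subst sum.swap, intro sum.cong refl) (simp add: my sum_distrib_left y_def mult.left_commute)
qed

text \<open>Each of the \<open>s + 1\<close> terms of \<open>(x\<^sup>s\<^sup>+\<^sup>1 - y\<^sup>s\<^sup>+\<^sup>1) / (x - y)\<close> is at most \<open>max |x| |y|\<^sup>s \<le> x\<^sup>s + y\<^sup>s\<close>.\<close>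

lemma odd_power_mean_value:
  fixes x y :: real
  assumes "even s"
  shows "(x - y) * (x ^ Suc s - y ^ Suc s) \<le> real (Suc s) * ((x - y)\<^sup>2 * (x ^ s + y ^ s))"
proof -
  have "(x ^ Suc s - y ^ Suc s) = (x - y) * (\<Sum>p<Suc s. x ^ p * y ^ (s - p))"
    using power_diff_sumr2[of x "Suc s" y]
    by (simp add: mult.commute del: sum.lessThan_Suc power_Suc)
  then have "(x - y) * (x ^ Suc s - y ^ Suc s) = (x - y)\<^sup>2 * (\<Sum>p<Suc s. x ^ p * y ^ (s - p))"
    by (simp add: power2_eq_square mult.assoc)
  also have "\<dots> \<le> (x - y)\<^sup>2 * (\<Sum>p<Suc s. x ^ s + y ^ s)"
  proof (intro mult_left_mono sum_mono)
    fix p assume p: "p \<in> {..<Suc s}"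
    define c where "c = max \<bar>x\<bar> \<bar>y\<bar>"
    have "x ^ p * y ^ (s - p) \<le> \<bar>x\<bar> ^ p * \<bar>y\<bar> ^ (s - p)"
      by (metis abs_ge_self abs_mult power_abs)
    also have "\<dots> \<le> c ^ p * c ^ (s - p)"
      by (intro mult_mono power_mono) (auto simp: c_def)
    also have "\<dots> = c ^ s" using p by (simp add: power_add[symmetric])
    also have "\<dots> \<le> x ^ s + y ^ s"
      using assms by (auto simp: c_def max_def power_even_abs zero_le_even_power)
    finally show "x ^ p * y ^ (s - p) \<le> x ^ s + y ^ s" .
  qed simp
  also have "\<dots> = real (Suc s) * ((x - y)\<^sup>2 * (x ^ s + y ^ s))"
    by (simp del: sum.lessThan_Suc)
  finally show ?thesis .
qed

lemma trace_mean_value: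
  assumes "sym_mat K X" "sym_mat K Y" "even s"
  defines "D \<equiv> \<lambda>a b. X a b - Y a b"
  shows "trace_mult_pow K (Suc s) D X - trace_mult_pow K (Suc s) D Y
    \<le> real (Suc s) * (trace_sq_mult_pow K s D X + trace_sq_mult_pow K s D Y)"
  unfolding D_def trace_mult_pow_double1[OF assms(1,2)] trace_mult_pow_double2[OF assms(1,2)]
    trace_sq_mult_pow_double1[OF assms(1,2)] trace_sq_mult_pow_double2[OF assms(1,2)]
    sum_subtractf[symmetric] sum.distrib[symmetric] sum_distrib_left
proof (intro sum_mono)
  fix i j
  let ?w = "(dot K (eigvec K X i) (eigvec K Y j))\<^sup>2" and ?x = "eigval K X i" and ?y = "eigval K Y j"
  have "?w * ((?x - ?y) * (?x ^ Suc s - ?y ^ Suc s))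
      \<le> ?w * (real (Suc s) * ((?x - ?y)\<^sup>2 * (?x ^ s + ?y ^ s)))"
    by (intro mult_left_mono odd_power_mean_value assms) simp
  then show "?w * (?x ^ Suc s * (?x - ?y)) - ?w * (?y ^ Suc s * (?x - ?y))
      \<le> real (Suc s) * (?w * (?x ^ s * (?x - ?y)\<^sup>2) + ?w * (?y ^ s * (?x - ?y)\<^sup>2))"
    by (simp only: algebra_simps)
qed

text \<open>Bernoulli's inequality for \<open>x / y\<close>; for even exponents it holds without a lower bound on the base.\<close>

lemma even_power_tangent:
  fixes x y :: real
  assumes "even s" "0 < s"
  shows "y ^ s + real s * (y ^ (s - 1) * (x - y)) \<le> x ^ s"
proof (cases "y = 0")
  case True
  then show ?thesis using assms by (cases "s = 1") (auto simp: zero_le_even_power power_0_left)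
next
  case False
  have "1 + real s * (x / y - 1) \<le> (1 + (x / y - 1)) ^ s"
    by (rule Bernoulli_inequality_even) (rule assms)
  then have "y ^ s * (1 + real s * (x / y - 1)) \<le> y ^ s * (x / y) ^ s"
    using assms by (intro mult_left_mono) (auto simp: zero_le_even_power)
  moreover have "y ^ s * (x / y) ^ s = x ^ s" using False by (simp add: power_divide)
  moreover have "y ^ s = y ^ (s - 1) * y" using assms(2) by (cases s) auto
  then have "y ^ s * (1 + real s * (x / y - 1)) = y ^ s + real s * (y ^ (s - 1) * (x - y))"
    using False by (simp add: field_simps)
  ultimately show ?thesis by simp
qed

text \<open>Klein's inequality for the convex function \<open>x\<^sup>s\<close>. It serves to compare the moments of the sum with those
of the sum without one independent centred summand: the linear term has expectation zero.\<close>

lemma klein_even_power: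
  assumes "sym_mat K X" "sym_mat K Y" "even s" "0 < s"
  defines "D \<equiv> \<lambda>a b. X a b - Y a b"
  shows "trace_pow K s Y + real s * trace_mult_pow K (s - 1) D Y \<le> trace_pow K s X"
  unfolding D_def trace_mult_pow_double2[OF assms(1,2)] trace_pow_double1[OF assms(1,2)]
    trace_pow_double2[OF assms(1,2)] sum.distrib[symmetric] sum_distrib_left
proof (intro sum_mono)
  fix i j
  let ?w = "(dot K (eigvec K X i) (eigvec K Y j))\<^sup>2" and ?x = "eigval K X i" and ?y = "eigval K Y j"
  have "?w * (?y ^ s + real s * (?y ^ (s - 1) * (?x - ?y))) \<le> ?w * ?x ^ s"
    by (intro mult_left_mono even_power_tangent assms) simp
  then show "?w * ?y ^ s + real s * (?w * (?y ^ (s - 1) * (?x - ?y))) \<le> ?w * ?x ^ s"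
    by (simp only: algebra_simps)
qed

text \<open>The arithmetic-geometric mean inequality, which removes the odd moment from the recursion. The
factor \<open>1/2\<close> in front of the highest moment lets that term be absorbed on the left.\<close>

lemma trace_pow_interpolate:
  assumes "even s"
  shows "2 * a * trace_pow K (Suc s) A
    \<le> trace_pow K (s + 2) A / 2 + 2 * a\<^sup>2 * trace_pow K s A"
  unfolding trace_pow_def sum_distrib_left sum_divide_distrib sum.distrib[symmetric]
proof (intro sum_mono)
  fix i
  let ?x = "eigval K A i"
  have "0 \<le> ?x ^ s * (?x - 2 * a)\<^sup>2 / 2" using assms by (simp add: zero_le_even_power)
  then show "2 * a * ?x ^ Suc s \<le> ?x ^ (s + 2) / 2 + 2 * a\<^sup>2 * ?x ^ s"
    by (simp add: power2_eq_square algebra_simps)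
qed

lemma mulv_norm_pow_le_trace_pow:
  assumes "sym_mat K A" "0 < K"
  shows "dot K (mulv K A x) (mulv K A x) ^ p \<le> trace_pow K (2 * p) A * dot K x x ^ p"
proof -
  let ?d = "eigval K A" and ?u = "eigvec K A"
  note sys = eigensystem_eig[OF assms(1)]
  define m where "m = Max ((\<lambda>i. (?d i)\<^sup>2) ` {..<K})"
  have "m \<in> (\<lambda>i. (?d i)\<^sup>2) ` {..<K}" unfolding m_def using assms(2) by (intro Max_in) auto
  then obtain k where k: "k < K" "m = (?d k)\<^sup>2" by auto
  have le: "(?d i)\<^sup>2 \<le> m" if "i < K" for i unfolding m_def using that by (intro Max_ge) auto
  have "dot K (mulv K A x) (mulv K A x) \<le> (\<Sum>i<K. m * (dot K (?u i) x)\<^sup>2)"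
    unfolding mulv_norm_eigensystem[OF assms(1) sys]
    by (intro sum_mono mult_right_mono le) auto
  also have "\<dots> = m * dot K x x"
    by (simp add: norm_orthonormal[OF eigvec_orthonormal[OF assms(1)], of x] sum_distrib_left)
  finally have "dot K (mulv K A x) (mulv K A x) ^ p \<le> (m * dot K x x) ^ p"
    by (intro power_mono) auto
  also have "\<dots> = ?d k ^ (2 * p) * dot K x x ^ p"
    by (simp add: k power_mult_distrib power_mult)
  also have "\<dots> \<le> trace_pow K (2 * p) A * dot K x x ^ p"
    unfolding trace_pow_def using k
    by (intro mult_right_mono member_le_sum) (auto simp: zero_le_even_power power_mult)
  finally show ?thesis .
qed

section \<open>Expectation under a finite product law\<close>

definition prod_expect ::
  "'j set \<Rightarrow> ('j \<Rightarrow> 'c set) \<Rightarrow> ('j \<Rightarrow> 'c \<Rightarrow> real) \<Rightarrow> (('j \<Rightarrow> 'c) \<Rightarrow> real) \<Rightarrow> real" where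
  "prod_expect I S w f = (\<Sum>z\<in>Pi\<^sub>E I S. (\<Prod>j\<in>I. w j (z j)) * f z)"

lemma sum_PiE_insert:
  assumes "j \<notin> I"
  shows "(\<Sum>z\<in>Pi\<^sub>E (insert j I) S. f z) = (\<Sum>y\<in>S j. \<Sum>z\<in>Pi\<^sub>E I S. f (z(j := y)))"
  unfolding PiE_insert_eq sum.reindex[OF inj_combinator[OF assms]]
  by (simp add: sum.cartesian_product o_def case_prod_unfold)

text \<open>Drawing the coordinate \<open>j\<close> afresh from its marginal does not change the product law. This form of
Fubini's theorem keeps the index set, so it also expresses independence of the coordinate \<open>j\<close> from
functions that ignore it.\<close>

lemma prod_expect_resample:
  assumes "finite I" "j \<in> I" and one: "(\<Sum>y\<in>S j. w j y) = 1"
  shows "prod_expect I S w f = prod_expect I S w (\<lambda>z. \<Sum>y\<in>S j. w j y * f (z(j := y)))"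
proof -
  define J where "J = I - {j}"
  have J: "j \<notin> J" "finite J" "I = insert j J" using assms by (auto simp: J_def)
  have prod: "(\<Prod>i\<in>I. w i ((z(j := y)) i)) = w j y * (\<Prod>i\<in>J. w i (z i))" for z y
    using J by (auto intro!: prod.cong)
  have *: "prod_expect I S w g
      = (\<Sum>z\<in>Pi\<^sub>E J S. (\<Prod>i\<in>J. w i (z i)) * (\<Sum>y\<in>S j. w j y * g (z(j := y))))" for g
    unfolding prod_expect_def
    by (subst J(3), subst sum_PiE_insert[OF J(1)])
      (subst sum.swap, simp add: prod sum_distrib_left mult.assoc mult.left_commute
        del: fun_upd_apply)
  show ?thesis unfolding * by (simp add: one sum_distrib_right[symmetric])
qed

locale product_weights =
  fixes I :: "'j set" and S :: "'j \<Rightarrow> 'c set" and w :: "'j \<Rightarrow> 'c \<Rightarrow> real"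
  assumes finite_index: "finite I"
    and finite_values: "\<And>j. j \<in> I \<Longrightarrow> finite (S j)"
    and weight_nonneg: "\<And>j y. j \<in> I \<Longrightarrow> y \<in> S j \<Longrightarrow> 0 \<le> w j y"
    and weight_total: "\<And>j. j \<in> I \<Longrightarrow> (\<Sum>y\<in>S j. w j y) = 1"
begin

abbreviation "E \<equiv> prod_expect I S w"

lemma expect_mono: "(\<And>z. z \<in> Pi\<^sub>E I S \<Longrightarrow> f z \<le> g z) \<Longrightarrow> E f \<le> E g"
  unfolding prod_expect_def
  by (intro sum_mono mult_left_mono prod_nonneg) (auto intro: weight_nonneg dest: PiE_mem)

lemma expect_add: "E (\<lambda>z. f z + g z) = E f + E g"
  and expect_diff: "E (\<lambda>z. f z - g z) = E f - E g"
  and expect_scale: "E (\<lambda>z. c * f z) = c * E f"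
  by (simp_all add: prod_expect_def algebra_simps sum.distrib sum_subtractf sum_distrib_left)

lemma expect_sum: "E (\<lambda>z. \<Sum>j\<in>J. f j z) = (\<Sum>j\<in>J. E (f j))"
  unfolding prod_expect_def sum_distrib_left by (rule sum.swap)

lemma expect_const: "E (\<lambda>_. c) = c"
  using prod_sum_PiE[where f = w and A = I and B = S, OF finite_index finite_values]
  by (simp add: prod_expect_def sum_distrib_right[symmetric] weight_total)

lemma expect_cong: "(\<And>z. z \<in> Pi\<^sub>E I S \<Longrightarrow> f z = g z) \<Longrightarrow> E f = E g"
  by (simp add: prod_expect_def)

lemma expect_resample: "j \<in> I \<Longrightarrow> E f = E (\<lambda>z. \<Sum>y\<in>S j. w j y * f (z(j := y)))"
  by (rule prod_expect_resample[OF finite_index]) (auto intro: weight_total)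

lemma expect_resample_le:
  assumes "j \<in> I" "\<And>z. z \<in> Pi\<^sub>E I S \<Longrightarrow> (\<Sum>y\<in>S j. w j y * f (z(j := y))) \<le> g z"
  shows "E f \<le> E g"
  by (subst expect_resample[OF assms(1)]) (rule expect_mono, rule assms)

end

section \<open>Moments of sums of independent positive semidefinite matrices\<close>

locale independent_psd =
  product_weights I S w for I :: "'j set" and S :: "'j \<Rightarrow> (nat \<Rightarrow> nat \<Rightarrow> real) set" and w +
  fixes K :: nat and R :: real and c :: "'j \<Rightarrow> real"
  assumes R_nonneg: "0 \<le> R"
    and sym_value: "\<And>j A. j \<in> I \<Longrightarrow> A \<in> S j \<Longrightarrow> sym_mat K A"
    and qform_value_nonneg: "\<And>j A x. j \<in> I \<Longrightarrow> A \<in> S j \<Longrightarrow> 0 \<le> qform K A x"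
    and qform_value_le: "\<And>j A x. j \<in> I \<Longrightarrow> A \<in> S j \<Longrightarrow> qform K A x \<le> R * dot K x x"
    and qform_mean_le:
      "\<And>j x. j \<in> I \<Longrightarrow> qform K (\<lambda>a b. \<Sum>A\<in>S j. w j A * A a b) x \<le> c j * dot K x x"
begin

definition mean :: "'j \<Rightarrow> nat \<Rightarrow> nat \<Rightarrow> real" where
  "mean j = (\<lambda>a b. \<Sum>A\<in>S j. w j A * A a b)"

definition centred_sum :: "('j \<Rightarrow> nat \<Rightarrow> nat \<Rightarrow> real) \<Rightarrow> nat \<Rightarrow> nat \<Rightarrow> real" where
  "centred_sum z = (\<lambda>a b. \<Sum>j\<in>I. z j a b - mean j a b)"

abbreviation summand :: "'j \<Rightarrow> ('j \<Rightarrow> nat \<Rightarrow> nat \<Rightarrow> real) \<Rightarrow> nat \<Rightarrow> nat \<Rightarrow> real" where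
  "summand j z \<equiv> \<lambda>a b. z j a b - mean j a b"

definition others :: "'j \<Rightarrow> ('j \<Rightarrow> nat \<Rightarrow> nat \<Rightarrow> real) \<Rightarrow> nat \<Rightarrow> nat \<Rightarrow> real" where
  "others j z = (\<lambda>a b. \<Sum>i\<in>I - {j}. z i a b - mean i a b)"

lemma qform_mean: "qform K (mean j) x = (\<Sum>A\<in>S j. w j A * qform K A x)"
  by (simp add: mean_def qform_sum_mat qform_scale_mat)

lemma sym_mean: "j \<in> I \<Longrightarrow> sym_mat K (mean j)"
  using sym_value by (auto simp: sym_mat_def mean_def intro!: sum.cong)

lemma qform_mean_nonneg: "j \<in> I \<Longrightarrow> 0 \<le> qform K (mean j) x"
  unfolding qform_mean
  by (intro sum_nonneg mult_nonneg_nonneg) (auto intro: weight_nonneg qform_value_nonneg)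

lemma qform_mean_le_R:
  assumes "j \<in> I"
  shows "qform K (mean j) x \<le> R * dot K x x"
proof -
  have "qform K (mean j) x \<le> (\<Sum>A\<in>S j. w j A * (R * dot K x x))"
    unfolding qform_mean using assms
    by (intro sum_mono mult_left_mono) (auto intro: weight_nonneg qform_value_le)
  then show ?thesis by (simp add: sum_distrib_right[symmetric] weight_total[OF assms])
qed

lemma sym_sum:
  assumes "z \<in> Pi\<^sub>E I S" "J \<subseteq> I"
  shows "sym_mat K (\<lambda>a b. \<Sum>j\<in>J. z j a b - mean j a b)"
proof -
  have "z j a b = z j b a" "mean j a b = mean j b a" if "j \<in> J" "a < K" "b < K" for j a b
    using that assms sym_value[of j "z j"] sym_mean[of j] PiE_mem[OF assms(1)]
    by (auto simp: sym_mat_def)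
  then show ?thesis by (simp add: sym_mat_def)
qed

lemma sym_centred_sum: "z \<in> Pi\<^sub>E I S \<Longrightarrow> sym_mat K (centred_sum z)"
  and sym_others: "z \<in> Pi\<^sub>E I S \<Longrightarrow> sym_mat K (others j z)"
  unfolding centred_sum_def others_def by (rule sym_sum; auto)+

lemma centred_sum_minus_others:
  assumes "j \<in> I"
  shows "(\<lambda>a b. centred_sum z a b - others j z a b) = summand j z"
  using sum.remove[OF finite_index assms, of "\<lambda>i. z i a b - mean i a b" for a b]
  by (simp add: centred_sum_def others_def)

lemma others_update: "others j (z(j := y)) = others j z"
  by (simp add: others_def)

text \<open>The centred summand \<open>j\<close> is independent of the sum of the others and enters the trace linearly.\<close>

lemma expect_trace_mult_others:
  assumes "j \<in> I"
  shows "E (\<lambda>z. trace_mult_pow K s (summand j z) (others j z)) = 0"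
proof -
  have zero: "(\<lambda>a b. \<Sum>A\<in>S j. w j A * (A a b - mean j a b)) = (\<lambda>a b. 0 * 0)"
    by (simp add: right_diff_distrib sum_subtractf sum_distrib_right[symmetric]
        weight_total[OF assms] mean_def)
  have "E (\<lambda>z. trace_mult_pow K s (summand j z) (others j z))
      = E (\<lambda>z. trace_mult_pow K s (\<lambda>a b. \<Sum>A\<in>S j. w j A * (A a b - mean j a b)) (others j z))"
    by (subst expect_resample[OF assms])
      (simp add: others_update trace_mult_pow_sum trace_mult_pow_scale)
  also have "\<dots> = E (\<lambda>_. 0)"
    unfolding zero trace_mult_pow_scale by simp
  finally show ?thesis by (simp add: expect_const)
qed

text \<open>\<open>E (A - E A)\<^sup>2 \<le> E A\<^sup>2 \<le> R E A\<close> as quadratic forms.\<close>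

lemma mulv_norm_variance:
  assumes "j \<in> I"
  shows "(\<Sum>A\<in>S j. w j A * dot K (mulv K (\<lambda>a b. A a b - mean j a b) x)
      (mulv K (\<lambda>a b. A a b - mean j a b) x)) \<le> R * qform K (mean j) x"
proof -
  let ?m = "mulv K (mean j) x"
  have m: "?m = (\<lambda>i. \<Sum>A\<in>S j. w j A * mulv K A x i)"
    by (simp add: mean_def mulv_sum_mat mulv_scale_mat)
  have cross: "(\<Sum>A\<in>S j. w j A * dot K (mulv K A x) ?m) = dot K ?m ?m"
    by (subst (2) m) (simp add: dot_simps)
  have "(\<Sum>A\<in>S j. w j A * dot K (mulv K (\<lambda>a b. A a b - mean j a b) x)
      (mulv K (\<lambda>a b. A a b - mean j a b) x))
    = (\<Sum>A\<in>S j. w j A * dot K (mulv K A x) (mulv K A x) - 2 * (w j A * dot K (mulv K A x) ?m)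
        + w j A * dot K ?m ?m)"
    by (intro sum.cong refl)
      (simp add: mulv_diff_mat dot_simps dot_commute algebra_simps)
  also have "\<dots> = (\<Sum>A\<in>S j. w j A * dot K (mulv K A x) (mulv K A x)) - dot K ?m ?m"
    by (simp add: sum.distrib sum_subtractf sum_distrib_left[symmetric] cross
        sum_distrib_right[symmetric] weight_total[OF assms])
  also have "\<dots> \<le> (\<Sum>A\<in>S j. w j A * dot K (mulv K A x) (mulv K A x))" by simp
  also have "\<dots> \<le> (\<Sum>A\<in>S j. w j A * (R * qform K A x))"
    using assms by (intro sum_mono mult_left_mono mulv_norm_le_qform weight_nonneg)
      (auto intro: sym_value qform_value_nonneg qform_value_le)
  also have "\<dots> = R * qform K (mean j) x"
    by (simp add: qform_mean sum_distrib_left mult.left_commute)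
  finally show ?thesis .
qed

lemma expect_trace_pow_others_le:
  assumes "j \<in> I" "even s"
  shows "E (\<lambda>z. trace_pow K s (others j z)) \<le> E (\<lambda>z. trace_pow K s (centred_sum z))"
proof (cases "s = 0")
  case False
  have "E (\<lambda>z. trace_pow K s (others j z))
      = E (\<lambda>z. trace_pow K s (others j z)
          + real s * trace_mult_pow K (s - 1) (summand j z) (others j z))"
    unfolding expect_add expect_scale expect_trace_mult_others[OF assms(1)] by simp
  also have "\<dots> \<le> E (\<lambda>z. trace_pow K s (centred_sum z))"
  proof (rule expect_mono)
    fix z assume z: "z \<in> Pi\<^sub>E I S"
    show "trace_pow K s (others j z)
        + real s * trace_mult_pow K (s - 1) (summand j z) (others j z)
      \<le> trace_pow K s (centred_sum z)"
      using klein_even_power[OF sym_centred_sum[OF z] sym_others[OF z] assms(2), of j] False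
      unfolding centred_sum_minus_others[OF assms(1)] by simp
  qed
  finally show ?thesis .
qed (simp add: trace_pow_0)

lemma expect_trace_sq_others_le:
  assumes "j \<in> I" "even s"
  shows "E (\<lambda>z. trace_sq_mult_pow K s (summand j z) (others j z))
    \<le> R * c j * E (\<lambda>z. trace_pow K s (centred_sum z))"
proof -
  have "c j * dot K x x \<ge> 0" for x
    using qform_mean_nonneg[OF assms(1), of x] qform_mean_le[OF assms(1), of x]
    unfolding mean_def by linarith
  have "E (\<lambda>z. trace_sq_mult_pow K s (summand j z) (others j z))
      \<le> E (\<lambda>z. R * c j * trace_pow K s (others j z))"
  proof (rule expect_resample_le[OF assms(1)])
    fix z assume z: "z \<in> Pi\<^sub>E I S"
    let ?B = "others j z"
    let ?v = "eigvec K ?B" and ?N = "\<lambda>A x. dot K (mulv K (\<lambda>a b. A a b - mean j a b) x)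
      (mulv K (\<lambda>a b. A a b - mean j a b) x)"
    have "(\<Sum>A\<in>S j. w j A * trace_sq_mult_pow K s (summand j (z(j := A))) (others j (z(j := A))))
        = (\<Sum>i<K. eigval K ?B i ^ s * (\<Sum>A\<in>S j. w j A * ?N A (?v i)))"
      by (simp add: others_update trace_sq_mult_pow_def sum_distrib_left mult.left_commute)
        (rule sum.swap)
    also have "\<dots> \<le> (\<Sum>i<K. eigval K ?B i ^ s * (R * c j))"
    proof (intro sum_mono mult_left_mono)
      fix i assume "i \<in> {..<K}"
      then have "qform K (mean j) (?v i) \<le> c j"
        using qform_mean_le[OF assms(1), of "?v i"] eigvec_unit[OF sym_others[OF z], of i j]
        by (simp add: mean_def)
      then show "(\<Sum>A\<in>S j. w j A * ?N A (?v i)) \<le> R * c j"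
        using mulv_norm_variance[OF assms(1), of "?v i"] R_nonneg
        by (meson mult_left_mono order_trans)
    qed (use assms in \<open>simp add: zero_le_even_power\<close>)
    also have "\<dots> = R * c j * trace_pow K s ?B"
      by (simp add: trace_pow_def sum_distrib_left mult.commute)
    finally show "(\<Sum>A\<in>S j. w j A * trace_sq_mult_pow K s (summand j (z(j := A)))
        (others j (z(j := A)))) \<le> R * c j * trace_pow K s ?B" .
  qed
  also have "\<dots> = R * c j * E (\<lambda>z. trace_pow K s (others j z))" by (rule expect_scale)
  also have "\<dots> \<le> R * c j * E (\<lambda>z. trace_pow K s (centred_sum z))"
  proof (cases "K = 0")
    case True
    then show ?thesis by (simp add: trace_pow_def)
  next
    case False
    define e where "e = (\<lambda>i::nat. if i = 0 then 1 else (0::real))"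
    have "dot K e e = 1" using False by (simp add: e_def dot_unit_vector)
    then have "0 \<le> c j" using \<open>\<And>x. c j * dot K x x \<ge> 0\<close>[of e] by simp
    then show ?thesis
      by (intro mult_left_mono expect_trace_pow_others_le assms mult_nonneg_nonneg R_nonneg)
  qed
  finally show ?thesis .
qed

text \<open>Here the total sum is not independent of the summand, but it carries the weight for all summands at
once: \<open>X\<^sub>j\<^sup>2 \<le> 2 R (A\<^sub>j + E A\<^sub>j) = 2 R (X\<^sub>j + 2 E A\<^sub>j)\<close>, and summing over \<open>j\<close> returns the sum itself and the
total mean.\<close>

lemma sum_trace_sq_le:
  assumes z: "z \<in> Pi\<^sub>E I S" and "even s"
  shows "(\<Sum>j\<in>I. trace_sq_mult_pow K s (summand j z) (centred_sum z))
    \<le> 2 * R * (trace_pow K (Suc s) (centred_sum z)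
        + 2 * (\<Sum>j\<in>I. c j) * trace_pow K s (centred_sum z))"
proof -
  let ?X = "centred_sum z"
  have "trace_sq_mult_pow K s (summand j z) ?X
      \<le> 2 * R * (trace_mult_pow K s (summand j z) ?X + 2 * trace_mult_pow K s (mean j) ?X)"
    if j: "j \<in> I" for j
    unfolding trace_sq_mult_pow_def trace_mult_pow_def sum_distrib_left sum.distrib[symmetric]
  proof (intro sum_mono)
    fix i
    let ?u = "eigvec K ?X i" and ?p = "eigval K ?X i ^ s"
    have zj: "z j \<in> S j" using z j by auto
    let ?a = "mulv K (z j) ?u" and ?b = "mulv K (mean j) ?u"
    have "dot K (mulv K (summand j z) ?u) (mulv K (summand j z) ?u)
        = 2 * dot K ?a ?a + 2 * dot K ?b ?b - dot K (\<lambda>i. ?a i + ?b i) (\<lambda>i. ?a i + ?b i)"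
      by (simp add: mulv_diff_mat dot_simps dot_commute)
    also have "\<dots> \<le> 2 * dot K ?a ?a + 2 * dot K ?b ?b" by simp
    also have "\<dots> \<le> 2 * (R * qform K (z j) ?u) + 2 * (R * qform K (mean j) ?u)"
      using j zj
      by (intro add_mono mult_left_mono mulv_norm_le_qform)
        (auto intro: sym_value qform_value_nonneg qform_value_le sym_mean qform_mean_nonneg
          qform_mean_le_R)
    also have "\<dots> = 2 * R * (qform K (summand j z) ?u + 2 * qform K (mean j) ?u)"
      by (simp add: qform_diff_mat algebra_simps)
    finally have "?p * dot K (mulv K (summand j z) ?u) (mulv K (summand j z) ?u)
        \<le> ?p * (2 * R * (qform K (summand j z) ?u + 2 * qform K (mean j) ?u))"
      using \<open>even s\<close> by (intro mult_left_mono) (auto simp: zero_le_even_power)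
    then show "?p * dot K (mulv K (summand j z) ?u) (mulv K (summand j z) ?u)
        \<le> 2 * R * (?p * qform K (summand j z) ?u + 2 * (?p * qform K (mean j) ?u))"
      by (simp add: algebra_simps)
  qed
  then have "(\<Sum>j\<in>I. trace_sq_mult_pow K s (summand j z) ?X)
      \<le> (\<Sum>j\<in>I. 2 * R * (trace_mult_pow K s (summand j z) ?X + 2 * trace_mult_pow K s (mean j) ?X))"
    by (rule sum_mono)
  also have "\<dots> = 2 * R * (trace_mult_pow K s ?X ?X + 2 * (\<Sum>j\<in>I. trace_mult_pow K s (mean j) ?X))"
    by (subst (3) centred_sum_def)
      (simp add: trace_mult_pow_sum sum_distrib_left[symmetric] sum.distrib)
  also have "\<dots> \<le> 2 * R * (trace_pow K (Suc s) ?X + 2 * (\<Sum>j\<in>I. c j * trace_pow K s ?X))"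
    unfolding trace_mult_pow_self[OF sym_centred_sum[OF z]]
    using R_nonneg \<open>even s\<close> sym_centred_sum[OF z] qform_mean_le
    by (intro mult_left_mono add_left_mono sum_mono trace_mult_pow_le) (auto simp: mean_def)
  finally show ?thesis by (simp add: sum_distrib_right mult.assoc)
qed

definition moment :: "nat \<Rightarrow> real" where
  "moment s = E (\<lambda>z. trace_pow K s (centred_sum z))"

lemma moment_nonneg: "even s \<Longrightarrow> 0 \<le> moment s"
  unfolding moment_def using expect_mono[of "\<lambda>_. 0"] expect_const[of 0] trace_pow_nonneg by metis

text \<open>\<open>E tr X\<^sup>s\<^sup>+\<^sup>2 = \<Sum>\<^sub>j E tr X\<^sub>j X\<^sup>s\<^sup>+\<^sup>1\<close>, and subtracting the vanishing \<open>E tr X\<^sub>j Y\<^sup>s\<^sup>+\<^sup>1\<close>, where \<open>Y\<close> omits the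
summand \<open>j\<close>, makes the mean value inequality applicable.\<close>

lemma moment_recursion:
  assumes "even s"
  shows "moment (s + 2) \<le> real (Suc s) *
    (2 * R * moment (Suc s) + 5 * R * (\<Sum>j\<in>I. c j) * moment s)"
proof -
  have "moment (s + 2) = E (\<lambda>z. \<Sum>j\<in>I. trace_mult_pow K (Suc s) (summand j z) (centred_sum z))"
    unfolding moment_def
  proof (rule expect_cong)
    fix z assume z: "z \<in> Pi\<^sub>E I S"
    show "trace_pow K (s + 2) (centred_sum z)
        = (\<Sum>j\<in>I. trace_mult_pow K (Suc s) (summand j z) (centred_sum z))"
      using trace_mult_pow_self[OF sym_centred_sum[OF z], of "Suc s"]
      by (subst (asm) (1) centred_sum_def) (simp add: trace_mult_pow_sum)
  qed
  also have "\<dots> = (\<Sum>j\<in>I. E (\<lambda>z. trace_mult_pow K (Suc s) (summand j z) (centred_sum z)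
      - trace_mult_pow K (Suc s) (summand j z) (others j z)))"
    by (simp add: expect_sum expect_diff expect_trace_mult_others)
  also have "\<dots> \<le> (\<Sum>j\<in>I. E (\<lambda>z. real (Suc s) *
      (trace_sq_mult_pow K s (summand j z) (centred_sum z)
       + trace_sq_mult_pow K s (summand j z) (others j z))))"
  proof (intro sum_mono expect_mono)
    fix j z assume "j \<in> I" "z \<in> Pi\<^sub>E I S"
    then show "trace_mult_pow K (Suc s) (summand j z) (centred_sum z)
        - trace_mult_pow K (Suc s) (summand j z) (others j z)
      \<le> real (Suc s) * (trace_sq_mult_pow K s (summand j z) (centred_sum z)
        + trace_sq_mult_pow K s (summand j z) (others j z))"
      using trace_mean_value[OF sym_centred_sum sym_others assms, of z z j]
      unfolding centred_sum_minus_others[OF \<open>j \<in> I\<close>] by blast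
  qed
  also have "\<dots> = real (Suc s) *
      (E (\<lambda>z. \<Sum>j\<in>I. trace_sq_mult_pow K s (summand j z) (centred_sum z))
       + (\<Sum>j\<in>I. E (\<lambda>z. trace_sq_mult_pow K s (summand j z) (others j z))))"
    unfolding expect_scale expect_add expect_sum sum_distrib_left[symmetric] sum.distrib ..
  also have "\<dots> \<le> real (Suc s) *
      (E (\<lambda>z. 2 * R * (trace_pow K (Suc s) (centred_sum z)
        + 2 * (\<Sum>j\<in>I. c j) * trace_pow K s (centred_sum z)))
       + (\<Sum>j\<in>I. R * c j * moment s))"
    unfolding moment_def
    by (intro mult_left_mono add_mono sum_mono expect_mono sum_trace_sq_le
        expect_trace_sq_others_le assms) auto
  also have "\<dots> = real (Suc s) *
      (2 * R * (moment (Suc s) + 2 * (\<Sum>j\<in>I. c j) * moment s) + R * (\<Sum>j\<in>I. c j) * moment s)"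
    unfolding expect_scale expect_add moment_def
    by (simp add: sum_distrib_left sum_distrib_right mult.assoc)
  finally show ?thesis by (simp add: algebra_simps)
qed

lemma moment_step:
  assumes "even s"
  shows "moment (s + 2)
    \<le> (4 * (real (Suc s))\<^sup>2 * R\<^sup>2 + 10 * real (Suc s) * R * (\<Sum>j\<in>I. c j)) * moment s"
proof -
  define a where "a = real (Suc s) * R"
  have "2 * a * moment (Suc s)
      \<le> E (\<lambda>z. (1 / 2) * trace_pow K (s + 2) (centred_sum z)
          + 2 * a\<^sup>2 * trace_pow K s (centred_sum z))"
    unfolding moment_def expect_scale[symmetric]
    using trace_pow_interpolate[OF assms, of a] by (intro expect_mono) simp
  also have "\<dots> = moment (s + 2) / 2 + 2 * a\<^sup>2 * moment s"
    unfolding expect_add expect_scale moment_def by simp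
  finally have "2 * a * moment (Suc s) \<le> moment (s + 2) / 2 + 2 * a\<^sup>2 * moment s" .
  moreover have "moment (s + 2)
      \<le> 2 * a * moment (Suc s) + 5 * a * (\<Sum>j\<in>I. c j) * moment s"
    using moment_recursion[OF assms] by (simp add: a_def algebra_simps)
  ultimately have "moment (s + 2) \<le> (4 * a\<^sup>2 + 10 * a * (\<Sum>j\<in>I. c j)) * moment s"
    unfolding distrib_right by linarith
  then show ?thesis unfolding a_def power_mult_distrib by (simp only: mult.assoc)
qed

lemma moment_bound:
  assumes c: "0 \<le> (\<Sum>j\<in>I. c j)" and "p \<le> P"
  defines "B \<equiv> 16 * (real P)\<^sup>2 * R\<^sup>2 + 20 * real P * R * (\<Sum>j\<in>I. c j)"
  shows "moment (2 * p) \<le> real K * B ^ p"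
  using \<open>p \<le> P\<close>
proof (induction p)
  case 0
  then show ?case by (simp add: moment_def trace_pow_0 expect_const)
next
  case (Suc p)
  have B: "0 \<le> B" unfolding B_def using c R_nonneg by simp
  have "moment (2 * Suc p)
      \<le> (4 * (real (Suc (2 * p)))\<^sup>2 * R\<^sup>2 + 10 * real (Suc (2 * p)) * R * (\<Sum>j\<in>I. c j))
        * moment (2 * p)"
    using moment_step[of "2 * p"] by simp
  also have "\<dots> \<le> (4 * (2 * real P)\<^sup>2 * R\<^sup>2 + 10 * (2 * real P) * R * (\<Sum>j\<in>I. c j)) * moment (2 * p)"
    using Suc.prems c R_nonneg
    by (intro mult_right_mono add_mono mult_left_mono power_mono moment_nonneg) auto
  also have "\<dots> = B * moment (2 * p)" by (simp add: B_def power_mult_distrib)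
  also have "\<dots> \<le> B * (real K * B ^ p)" using Suc B by (intro mult_left_mono) auto
  finally show ?case by (simp add: mult.left_commute)
qed

text \<open>Markov's inequality for \<open>tr X\<^sup>2\<^sup>P\<close>, which dominates the \<open>2 P\<close>-th power of the spectral norm.\<close>

theorem tail_bound:
  fixes P :: nat
  assumes c: "0 \<le> (\<Sum>j\<in>I. c j)" and "0 < t" "0 < K"
  defines "B \<equiv> 16 * (real P)\<^sup>2 * R\<^sup>2 + 20 * real P * R * (\<Sum>j\<in>I. c j)"
  shows "E (\<lambda>z. if \<exists>x. dot K x x = 1 \<and>
        t\<^sup>2 < dot K (mulv K (centred_sum z) x) (mulv K (centred_sum z) x) then 1 else 0)
    \<le> real K * (B / t\<^sup>2) ^ P"
proof -
  have "E (\<lambda>z. if \<exists>x. dot K x x = 1 \<and>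
        t\<^sup>2 < dot K (mulv K (centred_sum z) x) (mulv K (centred_sum z) x) then 1 else 0)
      \<le> E (\<lambda>z. 1 / (t\<^sup>2) ^ P * trace_pow K (2 * P) (centred_sum z))"
  proof (rule expect_mono)
    fix z assume z: "z \<in> Pi\<^sub>E I S"
    have "(t\<^sup>2) ^ P \<le> trace_pow K (2 * P) (centred_sum z)"
      if "dot K x x = 1" "t\<^sup>2 < dot K (mulv K (centred_sum z) x) (mulv K (centred_sum z) x)" for x
    proof -
      have "(t\<^sup>2) ^ P \<le> dot K (mulv K (centred_sum z) x) (mulv K (centred_sum z) x) ^ P"
        using that by (intro power_mono) auto
      also have "\<dots> \<le> trace_pow K (2 * P) (centred_sum z)"
        using mulv_norm_pow_le_trace_pow[OF sym_centred_sum[OF z] \<open>0 < K\<close>, of x P] that by simp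
      finally show ?thesis .
    qed
    then show "(if \<exists>x. dot K x x = 1 \<and>
        t\<^sup>2 < dot K (mulv K (centred_sum z) x) (mulv K (centred_sum z) x) then 1 else 0)
      \<le> 1 / (t\<^sup>2) ^ P * trace_pow K (2 * P) (centred_sum z)"
      using \<open>0 < t\<close> trace_pow_nonneg[of "2 * P" K "centred_sum z"] by (auto simp: field_simps)
  qed
  also have "\<dots> = 1 / (t\<^sup>2) ^ P * moment (2 * P)"
    unfolding expect_scale moment_def ..
  also have "\<dots> \<le> 1 / (t\<^sup>2) ^ P * (real K * B ^ P)"
    using moment_bound[OF c order_refl] by (intro mult_left_mono) (auto simp: B_def)
  also have "\<dots> = real K * (B / t\<^sup>2) ^ P" by (simp add: power_divide)
  finally show ?thesis .
qed

end

section \<open>Decoupling by mixing coefficients\<close>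

lemma sigma_algebra_sigma_gen_by: "sigma_algebra (space M) (sigma_gen_by M X I)"
  unfolding sigma_gen_by_def by (rule sigma_algebra_sigma_sets) auto

lemma sigma_gen_by_subset:
  assumes "\<And>i. X i \<in> borel_measurable M"
  shows "sigma_gen_by M X I \<subseteq> sets M"
  unfolding sigma_gen_by_def
  by (rule sets.sigma_sets_subset) (auto intro!: measurable_sets[OF assms])

lemma sigma_gen_by_top: "space M \<in> sigma_gen_by M X I"
proof -
  interpret sigma_algebra "space M" "sigma_gen_by M X I" by (rule sigma_algebra_sigma_gen_by)
  show ?thesis by (rule top)
qed

context prob_space
begin

lemma sum_measure_partition:
  assumes "finite P" "P \<subseteq> events" "partition_on (space M) P" "B \<in> events"
  shows "(\<Sum>A\<in>P. prob (A \<inter> B)) = prob B"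
proof -
  have "(\<Sum>A\<in>P. prob (A \<inter> B)) = prob (\<Union>A\<in>P. A \<inter> B)"
    using assms partition_onD2[OF assms(3)]
    by (intro finite_measure_finite_Union[symmetric])
      (auto simp: disjoint_family_on_def disjoint_def pairwise_def disjnt_def)
  also have "(\<Union>A\<in>P. A \<inter> B) = B"
    using partition_onD1[OF assms(3)] sets.sets_into_space[OF assms(4)] by blast
  finally show ?thesis .
qed

lemma partition_dependence_le_2:
  assumes P: "finite P" "P \<subseteq> events" "partition_on (space M) P"
    and Q: "finite Q" "Q \<subseteq> events" "partition_on (space M) Q"
  shows "(\<Sum>A\<in>P. \<Sum>B\<in>Q. \<bar>prob (A \<inter> B) - prob A * prob B\<bar>) \<le> 2"
proof -
  have one: "(\<Sum>A\<in>P. prob A) = 1" "(\<Sum>B\<in>Q. prob B) = 1"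
    using sum_measure_partition[OF P sets.top] sum_measure_partition[OF Q sets.top] P(2) Q(2)
    by (simp_all add: prob_space subset_iff cong: sum.cong)
  have "(\<Sum>A\<in>P. \<Sum>B\<in>Q. \<bar>prob (A \<inter> B) - prob A * prob B\<bar>)
      \<le> (\<Sum>A\<in>P. \<Sum>B\<in>Q. prob (B \<inter> A) + prob A * prob B)"
    by (intro sum_mono) (simp add: abs_le_iff Int_commute add_increasing)
  also have "\<dots> = (\<Sum>A\<in>P. prob A + prob A)"
    using P(2) one
    by (intro sum.cong) (auto simp: sum.distrib sum_measure_partition[OF Q]
        sum_distrib_left[symmetric])
  also have "\<dots> = 2" by (simp add: sum_distrib_left[symmetric] one)
  finally show ?thesis .
qed

text \<open>Boundedness of the sums over partitions is what makes the suprema in the definitions of the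
coefficients meaningful.\<close>

lemma bdd_above_dependence:
  assumes "\<A> \<subseteq> events" "\<B> \<subseteq> events"
  shows "bdd_above ((\<lambda>(P, Q). \<Sum>A\<in>P. \<Sum>B\<in>Q. \<bar>prob (A \<inter> B) - prob A * prob B\<bar>) `
    {(P, Q). finite P \<and> P \<subseteq> \<A> \<and> partition_on (space M) P \<and>
             finite Q \<and> Q \<subseteq> \<B> \<and> partition_on (space M) Q})"
  using assms by (intro bdd_aboveI[of _ 2]) (auto intro!: partition_dependence_le_2)

lemma beta_dependence_upper:
  assumes "\<A> \<subseteq> events" "\<B> \<subseteq> events"
    and "finite P" "P \<subseteq> \<A>" "partition_on (space M) P"
    and "finite Q" "Q \<subseteq> \<B>" "partition_on (space M) Q"
  shows "(\<Sum>A\<in>P. \<Sum>B\<in>Q. \<bar>prob (A \<inter> B) - prob A * prob B\<bar>) \<le> 2 * beta_dependence M \<A> \<B>"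
  using cSUP_upper[OF _ bdd_above_dependence[OF assms(1,2)], of "(P, Q)"] assms(3-)
  by (simp add: beta_dependence_def)

lemma beta_dependence_le_1:
  assumes "\<A> \<subseteq> events" "\<B> \<subseteq> events" "space M \<in> \<A>" "space M \<in> \<B>"
  shows "beta_dependence M \<A> \<B> \<le> 1"
proof -
  define T where "T = {(P, Q). finite P \<and> P \<subseteq> \<A> \<and> partition_on (space M) P \<and>
    finite Q \<and> Q \<subseteq> \<B> \<and> partition_on (space M) Q}"
  have "partition_on (space M) {space M}" using not_empty by (auto intro!: partition_onI)
  then have "({space M}, {space M}) \<in> T" using assms(3,4) by (simp add: T_def)
  then have "(SUP (P, Q)\<in>T. \<Sum>A\<in>P. \<Sum>B\<in>Q. \<bar>prob (A \<inter> B) - prob A * prob B\<bar>) \<le> 2"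
    using assms(1,2)
    by (intro cSUP_least) (blast, auto simp: T_def intro!: partition_dependence_le_2)
  then show ?thesis by (simp add: beta_dependence_def T_def)
qed

lemma beta_dependence_le_mixing_coeff:
  assumes "\<And>i. X i \<in> borel_measurable M"
  shows "beta_dependence M (sigma_gen_by M X {..i}) (sigma_gen_by M X {i + int q..})
    \<le> beta_mixing_coeff M X q"
proof -
  have "bdd_above (range (\<lambda>i. beta_dependence M (sigma_gen_by M X {..i})
      (sigma_gen_by M X {i + int q..})))"
    using sigma_gen_by_subset[of X M, OF assms]
      sigma_gen_by_top[of M X]
    by (intro bdd_aboveI[of _ 1]) (auto intro!: beta_dependence_le_1)
  then show ?thesis unfolding beta_mixing_coeff_def by (intro cSUP_upper) auto
qed

lemma level_sets_partition:
  "partition_on (space M) ((\<lambda>x. {\<omega>\<in>space M. f \<omega> = x}) ` (f ` space M))"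
  by (rule partition_onI) (auto simp: disjnt_def)

text \<open>The nonempty level sets of a function with finite range form a finite partition; values that are not
taken contribute zero.\<close>

lemma discrete_dependence_le:
  assumes fam: "\<A> \<subseteq> events" "\<B> \<subseteq> events"
    and f: "finite (f ` space M)" "\<And>x. {\<omega>\<in>space M. f \<omega> = x} \<in> \<A>"
    and g: "finite (g ` space M)" "\<And>y. {\<omega>\<in>space M. g \<omega> = y} \<in> \<B>"
    and fin: "finite F" "finite G"
  shows "(\<Sum>x\<in>F. \<Sum>y\<in>G. \<bar>prob {\<omega>\<in>space M. f \<omega> = x \<and> g \<omega> = y}
      - prob {\<omega>\<in>space M. f \<omega> = x} * prob {\<omega>\<in>space M. g \<omega> = y}\<bar>)
    \<le> 2 * beta_dependence M \<A> \<B>"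
proof -
  let ?a = "\<lambda>x. {\<omega>\<in>space M. f \<omega> = x}" and ?b = "\<lambda>y. {\<omega>\<in>space M. g \<omega> = y}"
  define h where "h A B = \<bar>prob (A \<inter> B) - prob A * prob B\<bar>" for A B
  have h0: "h {} B = 0" "h B {} = 0" and hpos: "0 \<le> h A B" for A B by (simp_all add: h_def)
  have "(\<Sum>x\<in>F. \<Sum>y\<in>G. \<bar>prob {\<omega>\<in>space M. f \<omega> = x \<and> g \<omega> = y} - prob (?a x) * prob (?b y)\<bar>)
      = (\<Sum>x\<in>F. \<Sum>y\<in>G. h (?a x) (?b y))"
    by (intro sum.cong refl) (auto simp: h_def intro!: arg_cong[of _ _ prob] arg_cong2[of _ _ _ _ "\<lambda>a b. \<bar>a - b\<bar>"])
  also have "\<dots> \<le> (\<Sum>x\<in>F \<union> f ` space M. \<Sum>y\<in>G \<union> g ` space M. h (?a x) (?b y))"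
    using fin f(1) g(1)
    by (intro order_trans[OF sum_mono2 sum_mono] sum_mono2 sum_nonneg hpos) auto
  also have "\<dots> = (\<Sum>x\<in>f ` space M. \<Sum>y\<in>G \<union> g ` space M. h (?a x) (?b y))"
  proof (intro sum.mono_neutral_right ballI sum.neutral)
    fix x y assume "x \<in> F \<union> f ` space M - f ` space M"
    then have "?a x = {}" by auto
    then show "h (?a x) (?b y) = 0" by (simp only: h0)
  qed (use fin f(1) in auto)
  also have "\<dots> = (\<Sum>x\<in>f ` space M. \<Sum>y\<in>g ` space M. h (?a x) (?b y))"
  proof (rule sum.cong[OF refl], intro sum.mono_neutral_right ballI)
    fix x y assume "y \<in> G \<union> g ` space M - g ` space M"
    then have "?b y = {}" by auto
    then show "h (?a x) (?b y) = 0" by (simp only: h0)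
  qed (use fin g(1) in auto)
  also have "\<dots> = (\<Sum>A\<in>?a ` f ` space M. \<Sum>B\<in>?b ` g ` space M. h A B)"
  proof -
    have "inj_on ?a (f ` space M)" "inj_on ?b (g ` space M)" by (auto intro!: inj_onI)
    then show ?thesis by (simp add: sum.reindex)
  qed
  also have "\<dots> \<le> 2 * beta_dependence M \<A> \<B>"
    unfolding h_def using fam f g
    by (intro beta_dependence_upper level_sets_partition) auto
  finally show ?thesis .
qed

definition level_prob :: "('a \<Rightarrow> 'c) \<Rightarrow> 'c \<Rightarrow> real" where
  "level_prob f x = prob {\<omega>\<in>space M. f \<omega> = x}"

lemma product_weights_level_prob:
  assumes "finite I" "\<And>k. k \<in> I \<Longrightarrow> finite (Z k ` space M)"
    and "\<And>k y. k \<in> I \<Longrightarrow> {\<omega>\<in>space M. Z k \<omega> = y} \<in> events"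
  shows "product_weights I (\<lambda>k. Z k ` space M) (\<lambda>k. level_prob (Z k))"
proof
  fix k assume k: "k \<in> I"
  let ?a = "\<lambda>x. {\<omega>\<in>space M. Z k \<omega> = x}"
  have "(\<Sum>y\<in>Z k ` space M. level_prob (Z k) y) = (\<Sum>A\<in>?a ` Z k ` space M. prob (A \<inter> space M))"
    by (subst sum.reindex)
      (auto simp: level_prob_def intro!: inj_onI sum.cong arg_cong[of _ _ prob])
  also have "\<dots> = 1"
    using assms(2,3) k
    by (subst sum_measure_partition[OF _ _ level_sets_partition]) (auto simp: prob_space)
  finally show "(\<Sum>y\<in>Z k ` space M. level_prob (Z k) y) = 1" .
qed (use assms in \<open>auto simp: level_prob_def\<close>)

text \<open>The product law is reached by splitting off the coordinates one at a time, from the last to the first.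
Each split costs the dependence between one coordinate and its past.\<close>

lemma telescoping_decoupling:
  assumes "\<And>k. k < m \<Longrightarrow>
    (\<Sum>z\<in>Pi\<^sub>E {..<k} S. \<Sum>y\<in>S k. \<bar>prob {\<omega>\<in>space M. (\<lambda>i\<in>{..<k}. Z i \<omega>) = z \<and> Z k \<omega> = y}
      - prob {\<omega>\<in>space M. (\<lambda>i\<in>{..<k}. Z i \<omega>) = z} * level_prob (Z k) y\<bar>) \<le> \<delta>"
    and "\<And>k. k < m \<Longrightarrow> (\<Sum>y\<in>S k. level_prob (Z k) y) = 1"
  shows "(\<Sum>z\<in>Pi\<^sub>E {..<m} S. \<bar>prob {\<omega>\<in>space M. (\<lambda>i\<in>{..<m}. Z i \<omega>) = z}
      - (\<Prod>i<m. level_prob (Z i) (z i))\<bar>) \<le> real m * \<delta>"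
  using assms
proof (induction m)
  case 0
  then show ?case by (simp add: prob_space restrict_def)
next
  case (Suc m)
  let ?J = "\<lambda>k z. prob {\<omega>\<in>space M. (\<lambda>i\<in>{..<k}. Z i \<omega>) = z}"
  let ?J' = "\<lambda>z y. prob {\<omega>\<in>space M. (\<lambda>i\<in>{..<m}. Z i \<omega>) = z \<and> Z m \<omega> = y}"
  let ?W = "\<lambda>z. \<Prod>i<m. level_prob (Z i) (z i)"
  have joint: "?J (Suc m) (z(m := y)) = ?J' z y" if "z \<in> Pi\<^sub>E {..<m} S" for z y
  proof -
    have "(\<lambda>i\<in>{..<Suc m}. Z i \<omega>) = z(m := y) \<longleftrightarrow> (\<lambda>i\<in>{..<m}. Z i \<omega>) = z \<and> Z m \<omega> = y" for \<omega>
      using PiE_arb[OF that]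
      by (auto simp: fun_eq_iff restrict_def less_Suc_eq split: if_splits)
    then show ?thesis by simp
  qed
  have "(\<Sum>z\<in>Pi\<^sub>E {..<Suc m} S. \<bar>?J (Suc m) z - (\<Prod>i<Suc m. level_prob (Z i) (z i))\<bar>)
      = (\<Sum>z\<in>Pi\<^sub>E {..<m} S. \<Sum>y\<in>S m. \<bar>?J' z y - ?W z * level_prob (Z m) y\<bar>)"
    unfolding lessThan_Suc[of m]
    by (subst sum_PiE_insert, simp, subst sum.swap)
      (auto intro!: sum.cong prod.cong arg_cong2[of _ _ _ _ "\<lambda>a b. \<bar>a - b\<bar>"]
        simp: joint[unfolded lessThan_Suc] mult.commute)
  also have "\<dots> \<le> (\<Sum>z\<in>Pi\<^sub>E {..<m} S. \<Sum>y\<in>S m. \<bar>?J' z y - ?J m z * level_prob (Z m) y\<bar>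
      + \<bar>?J m z - ?W z\<bar> * level_prob (Z m) y)"
  proof (intro sum_mono)
    fix z y
    \<comment> \<open>First decouple the coordinate \<open>m\<close> from its past, then the past itself.\<close>
    have tri: "\<bar>a - w * l\<bar> \<le> \<bar>a - j * l\<bar> + \<bar>j - w\<bar> * l" if "0 \<le> l" for a w l j :: real
    proof -
      have "a - w * l = (a - j * l) + (j - w) * l" by (simp add: algebra_simps)
      then show ?thesis
        using abs_triangle_ineq[of "a - j * l" "(j - w) * l"] that by (simp add: abs_mult)
    qed
    show "\<bar>?J' z y - ?W z * level_prob (Z m) y\<bar>
        \<le> \<bar>?J' z y - ?J m z * level_prob (Z m) y\<bar> + \<bar>?J m z - ?W z\<bar> * level_prob (Z m) y"
      by (rule tri) (simp add: level_prob_def)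
  qed
  also have "\<dots> = (\<Sum>z\<in>Pi\<^sub>E {..<m} S. \<Sum>y\<in>S m. \<bar>?J' z y - ?J m z * level_prob (Z m) y\<bar>)
      + (\<Sum>z\<in>Pi\<^sub>E {..<m} S. \<bar>?J m z - ?W z\<bar>)"
    using Suc.prems(2)[of m] by (simp add: sum.distrib sum_distrib_left[symmetric])
  also have "\<dots> \<le> \<delta> + real m * \<delta>"
    by (rule add_mono[OF Suc.prems(1)[OF lessI] Suc.IH[OF Suc.prems]]) simp_all
  also have "\<delta> + real m * \<delta> = real (Suc m) * \<delta>" by (simp add: algebra_simps)
  finally show ?case .
qed

text \<open>The event is a finite union of joint level sets, so its probabilities under the joint law and under the
product law differ by at most the sum of all discrepancies. Its measurability is recorded because the
tail event of the deviation is later covered by events of this kind.\<close>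

lemma decoupled_event_bound:
  assumes X: "\<And>i. X i \<in> borel_measurable M"
    and finite: "\<And>k. k < m \<Longrightarrow> finite (Z k ` space M)"
    and past: "\<And>j k y. j < k \<Longrightarrow> k < m \<Longrightarrow>
      {\<omega>\<in>space M. Z j \<omega> = y} \<in> sigma_gen_by M X {..t k}"
    and future: "\<And>k y. k < m \<Longrightarrow> {\<omega>\<in>space M. Z k \<omega> = y} \<in> sigma_gen_by M X {t k + int q..}"
  shows "prob {\<omega>\<in>space M. bad (\<lambda>k\<in>{..<m}. Z k \<omega>)}
    \<le> prod_expect {..<m} (\<lambda>k. Z k ` space M) (\<lambda>k. level_prob (Z k)) (\<lambda>z. if bad z then 1 else 0)
      + real m * (2 * beta_mixing_coeff M X q)"
    and "{\<omega>\<in>space M. bad (\<lambda>k\<in>{..<m}. Z k \<omega>)} \<in> events"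
proof -
  let ?S = "\<lambda>k. Z k ` space M"
  note sub = sigma_gen_by_subset[of X M, OF X]
  have Zm: "{\<omega>\<in>space M. Z k \<omega> = y} \<in> events" if "k < m" for k y
    using future[OF that] sub by blast
  interpret W: product_weights "{..<m}" ?S "\<lambda>k. level_prob (Z k)"
    by (rule product_weights_level_prob) (auto intro: finite Zm)
  have dep: "(\<Sum>z\<in>Pi\<^sub>E {..<k} ?S. \<Sum>y\<in>?S k.
      \<bar>prob {\<omega>\<in>space M. (\<lambda>i\<in>{..<k}. Z i \<omega>) = z \<and> Z k \<omega> = y}
      - prob {\<omega>\<in>space M. (\<lambda>i\<in>{..<k}. Z i \<omega>) = z} * level_prob (Z k) y\<bar>)
      \<le> 2 * beta_mixing_coeff M X q" if k: "k < m" for k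
  proof -
    let ?f = "\<lambda>\<omega>. \<lambda>i\<in>{..<k}. Z i \<omega>"
    have fin: "finite (Pi\<^sub>E {..<k} ?S)" using k finite by (intro finite_PiE) auto
    then have ff: "finite (?f ` space M)" by (rule finite_subset[rotated]) (auto split: if_splits)
    interpret A: sigma_algebra "space M" "sigma_gen_by M X {..t k}"
      by (rule sigma_algebra_sigma_gen_by)
    have fm: "{\<omega>\<in>space M. ?f \<omega> = z} \<in> sigma_gen_by M X {..t k}" for z
    proof (cases "z \<in> extensional {..<k}")
      case True
      then have "{\<omega>\<in>space M. ?f \<omega> = z} = {\<omega>\<in>space M. \<forall>i\<in>{..<k}. Z i \<omega> = z i}"
        using extensional_arb[OF True] by (auto simp: fun_eq_iff restrict_def split: if_splits)
      also have "\<dots> \<in> sigma_gen_by M X {..t k}"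
        using past k by (intro A.sets_Collect_finite_All) auto
      finally show ?thesis .
    next
      case False
      then have "?f \<omega> \<noteq> z" for \<omega>
        using restrict_extensional[of "\<lambda>i. Z i \<omega>" "{..<k}"] by metis
      then have "{\<omega>\<in>space M. ?f \<omega> = z} = {}" by blast
      then show ?thesis by (simp only: A.empty_sets)
    qed
    have "(\<Sum>z\<in>Pi\<^sub>E {..<k} ?S. \<Sum>y\<in>?S k. \<bar>prob {\<omega>\<in>space M. ?f \<omega> = z \<and> Z k \<omega> = y}
        - prob {\<omega>\<in>space M. ?f \<omega> = z} * level_prob (Z k) y\<bar>)
      \<le> 2 * beta_dependence M (sigma_gen_by M X {..t k}) (sigma_gen_by M X {t k + int q..})"
      unfolding level_prob_def
      by (rule discrete_dependence_le[OF sub sub ff fm finite[OF k] future[OF k] fin finite[OF k]])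
    then show ?thesis using beta_dependence_le_mixing_coeff[of X "t k" q, OF X] by linarith
  qed
  have tele: "(\<Sum>z\<in>Pi\<^sub>E {..<m} ?S. \<bar>prob {\<omega>\<in>space M. (\<lambda>i\<in>{..<m}. Z i \<omega>) = z}
      - (\<Prod>i<m. level_prob (Z i) (z i))\<bar>) \<le> real m * (2 * beta_mixing_coeff M X q)"
    using W.weight_total by (intro telescoping_decoupling dep) auto
  let ?f = "\<lambda>\<omega>. \<lambda>i\<in>{..<m}. Z i \<omega>"
  let ?bad = "{z\<in>Pi\<^sub>E {..<m} ?S. bad z}"
  have fin: "finite (Pi\<^sub>E {..<m} ?S)" using finite by (intro finite_PiE) auto
  have jm: "{\<omega>\<in>space M. ?f \<omega> = z} \<in> events" if "z \<in> Pi\<^sub>E {..<m} ?S" for z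
  proof -
    have "{\<omega>\<in>space M. ?f \<omega> = z} = {\<omega>\<in>space M. \<forall>i\<in>{..<m}. Z i \<omega> = z i}"
      using PiE_arb[OF that] by (auto simp: fun_eq_iff restrict_def)
    also have "\<dots> \<in> events" using Zm by (intro sets.sets_Collect_finite_All) auto
    finally show ?thesis .
  qed
  have eq: "{\<omega>\<in>space M. bad (?f \<omega>)} = (\<Union>z\<in>?bad. {\<omega>\<in>space M. ?f \<omega> = z})"
    by auto
  show "{\<omega>\<in>space M. bad (?f \<omega>)} \<in> events"
    unfolding eq using fin jm by (intro sets.finite_UN) auto
  have "prob {\<omega>\<in>space M. bad (?f \<omega>)} = (\<Sum>z\<in>?bad. prob {\<omega>\<in>space M. ?f \<omega> = z})"
    unfolding eq using fin jm
    by (intro finite_measure_finite_Union) (auto simp: disjoint_family_on_def)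
  also have "\<dots> = (\<Sum>z\<in>Pi\<^sub>E {..<m} ?S. prob {\<omega>\<in>space M. ?f \<omega> = z} * (if bad z then 1 else 0))"
    using fin by (intro sum.mono_neutral_cong_left) auto
  also have "\<dots> \<le> (\<Sum>z\<in>Pi\<^sub>E {..<m} ?S. (\<Prod>i<m. level_prob (Z i) (z i)) * (if bad z then 1 else 0)
      + \<bar>prob {\<omega>\<in>space M. ?f \<omega> = z} - (\<Prod>i<m. level_prob (Z i) (z i))\<bar>)"
  proof (rule sum_mono)
    have "a * (if Q then 1 else 0) \<le> w * (if Q then 1 else 0) + \<bar>a - w\<bar>" for a w :: real and Q
      by (cases Q) auto
    then show "prob {\<omega>\<in>space M. ?f \<omega> = z} * (if bad z then 1 else 0)
      \<le> (\<Prod>i<m. level_prob (Z i) (z i)) * (if bad z then 1 else 0)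
        + \<bar>prob {\<omega>\<in>space M. ?f \<omega> = z} - (\<Prod>i<m. level_prob (Z i) (z i))\<bar>" for z .
  qed
  also have "\<dots> \<le> prod_expect {..<m} ?S (\<lambda>k. level_prob (Z k)) (\<lambda>z. if bad z then 1 else 0)
      + real m * (2 * beta_mixing_coeff M X q)"
    unfolding sum.distrib prod_expect_def by (rule add_left_mono[OF tele])
  finally show "prob {\<omega>\<in>space M. bad (?f \<omega>)}
    \<le> prod_expect {..<m} ?S (\<lambda>k. level_prob (Z k)) (\<lambda>z. if bad z then 1 else 0)
      + real m * (2 * beta_mixing_coeff M X q)" .
qed

end

section \<open>Inverse square roots and the spectral norm\<close>

definition entries :: "real mat \<Rightarrow> nat \<Rightarrow> nat \<Rightarrow> real" where
  "entries A = (\<lambda>i j. A $$ (i, j))"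

lemma scalar_prod_dot:
  "w \<in> carrier_vec K \<Longrightarrow> scalar_prod v w = dot K (vec_index v) (vec_index w)"
  by (simp add: scalar_prod_def dot_def lessThan_atLeast0)

lemma mult_mat_vec_mulv:
  assumes "A \<in> carrier_mat K K" "v \<in> carrier_vec K" "i < K"
  shows "vec_index (A *\<^sub>v v) i = mulv K (entries A) (vec_index v) i"
  using assms by (simp add: mulv_def entries_def scalar_prod_def lessThan_atLeast0)

lemma symmetric_entries:
  "A \<in> carrier_mat K K \<Longrightarrow> transpose_mat A = A \<longleftrightarrow> sym_mat K (entries A)"
  by (auto simp: sym_mat_def entries_def mat_eq_iff)

lemma quadratic_form_entries:
  assumes "A \<in> carrier_mat K K" "v \<in> carrier_vec K"
  shows "scalar_prod v (A *\<^sub>v v) = qform K (entries A) (vec_index v)"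
  using assms mult_mat_vec_mulv[OF assms]
  by (subst scalar_prod_dot[of _ K]) (auto simp: qform_def intro!: dot_cong)

text \<open>The matrix \<open>\<Sum>\<^sub>i f\<^sub>i u\<^sub>i u\<^sub>i'\<close>: for an eigenbasis \<open>u\<close> this is the functional calculus, which turns products
of matrices into products of the functions \<open>f\<close>.\<close>

definition spectral_mat :: "nat \<Rightarrow> (nat \<Rightarrow> nat \<Rightarrow> real) \<Rightarrow> (nat \<Rightarrow> real) \<Rightarrow> real mat" where
  "spectral_mat K u f = Matrix.mat K K (\<lambda>(a, b). \<Sum>i<K. f i * u i a * u i b)"

lemma spectral_mat_carrier [simp]: "spectral_mat K u f \<in> carrier_mat K K"
  by (simp add: spectral_mat_def)

lemma spectral_mat_dim [simp]:
  "dim_row (spectral_mat K u f) = K" "dim_col (spectral_mat K u f) = K"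
  by (simp_all add: spectral_mat_def)

lemma orthonormal_complete:
  assumes "orthonormal K K u" "a < K" "b < K"
  shows "(\<Sum>i<K. u i a * u i b) = (if a = b then 1 else 0)"
  using parseval[OF assms(1), of "\<lambda>j. if j = a then 1 else 0" "\<lambda>j. if j = b then 1 else 0"] assms
  by (cases "a = b") (auto simp: dot_unit_vector)

lemma spectral_mat_one:
  assumes "orthonormal K K u"
  shows "spectral_mat K u (\<lambda>_. 1) = 1\<^sub>m K"
  by (rule eq_matI) (simp_all add: spectral_mat_def orthonormal_complete[OF assms])

lemma spectral_mat_mult:
  assumes "orthonormal K K u"
  shows "spectral_mat K u f * spectral_mat K u g = spectral_mat K u (\<lambda>i. f i * g i)"
proof (rule eq_matI)
  fix a b assume "a < dim_row (spectral_mat K u (\<lambda>i. f i * g i))"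
    and "b < dim_col (spectral_mat K u (\<lambda>i. f i * g i))"
  then have ab: "a < K" "b < K" by (simp_all add: spectral_mat_def)
  have "(spectral_mat K u f * spectral_mat K u g) $$ (a, b)
      = (\<Sum>c<K. (\<Sum>i<K. f i * u i a * u i c) * (\<Sum>j<K. g j * u j c * u j b))"
    using ab by (simp add: spectral_mat_def scalar_prod_def lessThan_atLeast0)
  also have "\<dots> = (\<Sum>c<K. \<Sum>i<K. \<Sum>j<K. f i * u i a * (g j * u j b) * (u i c * u j c))"
    by (simp add: sum_product algebra_simps)
  also have "\<dots> = (\<Sum>i<K. \<Sum>j<K. \<Sum>c<K. f i * u i a * (g j * u j b) * (u i c * u j c))"
    by (subst sum.swap) (intro sum.cong refl sum.swap)
  also have "\<dots> = (\<Sum>i<K. \<Sum>j<K. f i * u i a * (g j * u j b) * dot K (u i) (u j))"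
    by (simp add: dot_def sum_distrib_left)
  also have "\<dots> = (\<Sum>i<K. \<Sum>j<K. if j = i then f i * u i a * (g i * u i b) else 0)"
    using assms by (intro sum.cong) (auto simp: orthonormal_def)
  also have "\<dots> = spectral_mat K u (\<lambda>i. f i * g i) $$ (a, b)"
    using ab by (simp add: spectral_mat_def algebra_simps)
  finally show "(spectral_mat K u f * spectral_mat K u g) $$ (a, b)
      = spectral_mat K u (\<lambda>i. f i * g i) $$ (a, b)" .
qed (simp_all add: spectral_mat_def)

lemma spectral_mat_eigensystem:
  assumes "orthonormal K K u"
  shows "eigensystem K (entries (spectral_mat K u f)) K f u"
  unfolding eigensystem_def
proof (intro conjI allI impI assms)
  fix i l assume il: "i < K" "l < K"
  have "mulv K (entries (spectral_mat K u f)) (u i) l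
      = (\<Sum>c<K. \<Sum>j<K. f j * u j l * (u j c * u i c))"
    using il by (simp add: mulv_def entries_def spectral_mat_def sum_distrib_right mult.assoc)
  also have "\<dots> = (\<Sum>j<K. f j * u j l * dot K (u j) (u i))"
    by (subst sum.swap) (simp add: dot_def sum_distrib_left)
  also have "\<dots> = (\<Sum>j<K. if j = i then f i * u i l else 0)"
    using assms il by (intro sum.cong) (auto simp: orthonormal_def)
  also have "\<dots> = f i * u i l" using il by simp
  finally show "mulv K (entries (spectral_mat K u f)) (u i) l = f i * u i l" .
qed

lemma eigensystem_spectral_mat:
  assumes A: "A \<in> carrier_mat K K" "sym_mat K (entries A)" and sys: "eigensystem K (entries A) K d u"
  shows "A = spectral_mat K u d"
proof (rule eq_matI)
  fix a b assume "a < dim_row (spectral_mat K u d)" "b < dim_col (spectral_mat K u d)"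
  then have ab: "a < K" "b < K" by (simp_all add: spectral_mat_def)
  let ?e = "\<lambda>i j. if j = i then 1 else (0::real)"
  have "A $$ (a, b) = dot K (?e a) (mulv K (entries A) (?e b))"
    using ab by (subst dot_commute)
      (simp add: dot_unit_vector mulv_def entries_def if_distrib[of "(*) _"] cong: if_cong)
  also have "\<dots> = (\<Sum>i<K. dot K (u i) (?e a) * (d i * dot K (u i) (?e b)))"
    by (simp add: parseval[OF eigensystem_orthonormal[OF sys], of "?e a"]
        eigensystem_mulv_right[OF A(2) sys])
  also have "\<dots> = spectral_mat K u d $$ (a, b)"
    using ab by (simp add: dot_unit_vector spectral_mat_def algebra_simps)
  finally show "A $$ (a, b) = spectral_mat K u d $$ (a, b)" .
qed (use A in \<open>simp_all add: spectral_mat_def\<close>)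

lemma sym_spectral_mat: "sym_mat K (entries (spectral_mat K u f))"
  by (simp add: sym_mat_def entries_def spectral_mat_def algebra_simps)

lemma eigensystem_in_spectrum:
  assumes A: "A \<in> carrier_mat K K" and sys: "eigensystem K (entries A) K d u" and i: "i < K"
  shows "d i \<in> spectrum A"
proof -
  let ?v = "Matrix.vec K (u i)"
  have idx: "mulv K (entries A) (vec_index ?v) = mulv K (entries A) (u i)"
    by (rule mulv_cong) simp
  have "?v \<noteq> 0\<^sub>v K"
  proof
    assume "?v = 0\<^sub>v K"
    then have "\<forall>l<K. u i l = 0" by (metis index_vec index_zero_vec(1))
    then have "dot K (u i) (u i) = 0" by (simp add: dot_def)
    then show False using orthonormal_self[OF eigensystem_orthonormal[OF sys] i] by simp
  qed
  moreover have "A *\<^sub>v ?v = d i \<cdot>\<^sub>v ?v"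
  proof (rule eq_vecI)
    fix l assume "l < dim_vec (d i \<cdot>\<^sub>v ?v)"
    then have "l < K" by simp
    then show "vec_index (A *\<^sub>v ?v) l = vec_index (d i \<cdot>\<^sub>v ?v) l"
      using mult_mat_vec_mulv[OF A, of ?v l] sys i unfolding idx by (simp add: eigensystem_def)
  qed (use A in simp)
  ultimately have "eigenvalue A (d i)"
    unfolding eigenvalue_def eigenvector_def using A by (intro exI[of _ ?v]) auto
  then show ?thesis by (simp add: spectrum_def)
qed

lemma lambda_min_le_eigenvalue:
  assumes "A \<in> carrier_mat K K" "eigensystem K (entries A) K d u" "i < K"
  shows "lambda_min A \<le> d i"
  unfolding lambda_min_def
  using card_finite_spectrum(1)[OF assms(1)] eigensystem_in_spectrum[OF assms] by (rule Min_le)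

lemma positive_definite_entries:
  assumes "A \<in> carrier_mat K K"
  shows "positive_definite_mat A \<longleftrightarrow> sym_mat K (entries A) \<and>
    (\<forall>x. dot K x x \<noteq> 0 \<longrightarrow> 0 < qform K (entries A) x)"
proof -
  have "(\<forall>v\<in>carrier_vec K. v \<noteq> 0\<^sub>v K \<longrightarrow> 0 < scalar_prod v (A *\<^sub>v v)) \<longleftrightarrow>
      (\<forall>x. dot K x x \<noteq> 0 \<longrightarrow> 0 < qform K (entries A) x)"
  proof (intro iffI allI impI ballI)
    fix x assume pos: "\<forall>v\<in>carrier_vec K. v \<noteq> 0\<^sub>v K \<longrightarrow> 0 < scalar_prod v (A *\<^sub>v v)"
      and x: "dot K x x \<noteq> 0"
    have "Matrix.vec K x \<noteq> 0\<^sub>v K" using x by (metis dot_self_eq_0 index_vec index_zero_vec(1))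
    then have "0 < qform K (entries A) (vec_index (Matrix.vec K x))"
      using pos quadratic_form_entries[OF assms, of "Matrix.vec K x"] by auto
    then show "0 < qform K (entries A) x"
      by (subst qform_cong[of K x "vec_index (Matrix.vec K x)"]) auto
  next
    fix v :: "real Matrix.vec"
    assume pos: "\<forall>x. dot K x x \<noteq> 0 \<longrightarrow> 0 < qform K (entries A) x"
      and v: "v \<in> carrier_vec K" "v \<noteq> 0\<^sub>v K"
    have "dot K (vec_index v) (vec_index v) \<noteq> 0"
      using v by (auto simp: dot_self_eq_0 intro!: eq_vecI)
    then show "0 < scalar_prod v (A *\<^sub>v v)"
      using pos quadratic_form_entries[OF assms v(1)] by simp
  qed
  then show ?thesis
    using assms symmetric_entries[OF assms] by (auto simp: positive_definite_mat_def)
qed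

lemma spectral_mat_positive_definite:
  assumes on: "orthonormal K K u" and f: "\<And>i. i < K \<Longrightarrow> 0 < f i"
  shows "positive_definite_mat (spectral_mat K u f)"
proof -
  have "0 < qform K (entries (spectral_mat K u f)) x" if x: "dot K x x \<noteq> 0" for x
  proof -
    have "(\<Sum>i<K. (dot K (u i) x)\<^sup>2) \<noteq> 0" using norm_orthonormal[OF on, of x] x by simp
    then obtain k where k: "k < K" "(dot K (u k) x)\<^sup>2 \<noteq> 0"
      by (metis (no_types, lifting) lessThan_iff sum.neutral)
    have "0 < (\<Sum>i<K. f i * (dot K (u i) x)\<^sup>2)"
      using k by (intro sum_pos2[of _ k]) (auto simp: f less_imp_le[OF f])
    then show ?thesis
      by (simp add: qform_eigensystem[OF sym_spectral_mat spectral_mat_eigensystem[OF on]])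
  qed
  then show ?thesis
    using sym_spectral_mat by (simp add: positive_definite_entries[of _ K])
qed

text \<open>For a positive definite square root \<open>T\<close> of the matrix with eigenvalues \<open>f\<^sub>i\<^sup>2\<close>, the vector
\<open>y = T u\<^sub>i - f\<^sub>i u\<^sub>i\<close> satisfies \<open>T y = - f\<^sub>i y\<close>, which forces \<open>y = 0\<close>.\<close>

lemma positive_definite_sqrt_unique:
  assumes on: "orthonormal K K u" and f: "\<And>i. i < K \<Longrightarrow> 0 < f i"
    and T: "T \<in> carrier_mat K K" "positive_definite_mat T"
    and sq: "T * T = spectral_mat K u (\<lambda>i. f i * f i)"
  shows "T = spectral_mat K u f"
proof (rule eigensystem_spectral_mat[OF T(1)])
  have sym: "sym_mat K (entries T)"
    and pd: "\<And>x. dot K x x \<noteq> 0 \<Longrightarrow> 0 < qform K (entries T) x"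
    using T positive_definite_entries[OF T(1)] by auto
  show "sym_mat K (entries T)" by (rule sym)
  have TT: "mulv K (entries T) (mulv K (entries T) x) l = mulv K (entries (T * T)) x l"
    if "l < K" for x l
  proof -
    have "mulv K (entries T) (mulv K (entries T) x) l
        = (\<Sum>a<K. \<Sum>b<K. T $$ (l, a) * T $$ (a, b) * x b)"
      by (simp add: mulv_def entries_def sum_distrib_left mult.assoc)
    also have "\<dots> = (\<Sum>b<K. (\<Sum>a<K. T $$ (l, a) * T $$ (a, b)) * x b)"
      by (subst sum.swap) (simp add: sum_distrib_right)
    also have "\<dots> = mulv K (entries (T * T)) x l"
      using T(1) that by (simp add: mulv_def entries_def scalar_prod_def lessThan_atLeast0)
    finally show ?thesis .
  qed
  show "eigensystem K (entries T) K f u"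
    unfolding eigensystem_def
  proof (intro conjI allI impI on)
    fix i l assume il: "i < K" "l < K"
    define y where "y = (\<lambda>l. mulv K (entries T) (u i) l - f i * u i l)"
    have "mulv K (entries T) y a = - f i * y a" if "a < K" for a
    proof -
      have "mulv K (entries (T * T)) (u i) a = f i * f i * u i a"
        using spectral_mat_eigensystem[OF on, of "\<lambda>i. f i * f i"] il that
        by (simp add: sq eigensystem_def)
      then show ?thesis
        using TT[OF that, of "u i"]
        by (simp add: y_def mulv_diff mulv_scale algebra_simps)
    qed
    then have "qform K (entries T) y = dot K y (\<lambda>a. - f i * y a)"
      unfolding qform_def by (intro dot_cong) auto
    also have "\<dots> = - f i * dot K y y" by (rule dot_scale_right)
    also have "\<dots> \<le> 0" using f[OF il(1)] by (simp add: mult_nonneg_nonneg)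
    finally have "dot K y y = 0" using pd[of y] by fastforce
    then show "mulv K (entries T) (u i) l = f i * u i l"
      using il by (simp add: dot_self_eq_0 y_def)
  qed
qed

lemma inv_sqrt_mat_spectral:
  assumes G: "G \<in> carrier_mat K K" "sym_mat K (entries G)"
    and sys: "eigensystem K (entries G) K d u" and d: "\<And>i. i < K \<Longrightarrow> 0 < d i"
  shows "inv_sqrt_mat G = spectral_mat K u (\<lambda>i. 1 / sqrt (d i))"
proof -
  let ?f = "\<lambda>i. 1 / sqrt (d i)" and ?S = "spectral_mat K u (\<lambda>i. 1 / sqrt (d i))"
  note on = eigensystem_orthonormal[OF sys]
  have Gs: "G = spectral_mat K u d" by (rule eigensystem_spectral_mat[OF G sys])
  have cong: "spectral_mat K u f = spectral_mat K u g" if "\<And>i. i < K \<Longrightarrow> f i = g i" for f g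
    using that by (simp add: spectral_mat_def)
  have SSG: "?S * ?S * G = 1\<^sub>m K" "G * (?S * ?S) = 1\<^sub>m K"
    unfolding Gs spectral_mat_mult[OF on] spectral_mat_one[OF on, symmetric]
    by (rule cong; use d in \<open>force simp: divide_simps\<close>)+
  show ?thesis unfolding inv_sqrt_mat_def
  proof (rule the_equality)
    show "?S \<in> carrier_mat (dim_row G) (dim_row G) \<and> positive_definite_mat ?S \<and>
        inverts_mat G (?S * ?S) \<and> inverts_mat (?S * ?S) G"
      using G SSG d on
      by (auto simp: inverts_mat_def spectral_mat_positive_definite)
  next
    fix T assume "T \<in> carrier_mat (dim_row G) (dim_row G) \<and> positive_definite_mat T \<and>
        inverts_mat G (T * T) \<and> inverts_mat (T * T) G"
    then have T: "T \<in> carrier_mat K K" "positive_definite_mat T" "T * T * G = 1\<^sub>m K"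
      using G by (auto simp: inverts_mat_def)
    have "T * T = T * T * (G * (?S * ?S))" using T(1) by (simp add: SSG(2))
    also have "\<dots> = T * T * G * (?S * ?S)"
      by (rule assoc_mult_mat[symmetric, of _ K K _ K _ K])
        (use T(1) G(1) in \<open>auto intro!: mult_carrier_mat[of _ K K]\<close>)
    also have "\<dots> = ?S * ?S"
      unfolding T(3) by (intro left_mult_one_mat[of _ K K] mult_carrier_mat[of _ K K]) simp_all
    finally have "T * T = spectral_mat K u (\<lambda>i. ?f i * ?f i)"
      by (simp only: spectral_mat_mult[OF on])
    from positive_definite_sqrt_unique[OF on _ T(1,2) this] d show "T = ?S" by simp
  qed
qed

text \<open>With \<open>S = G\<^sup>-\<^sup>1\<^sup>/\<^sup>2\<close>, the last two statements are \<open>S G S = I\<close>, the isotropy of the orthonormalized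
vectors, and \<open>|S|\<^sup>2 \<le> 1 / \<lambda>\<^sub>m\<^sub>i\<^sub>n(G)\<close>, the bound on their length.\<close>

lemma inv_sqrt_mat_properties:
  assumes G: "G \<in> carrier_mat K K" "sym_mat K (entries G)" and pos: "0 < lambda_min G"
  shows "inv_sqrt_mat G \<in> carrier_mat K K"
    and "sym_mat K (entries (inv_sqrt_mat G))"
    and "qform K (entries G) (mulv K (entries (inv_sqrt_mat G)) x) = dot K x x"
    and "dot K (mulv K (entries (inv_sqrt_mat G)) x) (mulv K (entries (inv_sqrt_mat G)) x)
      \<le> 1 / lambda_min G * dot K x x"
proof -
  obtain d u where sys: "eigensystem K (entries G) K d u" using spectral_theorem[OF G(2)] by blast
  have d: "lambda_min G \<le> d i" "0 < d i" if "i < K" for i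
    using lambda_min_le_eigenvalue[OF G(1) sys that] pos by auto
  have S: "inv_sqrt_mat G = spectral_mat K u (\<lambda>i. 1 / sqrt (d i))"
    by (rule inv_sqrt_mat_spectral[OF G sys d(2)])
  note on = eigensystem_orthonormal[OF sys]
  note sysS = spectral_mat_eigensystem[OF on, of "\<lambda>i. 1 / sqrt (d i)"]
  show "inv_sqrt_mat G \<in> carrier_mat K K" "sym_mat K (entries (inv_sqrt_mat G))"
    by (simp_all add: S sym_spectral_mat)
  have "qform K (entries G) (mulv K (entries (inv_sqrt_mat G)) x)
      = (\<Sum>i<K. d i * (1 / sqrt (d i) * dot K (u i) x)\<^sup>2)"
    unfolding qform_eigensystem[OF G(2) sys] S
    by (intro sum.cong refl) (simp add: eigensystem_mulv_right[OF sym_spectral_mat sysS])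
  also have "\<dots> = (\<Sum>i<K. (dot K (u i) x)\<^sup>2)"
  proof (intro sum.cong refl)
    fix i assume "i \<in> {..<K}"
    then have "0 < d i" using d(2) by simp
    then show "d i * (1 / sqrt (d i) * dot K (u i) x)\<^sup>2 = (dot K (u i) x)\<^sup>2"
      by (simp add: power_divide)
  qed
  finally show "qform K (entries G) (mulv K (entries (inv_sqrt_mat G)) x) = dot K x x"
    by (simp add: norm_orthonormal[OF on])
  show "dot K (mulv K (entries (inv_sqrt_mat G)) x) (mulv K (entries (inv_sqrt_mat G)) x)
      \<le> 1 / lambda_min G * dot K x x"
    unfolding S mulv_norm_eigensystem[OF sym_spectral_mat sysS] norm_orthonormal[OF on, of x]
      sum_distrib_left
  proof (intro sum_mono mult_right_mono)
    fix i assume "i \<in> {..<K}"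
    then show "(1 / sqrt (d i))\<^sup>2 \<le> 1 / lambda_min G"
      using d[of i] pos by (simp add: power_divide frac_le)
  qed simp
qed

text \<open>The lower bound on the supremum, which the absolute value demands, comes from the first unit vector.\<close>

lemma spectral_norm_le:
  assumes A: "A \<in> carrier_mat K K" and "0 < K" "0 \<le> t"
    and le: "\<And>x. dot K x x = 1 \<Longrightarrow> dot K (mulv K (entries A) x) (mulv K (entries A) x) \<le> t\<^sup>2"
  shows "\<bar>spectral_norm A\<bar> \<le> t"
proof -
  let ?U = "{v \<in> carrier_vec K. euclidean_norm v = 1}"
  have "euclidean_norm (unit_vec K 0) = 1"
    using \<open>0 < K\<close> by (simp add: euclidean_norm_def)
  then have unit: "unit_vec K 0 \<in> ?U" by simp
  have le': "euclidean_norm (A *\<^sub>v v) \<le> t" if "v \<in> ?U" for v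
  proof -
    have v: "v \<in> carrier_vec K" and "scalar_prod v v = 1"
      using that by (auto simp: euclidean_norm_def)
    then have "dot K (vec_index v) (vec_index v) = 1" by (simp add: scalar_prod_dot)
    from le[OF this] have "scalar_prod (A *\<^sub>v v) (A *\<^sub>v v) \<le> t\<^sup>2"
      using mult_mat_vec_mulv[OF A v]
        dot_cong[of K "vec_index (A *\<^sub>v v)" "mulv K (entries A) (vec_index v)"
           "vec_index (A *\<^sub>v v)" "mulv K (entries A) (vec_index v)"]
      by (subst scalar_prod_dot[OF mult_mat_vec_carrier[OF A v]]) metis
    then show ?thesis using \<open>0 \<le> t\<close> by (simp add: euclidean_norm_def real_le_lsqrt)
  qed
  have "?U \<noteq> {}" using unit by blast
  then have "spectral_norm A \<le> t"
    unfolding spectral_norm_def using A le' by (intro cSUP_least) auto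
  moreover have "euclidean_norm (A *\<^sub>v unit_vec K 0) \<le> spectral_norm A"
    unfolding spectral_norm_def using A unit le'
    by (intro cSUP_upper bdd_aboveI[of _ t]) auto
  moreover have "0 \<le> euclidean_norm (A *\<^sub>v unit_vec K 0)"
    by (auto simp: euclidean_norm_def scalar_prod_def intro!: sum_nonneg)
  ultimately show ?thesis by linarith
qed

section \<open>Blocks of truncated vectors\<close>

text \<open>Rounding towards zero to a multiple of \<open>d\<close>: unlike the floor it does not increase the absolute value,
so that rounded vectors obey the same norm bound.\<close>

definition truncate :: "real \<Rightarrow> real \<Rightarrow> real" where
  "truncate d x = sgn x * (d * real_of_int \<lfloor>\<bar>x\<bar> / d\<rfloor>)"

lemma truncate_bounds:
  assumes "0 < d"
  shows "\<bar>truncate d x\<bar> \<le> \<bar>x\<bar>" "\<bar>x - truncate d x\<bar> \<le> d"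
proof -
  define y where "y = d * real_of_int \<lfloor>\<bar>x\<bar> / d\<rfloor>"
  have "y \<le> d * (\<bar>x\<bar> / d)"
    unfolding y_def using assms by (intro mult_left_mono of_int_floor_le) simp
  moreover have "d * (\<bar>x\<bar> / d) < d * (real_of_int \<lfloor>\<bar>x\<bar> / d\<rfloor> + 1)"
    using assms by (intro mult_strict_left_mono) (linarith, simp)
  ultimately have "y \<le> \<bar>x\<bar>" "\<bar>x\<bar> < y + d" using assms by (simp_all add: y_def algebra_simps)
  moreover have "0 \<le> y" using assms by (simp add: y_def)
  moreover have "truncate d x = sgn x * y" by (simp add: truncate_def y_def)
  ultimately show "\<bar>truncate d x\<bar> \<le> \<bar>x\<bar>" "\<bar>x - truncate d x\<bar> \<le> d"
    using assms by (auto simp: sgn_if)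
qed

lemma truncate_finite_range:
  assumes "0 < d"
  shows "finite (truncate d ` {-B..B})"
proof -
  have "truncate d ` {-B..B} \<subseteq> (\<lambda>(s, k). s * (d * real_of_int k)) ` ({-1, 0, 1} \<times> {0..\<lfloor>B / d\<rfloor>})"
  proof
    fix y assume "y \<in> truncate d ` {-B..B}"
    then obtain x where x: "y = truncate d x" "\<bar>x\<bar> \<le> B" by auto
    have "\<lfloor>\<bar>x\<bar> / d\<rfloor> \<in> {0..\<lfloor>B / d\<rfloor>}"
      using x assms by (auto intro!: floor_mono divide_right_mono)
    moreover have "sgn x \<in> {-1, 0, 1}" by (auto simp: sgn_if)
    ultimately show "y \<in> (\<lambda>(s, k). s * (d * real_of_int k)) ` ({-1, 0, 1} \<times> {0..\<lfloor>B / d\<rfloor>})"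
      unfolding x truncate_def by (intro image_eqI[of _ _ "(sgn x, \<lfloor>\<bar>x\<bar> / d\<rfloor>)"]) auto
  qed
  then show ?thesis by (rule finite_subset) auto
qed

lemma truncate_measurable [measurable]: "truncate d \<in> borel_measurable borel"
  unfolding truncate_def by measurable

lemma dot_Cauchy_Schwarz: "(dot K x y)\<^sup>2 \<le> dot K x x * dot K y y"
  using Cauchy_Schwarz_ineq_sum[of x y "{..<K}"] by (simp add: dot_def power2_eq_square)

lemma dot_add_sq_le:
  "dot K (\<lambda>i. x i + y i + z i) (\<lambda>i. x i + y i + z i) \<le> 3 * (dot K x x + dot K y y + dot K z z)"
proof -
  have "(a + b + c) * (a + b + c) \<le> 3 * (a * a + b * b + c * c)" for a b c :: real
    using zero_le_square[of "a - b"] zero_le_square[of "b - c"] zero_le_square[of "a - c"]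
    by (simp add: algebra_simps)
  then show ?thesis
    unfolding dot_def sum.distrib[symmetric] sum_distrib_left by (intro sum_mono)
qed

lemma mulv_norm_le_of_abs_qform:
  assumes sym: "sym_mat K A" and "0 \<le> e" and le: "\<And>x. \<bar>qform K A x\<bar> \<le> e * dot K x x"
  shows "dot K (mulv K A x) (mulv K A x) \<le> e\<^sup>2 * dot K x x"
  unfolding mulv_norm_eigensystem[OF sym eigensystem_eig[OF sym]]
    norm_orthonormal[OF eigvec_orthonormal[OF sym], of x] sum_distrib_left
proof (intro sum_mono mult_right_mono)
  fix i assume "i \<in> {..<K}"
  then have "\<bar>eigval K A i\<bar> \<le> e"
    using le[of "eigvec K A i"] by (simp add: qform_eigvec[OF sym] eigvec_unit[OF sym])
  then show "(eigval K A i)\<^sup>2 \<le> e\<^sup>2" using abs_le_square_iff[of "eigval K A i" e] \<open>0 \<le> e\<close> by simp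
qed simp

definition outer_sum :: "real \<Rightarrow> 'i set \<Rightarrow> ('i \<Rightarrow> nat \<Rightarrow> real) \<Rightarrow> nat \<Rightarrow> nat \<Rightarrow> real" where
  "outer_sum c J v = (\<lambda>a b. c * (\<Sum>i\<in>J. v i a * v i b))"

lemma qform_outer_sum: "qform K (outer_sum c J v) x = c * (\<Sum>i\<in>J. (dot K (v i) x)\<^sup>2)"
proof -
  have "qform K (\<lambda>a b. v i a * v i b) x = (dot K (v i) x)\<^sup>2" for i
    by (simp add: qform_def dot_def mulv_def power2_eq_square sum_product sum_distrib_left
        algebra_simps)
  then show ?thesis by (simp add: outer_sum_def qform_scale_mat qform_sum_mat)
qed

lemma sym_outer_sum: "sym_mat K (outer_sum c J v)"
  by (simp add: sym_mat_def outer_sum_def mult.commute)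

lemma (in prob_space) sum_level_prob:
  assumes "finite (Z ` space M)" "\<And>y. {\<omega>\<in>space M. Z \<omega> = y} \<in> events"
  shows "(\<Sum>y\<in>Z ` space M. level_prob Z y * f y) = (\<integral>\<omega>. (f (Z \<omega>) :: real) \<partial>M)"
proof -
  have "(\<integral>\<omega>. f (Z \<omega>) \<partial>M)
      = (\<integral>\<omega>. (\<Sum>y\<in>Z ` space M. f y * indicator {\<omega>\<in>space M. Z \<omega> = y} \<omega>) \<partial>M)"
  proof (rule Bochner_Integration.integral_cong[OF refl])
    fix \<omega> assume w: "\<omega> \<in> space M"
    then have "(\<Sum>y\<in>Z ` space M. f y * indicator {\<omega>\<in>space M. Z \<omega> = y} \<omega>)
        = (\<Sum>y\<in>Z ` space M. if y = Z \<omega> then f (Z \<omega>) else 0)"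
      by (intro sum.cong) (auto simp: indicator_def)
    then show "f (Z \<omega>) = (\<Sum>y\<in>Z ` space M. f y * indicator {\<omega>\<in>space M. Z \<omega> = y} \<omega>)"
      using w assms(1) by simp
  qed
  also have "\<dots> = (\<Sum>y\<in>Z ` space M. \<integral>\<omega>. f y * indicator {\<omega>\<in>space M. Z \<omega> = y} \<omega> \<partial>M)"
    using assms(2)
    by (intro Bochner_Integration.integral_sum integrable_mult_right integrable_real_indicator)
      (auto simp: emeasure_eq_measure)
  also have "\<dots> = (\<Sum>y\<in>Z ` space M. level_prob Z y * f y)"
    using assms(2) by (intro sum.cong) (auto simp: level_prob_def mult.commute)
  finally show ?thesis by simp
qed

text \<open>Stationarity enters only through the common second moment matrix of the vectors \<open>V (X\<^sub>i)\<close>.\<close>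

locale isotropic_mixing = prob_space M for M :: "'a measure" +
  fixes X :: "int \<Rightarrow> 'a \<Rightarrow> 'x::euclidean_space" and V :: "'x \<Rightarrow> nat \<Rightarrow> real"
    and K n q :: nat and B :: real
  assumes X: "\<And>i. X i \<in> borel_measurable M"
    and V: "\<And>a. a < K \<Longrightarrow> (\<lambda>x. V x a) \<in> borel_measurable borel"
    and V_bounded: "\<And>i \<omega>. \<omega> \<in> space M \<Longrightarrow> dot K (V (X i \<omega>)) (V (X i \<omega>)) \<le> B\<^sup>2"
    and V_isotropic: "\<And>i x. (\<integral>\<omega>. (dot K (V (X i \<omega>)) x)\<^sup>2 \<partial>M) = dot K x x"
    and B_pos: "0 < B" and K_pos: "0 < K" and q_pos: "0 < q" and n_pos: "0 < n"
begin

text \<open>The intervals \<open>{r q + 1..(r + 1) q}\<close>, intersected with the sample; the last ones may be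
incomplete or empty. The even blocks are those with \<open>r = 2 k\<close>, the odd ones those with \<open>r = 2 k + 1\<close>, for
\<open>k < blocks\<close>.\<close>

definition block :: "nat \<Rightarrow> int set" where
  "block r = {i\<in>{1..int n}. nat ((i - 1) div int q) = r}"

definition blocks :: nat where "blocks = n div (2 * q) + 1"

lemma finite_block [simp]: "finite (block r)"
  unfolding block_def by (rule finite_subset[of _ "{1..int n}"]) auto

lemma block_bounds:
  assumes "i \<in> block r"
  shows "int r * int q < i" "i \<le> (int r + 1) * int q"
proof -
  have r: "(i - 1) div int q = int r" using assms q_pos
    by (auto simp: block_def pos_imp_zdiv_nonneg_iff)
  have "int q * ((i - 1) div int q) + (i - 1) mod int q = i - 1" by (rule mult_div_mod_eq)
  moreover have "0 \<le> (i - 1) mod int q" "(i - 1) mod int q < int q" using q_pos by simp_all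
  ultimately show "int r * int q < i" "i \<le> (int r + 1) * int q"
    unfolding r by (auto simp: algebra_simps)
qed

lemma card_block_le: "card (block r) \<le> q"
proof -
  have "block r \<subseteq> {int r * int q + 1..(int r + 1) * int q}"
    using block_bounds by fastforce
  then have "card (block r) \<le> card {int r * int q + 1..(int r + 1) * int q}"
    by (intro card_mono) auto
  then show ?thesis by (simp add: algebra_simps)
qed

lemma sum_blocks:
  "(\<Sum>i\<in>{1..int n}. f i) = (\<Sum>k<blocks. \<Sum>i\<in>block (2 * k). f i)
    + (\<Sum>k<blocks. \<Sum>i\<in>block (2 * k + 1). (f i :: real))"
proof -
  have "nat ((i - 1) div int q) < 2 * blocks" if "i \<in> {1..int n}" for i
  proof -
    have "(i - 1) div int q \<le> int n div int q" using that q_pos by (intro zdiv_mono1) auto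
    then have "nat ((i - 1) div int q) \<le> n div q" by (simp add: zdiv_int nat_le_iff)
    also have "x < 2 * (x div 2 + 1)" for x :: nat by presburger
    also have "n div q div 2 = n div (2 * q)" by (simp add: div_mult2_eq mult.commute)
    finally show ?thesis by (simp add: blocks_def)
  qed
  then have "(\<Sum>i\<in>{1..int n}. f i) = (\<Sum>r<2 * blocks. \<Sum>i\<in>block r. f i)"
    unfolding block_def by (intro sum.group[symmetric]) auto
  also have "(\<Sum>r<2 * m. g r) = (\<Sum>k<m. g (2 * k)) + (\<Sum>k<m. g (2 * k + 1))"
    for m :: nat and g :: "nat \<Rightarrow> real"
    by (induction m) auto
  finally show ?thesis .
qed

lemma V_measurable [measurable]: "a < K \<Longrightarrow> (\<lambda>\<omega>. V (X i \<omega>) a) \<in> borel_measurable M"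
  using measurable_compose[OF X V] by simp

lemma V_component_le: "\<omega> \<in> space M \<Longrightarrow> a < K \<Longrightarrow> \<bar>V (X i \<omega>) a\<bar> \<le> B"
proof -
  assume w: "\<omega> \<in> space M" "a < K"
  have "V (X i \<omega>) a * V (X i \<omega>) a \<le> dot K (V (X i \<omega>)) (V (X i \<omega>))"
    unfolding dot_def using w(2) by (intro member_le_sum) auto
  also have "\<dots> \<le> B\<^sup>2" by (rule V_bounded[OF w(1)])
  finally show ?thesis
    using B_pos abs_le_square_iff[of "V (X i \<omega>) a" B] by (simp add: power2_eq_square)
qed

end

locale discretized_mixing = isotropic_mixing +
  fixes \<delta> :: real
  assumes \<delta>_pos: "0 < \<delta>" and \<delta>_le_1: "\<delta> \<le> 1"
begin

text \<open>Rounding \<open>K\<close> coordinates to this grid moves a vector by at most \<open>\<delta>\<close> in the Euclidean norm.\<close>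

definition grid :: real where "grid = \<delta> / real K"

definition W :: "int \<Rightarrow> 'a \<Rightarrow> nat \<Rightarrow> real" where
  "W i \<omega> a = truncate grid (V (X i \<omega>) a)"

lemma grid_pos: "0 < grid"
  using \<delta>_pos K_pos by (simp add: grid_def)

lemma W_measurable [measurable]: "a < K \<Longrightarrow> (\<lambda>\<omega>. W i \<omega> a) \<in> borel_measurable M"
  unfolding W_def by measurable

lemma W_norm_le: "\<omega> \<in> space M \<Longrightarrow> dot K (W i \<omega>) (W i \<omega>) \<le> B\<^sup>2"
proof -
  assume w: "\<omega> \<in> space M"
  have "W i \<omega> a * W i \<omega> a \<le> V (X i \<omega>) a * V (X i \<omega>) a" for a
    using truncate_bounds(1)[OF grid_pos, of "V (X i \<omega>) a"]
    unfolding W_def by (metis abs_le_square_iff power2_eq_square)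
  then have "dot K (W i \<omega>) (W i \<omega>) \<le> dot K (V (X i \<omega>)) (V (X i \<omega>))"
    unfolding dot_def by (rule sum_mono)
  then show ?thesis using V_bounded[OF w, of i] by linarith
qed

lemma discretization_error:
  "dot K (\<lambda>a. V (X i \<omega>) a - W i \<omega> a) (\<lambda>a. V (X i \<omega>) a - W i \<omega> a) \<le> \<delta>\<^sup>2"
proof -
  have "(V (X i \<omega>) a - W i \<omega> a) * (V (X i \<omega>) a - W i \<omega> a) \<le> grid\<^sup>2" for a
    using truncate_bounds(2)[OF grid_pos, of "V (X i \<omega>) a"] grid_pos
    unfolding W_def by (metis abs_le_square_iff abs_of_pos power2_eq_square)
  then have "dot K (\<lambda>a. V (X i \<omega>) a - W i \<omega> a) (\<lambda>a. V (X i \<omega>) a - W i \<omega> a) \<le> real K * grid\<^sup>2"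
    unfolding dot_def using sum_bounded_above[of "{..<K}" _ "grid\<^sup>2"] by simp
  also have "\<dots> = \<delta>\<^sup>2 / real K" using K_pos by (simp add: grid_def power2_eq_square)
  also have "\<dots> \<le> \<delta>\<^sup>2" using K_pos mult_left_mono[of 1 "real K" "\<delta>\<^sup>2"]
    by (simp add: divide_le_eq)
  finally show ?thesis .
qed

lemma dot_V_W_close:
  assumes "\<omega> \<in> space M"
  shows "\<bar>(dot K (V (X i \<omega>)) x)\<^sup>2 - (dot K (W i \<omega>) x)\<^sup>2\<bar> \<le> 2 * \<delta> * B * dot K x x"
    and "(dot K (W i \<omega>) x)\<^sup>2 \<le> 2 * (dot K (V (X i \<omega>)) x)\<^sup>2 + 2 * dot K x x"
proof -
  let ?v = "dot K (V (X i \<omega>)) x" and ?w = "dot K (W i \<omega>) x" and ?x = "sqrt (dot K x x)"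
  have root: "\<bar>dot K y x\<bar> \<le> c * ?x" if "dot K y y \<le> c\<^sup>2" "0 \<le> c" for y c
  proof -
    have "(dot K y x)\<^sup>2 \<le> c\<^sup>2 * dot K x x"
      using dot_Cauchy_Schwarz[of K y x] mult_right_mono[OF that(1) dot_self_nonneg[of K x]]
      by linarith
    also have "\<dots> = (c * ?x)\<^sup>2" by (simp add: power_mult_distrib)
    finally show ?thesis using that(2) abs_le_square_iff[of "dot K y x" "c * ?x"] by simp
  qed
  have v: "\<bar>?v\<bar> \<le> B * ?x" by (rule root[OF V_bounded[OF assms]]) (use B_pos in simp)
  have w: "\<bar>?w\<bar> \<le> B * ?x" by (rule root[OF W_norm_le[OF assms]]) (use B_pos in simp)
  have diff: "\<bar>?v - ?w\<bar> \<le> \<delta> * ?x"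
    using root[OF discretization_error, of i \<omega>] \<delta>_pos by (simp add: dot_simps)
  have "\<bar>?v\<^sup>2 - ?w\<^sup>2\<bar> = \<bar>?v - ?w\<bar> * \<bar>?v + ?w\<bar>"
    by (simp add: abs_mult[symmetric] power2_eq_square algebra_simps)
  also have "\<dots> \<le> (\<delta> * ?x) * (2 * B * ?x)"
    using diff v w \<delta>_pos by (intro mult_mono) auto
  also have "\<dots> = 2 * \<delta> * B * (?x * ?x)" by (simp add: algebra_simps)
  finally show "\<bar>?v\<^sup>2 - ?w\<^sup>2\<bar> \<le> 2 * \<delta> * B * dot K x x" by simp
  have "?w\<^sup>2 \<le> 2 * ?v\<^sup>2 + 2 * (?v - ?w)\<^sup>2"
    (is "_ \<le> _ + 2 * ?d")
    using zero_le_power2[of "2 * ?v - ?w"] by (simp add: power2_eq_square algebra_simps)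
  moreover have "\<bar>?v - ?w\<bar> \<le> \<bar>?x\<bar>"
    using diff mult_right_mono[OF \<delta>_le_1, of ?x] by simp
  then have "?d \<le> ?x\<^sup>2" by (simp only: abs_le_square_iff)
  then have "?d \<le> dot K x x" by simp
  ultimately show "?w\<^sup>2 \<le> 2 * ?v\<^sup>2 + 2 * dot K x x" by linarith
qed

lemma integrable_dot_V: "integrable M (\<lambda>\<omega>. (dot K (V (X i \<omega>)) x)\<^sup>2)"
  and integrable_dot_W: "integrable M (\<lambda>\<omega>. (dot K (W i \<omega>) x)\<^sup>2)"
proof -
  have "(dot K (V (X i \<omega>)) x)\<^sup>2 \<le> B\<^sup>2 * dot K x x" "(dot K (W i \<omega>) x)\<^sup>2 \<le> B\<^sup>2 * dot K x x"
    if "\<omega> \<in> space M" for \<omega>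
    using dot_Cauchy_Schwarz[of K _ x] mult_right_mono[OF V_bounded[OF that] dot_self_nonneg[of K x]]
      mult_right_mono[OF W_norm_le[OF that] dot_self_nonneg[of K x]]
    by (meson order_trans)+
  moreover have "(\<lambda>\<omega>. (dot K (V (X i \<omega>)) x)\<^sup>2) \<in> borel_measurable M"
    "(\<lambda>\<omega>. (dot K (W i \<omega>) x)\<^sup>2) \<in> borel_measurable M"
    unfolding dot_def by measurable
  ultimately show "integrable M (\<lambda>\<omega>. (dot K (V (X i \<omega>)) x)\<^sup>2)"
    "integrable M (\<lambda>\<omega>. (dot K (W i \<omega>) x)\<^sup>2)"
    by (auto intro!: integrable_const_bound[of _ "B\<^sup>2 * dot K x x"])
qed

lemma expectation_dot_W_le: "(\<integral>\<omega>. (dot K (W i \<omega>) x)\<^sup>2 \<partial>M) \<le> 4 * dot K x x"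
proof -
  have "(\<integral>\<omega>. (dot K (W i \<omega>) x)\<^sup>2 \<partial>M) \<le> (\<integral>\<omega>. 2 * (dot K (V (X i \<omega>)) x)\<^sup>2 + 2 * dot K x x \<partial>M)"
    using integrable_dot_V integrable_dot_W dot_V_W_close(2) by (intro integral_mono) auto
  also have "\<dots> = 4 * dot K x x"
    using integrable_dot_V by (simp add: V_isotropic prob_space)
  finally show ?thesis .
qed

lemma expectation_dot_W_close:
  "\<bar>(\<integral>\<omega>. (dot K (W i \<omega>) x)\<^sup>2 \<partial>M) - dot K x x\<bar> \<le> 2 * \<delta> * B * dot K x x"
proof -
  have eq: "(\<integral>\<omega>. (dot K (W i \<omega>) x)\<^sup>2 \<partial>M) - dot K x x
      = (\<integral>\<omega>. (dot K (W i \<omega>) x)\<^sup>2 - (dot K (V (X i \<omega>)) x)\<^sup>2 \<partial>M)"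
    using integrable_dot_V integrable_dot_W by (simp add: V_isotropic)
  have "\<bar>\<integral>\<omega>. (dot K (W i \<omega>) x)\<^sup>2 - (dot K (V (X i \<omega>)) x)\<^sup>2 \<partial>M\<bar>
      \<le> (\<integral>\<omega>. \<bar>(dot K (W i \<omega>) x)\<^sup>2 - (dot K (V (X i \<omega>)) x)\<^sup>2\<bar> \<partial>M)"
    by (rule integral_abs_bound)
  also have "\<dots> \<le> (\<integral>\<omega>. 2 * \<delta> * B * dot K x x \<partial>M)"
    using integrable_dot_V integrable_dot_W dot_V_W_close(1)
    by (intro integral_mono) (auto simp: abs_minus_commute)
  finally show ?thesis unfolding eq by (simp add: prob_space)
qed

text \<open>Entries outside the \<open>K\<times>K\<close> square are set to zero in order that the function take finitely many values.\<close>

definition block_mat :: "nat \<Rightarrow> 'a \<Rightarrow> nat \<Rightarrow> nat \<Rightarrow> real" where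
  "block_mat r \<omega> = (\<lambda>a b. if a < K \<and> b < K
     then outer_sum (1 / real n) (block r) (\<lambda>i. W i \<omega>) a b else 0)"

lemma qform_block_mat:
  "qform K (block_mat r \<omega>) x = 1 / real n * (\<Sum>i\<in>block r. (dot K (W i \<omega>) x)\<^sup>2)"
proof -
  have "mulv K (block_mat r \<omega>) x a = mulv K (outer_sum (1 / real n) (block r) (\<lambda>i. W i \<omega>)) x a"
    if "a < K" for a
    using that by (auto simp: mulv_def block_mat_def)
  then show ?thesis
    unfolding qform_outer_sum[symmetric] qform_def by (intro dot_cong) auto
qed

lemma sym_block_mat: "sym_mat K (block_mat r \<omega>)"
  using sym_outer_sum[of K "1 / real n" "block r" "\<lambda>i. W i \<omega>"]
  by (simp add: sym_mat_def block_mat_def)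

lemma qform_block_mat_le:
  assumes "\<omega> \<in> space M"
  shows "qform K (block_mat r \<omega>) x \<le> real q * B\<^sup>2 / real n * dot K x x"
proof -
  have "(\<Sum>i\<in>block r. (dot K (W i \<omega>) x)\<^sup>2) \<le> (\<Sum>i\<in>block r. B\<^sup>2 * dot K x x)"
    using dot_Cauchy_Schwarz[of K _ x] mult_right_mono[OF W_norm_le[OF assms] dot_self_nonneg[of K x]]
    by (intro sum_mono) (meson order_trans)
  also have "\<dots> \<le> real q * (B\<^sup>2 * dot K x x)"
    using card_block_le[of r] by (simp add: mult_right_mono)
  finally show ?thesis
    unfolding qform_block_mat using n_pos by (simp add: field_simps)
qed

lemma finite_range_block_mat: "finite (block_mat r ` space M)"
proof -
  define F where "F = truncate grid ` {-B..B}"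
  define G where "G = (\<lambda>u a b. if a < K \<and> b < K
     then outer_sum (1 / real n) (block r) (\<lambda>i a. u (i, a)) a b else (0::real))"
  have "block_mat r ` space M \<subseteq> G ` (Pi\<^sub>E (block r \<times> {..<K}) (\<lambda>_. F))"
  proof
    fix A assume "A \<in> block_mat r ` space M"
    then obtain \<omega> where w: "\<omega> \<in> space M" "A = block_mat r \<omega>" by auto
    define u where "u = (\<lambda>p\<in>block r \<times> {..<K}. W (fst p) \<omega> (snd p))"
    have "u \<in> Pi\<^sub>E (block r \<times> {..<K}) (\<lambda>_. F)"
      using V_component_le[OF w(1)] by (auto simp: u_def F_def W_def abs_le_iff minus_le_iff)
    moreover have "A = G u"
      unfolding w G_def block_mat_def outer_sum_def
      by (intro ext) (auto simp: u_def intro!: sum.cong)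
    ultimately show "A \<in> G ` (Pi\<^sub>E (block r \<times> {..<K}) (\<lambda>_. F))" by blast
  qed
  moreover have "finite (Pi\<^sub>E (block r \<times> {..<K}) (\<lambda>_. F))"
    using truncate_finite_range[OF grid_pos] by (intro finite_PiE) (auto simp: F_def)
  ultimately show ?thesis by (meson finite_imageI finite_subset)
qed

text \<open>The level sets of a block belong to the sigma-algebra of any set of times that contains the block, which
is what relates blocks to the mixing coefficient.\<close>

lemma block_mat_level_set:
  assumes "block r \<subseteq> I"
  shows "{\<omega>\<in>space M. block_mat r \<omega> = A} \<in> sigma_gen_by M X I"
proof -
  define N where "N = sigma (space M) (\<Union>i\<in>I. {X i -` A \<inter> space M |A. A \<in> sets borel})"
  have N: "space N = space M" "sets N = sigma_gen_by M X I"
    unfolding N_def sigma_gen_by_def by (auto simp: space_measure_of_conv intro!: sets_measure_of)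
  have "X i \<in> borel_measurable N" if "i \<in> I" for i
    using that by (intro measurableI) (auto simp: N sigma_gen_by_def intro!: sigma_sets.Basic)
  then have W: "(\<lambda>\<omega>. W i \<omega> a) \<in> borel_measurable N" if "i \<in> block r" "a < K" for i a
    using that assms measurable_compose[OF _ V] measurable_compose[OF _ truncate_measurable]
    unfolding W_def by blast
  show ?thesis
  proof (cases "\<forall>a b. \<not> (a < K \<and> b < K) \<longrightarrow> A a b = 0")
    case True
    then have "block_mat r \<omega> = A \<longleftrightarrow> (\<forall>a\<in>{..<K}. \<forall>b\<in>{..<K}. block_mat r \<omega> a b = A a b)" for \<omega>
      by (auto simp: fun_eq_iff block_mat_def)
    then have "{\<omega>\<in>space M. block_mat r \<omega> = A}
        = {\<omega>\<in>space N. \<forall>a\<in>{..<K}. \<forall>b\<in>{..<K}. block_mat r \<omega> a b = A a b}"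
      by (simp add: N)
    also have "\<dots> \<in> sets N"
    proof (intro sets.sets_Collect_finite_All)
      fix a b assume "a \<in> {..<K}" "b \<in> {..<K}"
      then have "(\<lambda>\<omega>. block_mat r \<omega> a b) \<in> borel_measurable N"
        using W unfolding block_mat_def outer_sum_def
        by (auto intro!: borel_measurable_times borel_measurable_sum)
      then show "{\<omega> \<in> space N. block_mat r \<omega> a b = A a b} \<in> sets N" by measurable
    qed auto
    finally show ?thesis by (simp add: N)
  next
    case False
    then have "{\<omega>\<in>space M. block_mat r \<omega> = A} = {}"
      by (auto simp: block_mat_def)
    then show ?thesis by (simp only: N(2)[symmetric] sets.empty_sets)
  qed
qed

definition block_mean :: "nat \<Rightarrow> nat \<Rightarrow> nat \<Rightarrow> real" where
  "block_mean r = (\<lambda>a b. \<Sum>A\<in>block_mat r ` space M. level_prob (block_mat r) A * A a b)"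

lemma block_mat_level_event: "{\<omega>\<in>space M. block_mat r \<omega> = A} \<in> events"
  using block_mat_level_set[OF subset_UNIV] sigma_gen_by_subset[of X M, OF X] by blast

lemma qform_block_mean:
  "qform K (block_mean r) x = 1 / real n * (\<Sum>i\<in>block r. \<integral>\<omega>. (dot K (W i \<omega>) x)\<^sup>2 \<partial>M)"
proof -
  have "qform K (block_mean r) x
      = (\<Sum>A\<in>block_mat r ` space M. level_prob (block_mat r) A * qform K A x)"
    by (simp add: block_mean_def qform_sum_mat qform_scale_mat)
  also have "\<dots> = (\<integral>\<omega>. qform K (block_mat r \<omega>) x \<partial>M)"
    by (rule sum_level_prob[OF finite_range_block_mat block_mat_level_event])
  finally show ?thesis
    using integrable_dot_W by (simp add: qform_block_mat)
qed

lemma sym_block_mean: "sym_mat K (block_mean r)"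
  using sym_block_mat by (auto simp: sym_mat_def block_mean_def intro!: sum.cong)

lemma qform_block_mean_le:
  "qform K (block_mean r) x \<le> 4 * real (card (block r)) / real n * dot K x x"
proof -
  have "(\<Sum>i\<in>block r. \<integral>\<omega>. (dot K (W i \<omega>) x)\<^sup>2 \<partial>M) \<le> (\<Sum>i\<in>block r. 4 * dot K x x)"
    by (intro sum_mono expectation_dot_W_le)
  then show ?thesis
    unfolding qform_block_mean using n_pos by (simp add: field_simps)
qed

definition parity_sum :: "nat \<Rightarrow> 'a \<Rightarrow> nat \<Rightarrow> nat \<Rightarrow> real" where
  "parity_sum s \<omega> = (\<lambda>a b. \<Sum>k<blocks. block_mat (2 * k + s) \<omega> a b - block_mean (2 * k + s) a b)"

text \<open>The blocks of one parity decouple, and \<open>tail_bound\<close> applies to the product law of their values. The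
means of the blocks add up to at most \<open>4 I\<close>; the factor \<open>4\<close> instead of \<open>1\<close> accounts for the rounding.\<close>

lemma parity_sum_tail:
  assumes "s \<le> 1" "0 < t"
  defines "R \<equiv> real q * B\<^sup>2 / real n"
  defines "bad \<equiv> {\<omega>\<in>space M. \<exists>x. dot K x x = 1 \<and>
    t\<^sup>2 < dot K (mulv K (parity_sum s \<omega>) x) (mulv K (parity_sum s \<omega>) x)}"
  shows "bad \<in> events"
    and "prob bad \<le> real K * ((16 * (real P)\<^sup>2 * R\<^sup>2 + 80 * real P * R) / t\<^sup>2) ^ P
      + real blocks * (2 * beta_mixing_coeff M X q)"
proof -
  let ?Z = "\<lambda>k. block_mat (2 * k + s)"
  let ?S = "\<lambda>k. ?Z k ` space M" and ?w = "\<lambda>k. level_prob (?Z k)"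
  let ?c = "\<lambda>k. 4 * real (card (block (2 * k + s))) / real n"
  interpret W: independent_psd "{..<blocks}" ?S ?w K R ?c
  proof (intro independent_psd.intro independent_psd_axioms.intro)
    show "product_weights {..<blocks} ?S ?w"
      by (rule product_weights_level_prob[OF _ finite_range_block_mat block_mat_level_event]) simp
    show "0 \<le> R" by (simp add: R_def)
    show "sym_mat K A" if "A \<in> ?S k" for A k using that sym_block_mat by auto
    show "0 \<le> qform K A x" if "A \<in> ?S k" for A k x
      using that by (auto simp: qform_block_mat intro!: sum_nonneg divide_nonneg_nonneg)
    show "qform K A x \<le> R * dot K x x" if "A \<in> ?S k" for A k x
      using that qform_block_mat_le by (auto simp: R_def)
    show "qform K (\<lambda>a b. \<Sum>A\<in>?S k. ?w k A * A a b) x \<le> ?c k * dot K x x" for k x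
      using qform_block_mean_le[of "2 * k + s" x] by (simp add: block_mean_def)
  qed
  have csum: "(\<Sum>k<blocks. ?c k) \<le> 4"
  proof -
    have "(\<Sum>k<blocks. real (card (block (2 * k + s)))) \<le>
        (\<Sum>k<blocks. real (card (block (2 * k)))) + (\<Sum>k<blocks. real (card (block (2 * k + 1))))"
      using assms(1) by (cases "s = 0") (auto simp: le_Suc_eq intro: sum_nonneg)
    also have "\<dots> = real n" using sum_blocks[of "\<lambda>_. 1"] by simp
    finally have "4 * (\<Sum>k<blocks. real (card (block (2 * k + s)))) / real n \<le> 4"
      using n_pos by (simp add: divide_le_eq)
    then show ?thesis by (simp add: sum_distrib_left sum_divide_distrib)
  qed
  have c0: "0 \<le> (\<Sum>k<blocks. ?c k)" by (intro sum_nonneg) simp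
  define badz where "badz = (\<lambda>z. \<exists>x. dot K x x = 1 \<and>
    t\<^sup>2 < dot K (mulv K (W.centred_sum z) x) (mulv K (W.centred_sum z) x))"
  have centred: "W.centred_sum (\<lambda>k\<in>{..<blocks}. ?Z k \<omega>) = parity_sum s \<omega>" for \<omega>
    by (simp add: W.centred_sum_def W.mean_def parity_sum_def block_mean_def)
  have bad: "bad = {\<omega>\<in>space M. badz (\<lambda>k\<in>{..<blocks}. ?Z k \<omega>)}"
    unfolding bad_def badz_def centred ..
  \<comment> \<open>The last index of the preceding block of the same parity.\<close>
  define time where "time k = (2 * int k + int s - 1) * int q" for k :: nat
  have past: "{\<omega>\<in>space M. ?Z j \<omega> = y} \<in> sigma_gen_by M X {..time k}" if "j < k" for j k y
  proof (rule block_mat_level_set, rule subsetI)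
    fix i assume "i \<in> block (2 * j + s)"
    then have "i \<le> (int (2 * j + s) + 1) * int q" by (rule block_bounds)
    also have "\<dots> \<le> time k"
      unfolding time_def using that by (intro mult_right_mono) auto
    finally show "i \<in> {..time k}" by simp
  qed
  have future: "{\<omega>\<in>space M. ?Z k \<omega> = y} \<in> sigma_gen_by M X {time k + int q..}" for k y
  proof (rule block_mat_level_set, rule subsetI)
    fix i assume "i \<in> block (2 * k + s)"
    then have "int (2 * k + s) * int q < i" by (rule block_bounds)
    then show "i \<in> {time k + int q..}" by (simp add: time_def algebra_simps)
  qed
  note dec = decoupled_event_bound[of X blocks ?Z time q badz, OF X finite_range_block_mat past future]
  show "bad \<in> events" unfolding bad by (rule dec(2))
  have "W.E (\<lambda>z. if badz z then 1 else 0)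
      \<le> real K * ((16 * (real P)\<^sup>2 * R\<^sup>2 + 20 * real P * R * (\<Sum>k<blocks. ?c k)) / t\<^sup>2) ^ P"
    unfolding badz_def by (rule W.tail_bound[OF c0 \<open>0 < t\<close> K_pos])
  also have "\<dots> \<le> real K * ((16 * (real P)\<^sup>2 * R\<^sup>2 + 20 * real P * R * 4) / t\<^sup>2) ^ P"
    using csum c0 W.R_nonneg
    by (intro mult_left_mono power_mono divide_right_mono add_left_mono divide_nonneg_nonneg
        add_nonneg_nonneg mult_nonneg_nonneg) auto
  also have "20 * real P * R * 4 = 80 * real P * R" by simp
  finally show "prob bad \<le> real K * ((16 * (real P)\<^sup>2 * R\<^sup>2 + 80 * real P * R) / t\<^sup>2) ^ P
      + real blocks * (2 * beta_mixing_coeff M X q)"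
    using dec(1) unfolding bad by linarith
qed

end

section \<open>Tail bound for the deviation from isotropy\<close>

lemma qform_identity: "qform K (\<lambda>a b. if a = b then 1 else 0) x = dot K x x"
proof -
  have "mulv K (\<lambda>a b. if a = b then 1 else 0) x a = x a" if "a < K" for a
    using that by (simp add: mulv_def if_distrib[of "\<lambda>c. c * _"] cong: if_cong)
  then show ?thesis unfolding qform_def by (intro dot_cong) auto
qed

context isotropic_mixing
begin

definition deviation :: "'a \<Rightarrow> nat \<Rightarrow> nat \<Rightarrow> real" where
  "deviation \<omega> = (\<lambda>a b. outer_sum (1 / real n) {1..int n} (\<lambda>i. V (X i \<omega>)) a b
     - (if a = b then 1 else 0))"

end

context discretized_mixing
begin

text \<open>What remains of the deviation after the centred block sums of both parities: the effect of rounding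
on the sample average and on the expectation.\<close>

definition residual :: "'a \<Rightarrow> nat \<Rightarrow> nat \<Rightarrow> real" where
  "residual \<omega> = (\<lambda>a b. deviation \<omega> a b - (parity_sum 0 \<omega> a b + parity_sum 1 \<omega> a b))"

lemma sym_residual: "sym_mat K (residual \<omega>)"
proof -
  have "block_mat r \<omega> a b = block_mat r \<omega> b a" "block_mean r a b = block_mean r b a"
    if "a < K" "b < K" for r a b
    using sym_block_mat[of r \<omega>] sym_block_mean[of r] that by (auto simp: sym_mat_def)
  then show ?thesis
    using sym_outer_sum[of K "1 / real n" "{1..int n}" "\<lambda>i. V (X i \<omega>)"]
    by (simp add: sym_mat_def residual_def deviation_def parity_sum_def)
qed

lemma qform_residual:
  "qform K (residual \<omega>) x = 1 / real n * (\<Sum>i\<in>{1..int n}.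
     ((dot K (V (X i \<omega>)) x)\<^sup>2 - (dot K (W i \<omega>) x)\<^sup>2)
     + ((\<integral>\<omega>. (dot K (W i \<omega>) x)\<^sup>2 \<partial>M) - dot K x x))"
proof -
  let ?w = "\<lambda>i. (dot K (W i \<omega>) x)\<^sup>2" and ?e = "\<lambda>i. (\<integral>\<omega>. (dot K (W i \<omega>) x)\<^sup>2 \<partial>M)"
  have parity: "qform K (parity_sum s \<omega>) x
      = 1 / real n * (\<Sum>k<blocks. \<Sum>i\<in>block (2 * k + s). ?w i - ?e i)" for s
    unfolding parity_sum_def
    by (simp only: qform_sum_mat qform_diff_mat qform_block_mat qform_block_mean
        right_diff_distrib[symmetric] sum_subtractf[symmetric] sum_distrib_left[symmetric])
  have "qform K (parity_sum 0 \<omega>) x + qform K (parity_sum 1 \<omega>) x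
      = 1 / real n * (\<Sum>i\<in>{1..int n}. ?w i - ?e i)"
    unfolding parity distrib_left[symmetric] sum_blocks by simp
  moreover have "qform K (residual \<omega>) x = qform K (deviation \<omega>) x
      - (qform K (parity_sum 0 \<omega>) x + qform K (parity_sum 1 \<omega>) x)"
    by (simp only: residual_def qform_diff_mat qform_add_mat)
  moreover have "qform K (deviation \<omega>) x
      = 1 / real n * (\<Sum>i\<in>{1..int n}. (dot K (V (X i \<omega>)) x)\<^sup>2) - dot K x x"
    by (simp only: deviation_def qform_diff_mat qform_outer_sum qform_identity)
  moreover have "dot K x x = 1 / real n * (\<Sum>i\<in>{1..int n}. dot K x x)"
    using n_pos by simp
  ultimately show ?thesis
    by (simp add: sum.distrib sum_subtractf algebra_simps diff_divide_distrib add_divide_distrib)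
qed

lemma qform_residual_le:
  assumes "\<omega> \<in> space M"
  shows "\<bar>qform K (residual \<omega>) x\<bar> \<le> 4 * \<delta> * B * dot K x x"
proof -
  have "\<bar>\<Sum>i\<in>{1..int n}. ((dot K (V (X i \<omega>)) x)\<^sup>2 - (dot K (W i \<omega>) x)\<^sup>2)
      + ((\<integral>\<omega>. (dot K (W i \<omega>) x)\<^sup>2 \<partial>M) - dot K x x)\<bar>
    \<le> (\<Sum>i\<in>{1..int n}. 4 * \<delta> * B * dot K x x)"
  proof (rule order_trans[OF sum_abs], rule sum_mono)
    fix i
    show "\<bar>((dot K (V (X i \<omega>)) x)\<^sup>2 - (dot K (W i \<omega>) x)\<^sup>2)
        + ((\<integral>\<omega>. (dot K (W i \<omega>) x)\<^sup>2 \<partial>M) - dot K x x)\<bar> \<le> 4 * \<delta> * B * dot K x x"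
      using dot_V_W_close(1)[OF assms, of i x] expectation_dot_W_close[of i x] by linarith
  qed
  then show ?thesis
    unfolding qform_residual using n_pos by (simp add: abs_mult divide_le_eq mult.commute)
qed

lemma deviation_norm_le:
  assumes "\<omega> \<in> space M" "4 * \<delta> * B \<le> t" "dot K x x = 1"
    and "\<And>s. s \<le> 1 \<Longrightarrow> dot K (mulv K (parity_sum s \<omega>) x) (mulv K (parity_sum s \<omega>) x) \<le> t\<^sup>2"
  shows "dot K (mulv K (deviation \<omega>) x) (mulv K (deviation \<omega>) x) \<le> (3 * t)\<^sup>2"
proof -
  let ?p = "\<lambda>s. mulv K (parity_sum s \<omega>) x" and ?r = "mulv K (residual \<omega>) x"
  have t: "0 \<le> t" using assms(2) \<delta>_pos B_pos by (meson less_imp_le mult_pos_pos order_trans zero_less_numeral)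
  have "\<bar>qform K (residual \<omega>) y\<bar> \<le> t * dot K y y" for y
    using qform_residual_le[OF assms(1), of y] mult_right_mono[OF assms(2) dot_self_nonneg[of K y]]
    by linarith
  then have "dot K ?r ?r \<le> t\<^sup>2"
    using mulv_norm_le_of_abs_qform[OF sym_residual t, of \<omega> x] assms(3) by simp
  moreover have "dot K (?p 0) (?p 0) \<le> t\<^sup>2" "dot K (?p 1) (?p 1) \<le> t\<^sup>2"
    using assms(4) by auto
  moreover have "mulv K (deviation \<omega>) x = (\<lambda>a. ?p 0 a + ?p 1 a + ?r a)"
    by (simp add: residual_def mulv_diff_mat mulv_add_mat)
  ultimately show ?thesis
    using dot_add_sq_le[of K "?p 0" "?p 1" ?r] by (simp add: power_mult_distrib)
qed

end

text \<open>If the deviation exceeds \<open>3 t\<close>, then one of its three parts exceeds \<open>t\<close>, and the residual never does when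
the grid is fine enough.\<close>

theorem (in isotropic_mixing) deviation_tail:
  assumes "0 < t"
  defines "R \<equiv> real q * B\<^sup>2 / real n"
  shows "\<exists>T\<in>events. {\<omega>\<in>space M. \<exists>x. dot K x x = 1 \<and>
      (3 * t)\<^sup>2 < dot K (mulv K (deviation \<omega>) x) (mulv K (deviation \<omega>) x)} \<subseteq> T \<and>
    prob T \<le> 2 * (real K * ((16 * (real P)\<^sup>2 * R\<^sup>2 + 80 * real P * R) / t\<^sup>2) ^ P
      + real blocks * (2 * beta_mixing_coeff M X q))"
proof -
  \<comment> \<open>The residual is at most \<open>4 \<delta> B\<close>.\<close>
  define \<delta> where "\<delta> = min 1 (t / (4 * B))"
  have \<delta>: "0 < \<delta>" "\<delta> \<le> 1" "4 * \<delta> * B \<le> t"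
    using assms(1) B_pos by (auto simp: \<delta>_def min_def field_simps)
  interpret discretized_mixing M X V K n q B \<delta>
    by unfold_locales (fact \<delta>)+
  define bad where "bad = (\<lambda>s. {\<omega>\<in>space M. \<exists>x. dot K x x = 1 \<and>
    t\<^sup>2 < dot K (mulv K (parity_sum s \<omega>) x) (mulv K (parity_sum s \<omega>) x)})"
  let ?b = "real K * ((16 * (real P)\<^sup>2 * R\<^sup>2 + 80 * real P * R) / t\<^sup>2) ^ P
      + real blocks * (2 * beta_mixing_coeff M X q)"
  have bad: "bad s \<in> events" "prob (bad s) \<le> ?b" if "s \<le> 1" for s
    using parity_sum_tail[OF that assms(1)] unfolding bad_def R_def by blast+
  have "prob (bad 0 \<union> bad 1) \<le> prob (bad 0) + prob (bad 1)"
    using bad by (intro measure_Un_le) auto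
  also have "\<dots> \<le> 2 * ?b" using bad(2)[of 0] bad(2)[of 1] by simp
  finally have "prob (bad 0 \<union> bad 1) \<le> 2 * ?b" .
  moreover have "{\<omega>\<in>space M. \<exists>x. dot K x x = 1 \<and>
      (3 * t)\<^sup>2 < dot K (mulv K (deviation \<omega>) x) (mulv K (deviation \<omega>) x)} \<subseteq> bad 0 \<union> bad 1"
  proof
    fix \<omega> assume "\<omega> \<in> {\<omega>\<in>space M. \<exists>x. dot K x x = 1 \<and>
      (3 * t)\<^sup>2 < dot K (mulv K (deviation \<omega>) x) (mulv K (deviation \<omega>) x)}"
    then obtain x where w: "\<omega> \<in> space M" and x: "dot K x x = 1"
      "(3 * t)\<^sup>2 < dot K (mulv K (deviation \<omega>) x) (mulv K (deviation \<omega>) x)" by blast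
    then obtain s where "s \<le> 1"
      "t\<^sup>2 < dot K (mulv K (parity_sum s \<omega>) x) (mulv K (parity_sum s \<omega>) x)"
      using deviation_norm_le[OF w \<delta>(3) x(1)] by (meson not_less)
    then have "\<omega> \<in> bad s" "s = 0 \<or> s = 1" using w x(1) by (auto simp: bad_def)
    then show "\<omega> \<in> bad 0 \<union> bad 1" by auto
  qed
  ultimately show ?thesis using bad(1)[of 0] bad(1)[of 1] by (intro bexI[of _ "bad 0 \<union> bad 1"]) auto
qed

text \<open>The order \<open>2 P\<close> of the moment is of the size of \<open>ln K\<close>: then \<open>K \<le> e\<^sup>P\<close>, so the dimension contributes only
a constant factor to the \<open>P\<close>-th root. The hypothesis \<open>3 \<le> K\<close> gives \<open>1 \<le> ln K\<close>, hence \<open>P \<le> 2 ln K\<close>.\<close>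

lemma moment_order_choice:
  fixes K :: nat and R C \<rho> :: real
  defines "P \<equiv> nat \<lceil>ln (real K)\<rceil>"
  assumes K: "3 \<le> K" and R: "0 \<le> R" and \<rho>: "0 < \<rho>" "\<rho> \<le> 1" "\<rho>\<^sup>2 = R * ln (real K)"
    and C: "0 < C" "224 * exp 1 \<le> C\<^sup>2"
  shows "real K * ((16 * (real P)\<^sup>2 * R\<^sup>2 + 80 * real P * R) / (C * \<rho>)\<^sup>2) ^ P \<le> 224 * exp 1 / C\<^sup>2"
proof -
  have "exp 1 \<le> real K" using exp_le K by linarith
  then have ln: "1 \<le> ln (real K)" using K by (simp add: ln_ge_iff)
  then have P: "ln (real K) \<le> real P" "real P \<le> 2 * ln (real K)" "1 \<le> P"
    unfolding P_def by linarith+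
  have PR: "0 \<le> real P * R" "real P * R \<le> 2 * \<rho>\<^sup>2"
    using mult_right_mono[OF P(2) R] R by (simp_all add: \<rho>(3) mult_ac)
  have \<rho>2: "\<rho>\<^sup>2 \<le> 1" using power_le_one[of \<rho> 2] \<rho>(1,2) by simp
  have "16 * (real P)\<^sup>2 * R\<^sup>2 + 80 * real P * R = 16 * (real P * R)\<^sup>2 + 80 * (real P * R)"
    by (simp add: power_mult_distrib)
  also have "\<dots> \<le> 16 * (2 * \<rho>\<^sup>2)\<^sup>2 + 80 * (2 * \<rho>\<^sup>2)"
    using PR by (intro add_mono mult_left_mono power_mono) auto
  also have "\<dots> = 64 * (\<rho>\<^sup>2 * \<rho>\<^sup>2) + 160 * \<rho>\<^sup>2" by (simp add: power2_eq_square)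
  also have "\<dots> \<le> 224 * \<rho>\<^sup>2" using mult_right_mono[OF \<rho>2, of "\<rho>\<^sup>2"] by simp
  finally have "(16 * (real P)\<^sup>2 * R\<^sup>2 + 80 * real P * R) / (C * \<rho>)\<^sup>2 \<le> 224 * \<rho>\<^sup>2 / (C * \<rho>)\<^sup>2"
    by (rule divide_right_mono) simp
  also have "\<dots> = 224 / C\<^sup>2" using \<rho>(1) by (simp add: power_mult_distrib)
  finally have "((16 * (real P)\<^sup>2 * R\<^sup>2 + 80 * real P * R) / (C * \<rho>)\<^sup>2) ^ P \<le> (224 / C\<^sup>2) ^ P"
    using R by (intro power_mono) auto
  then have "real K * ((16 * (real P)\<^sup>2 * R\<^sup>2 + 80 * real P * R) / (C * \<rho>)\<^sup>2) ^ P
      \<le> exp 1 ^ P * (224 / C\<^sup>2) ^ P"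
  proof (rule mult_mono[rotated])
    have "real K = exp (ln (real K))" using K by simp
    also have "\<dots> \<le> exp (real P)" using P by simp
    also have "\<dots> = exp 1 ^ P" by (simp add: exp_of_nat_mult[symmetric])
    finally show "real K \<le> exp 1 ^ P" .
  qed (use R in auto)
  also have "\<dots> = (224 * exp 1 / C\<^sup>2) ^ P" by (simp add: power_mult_distrib[symmetric] mult.commute)
  also have "\<dots> \<le> (224 * exp 1 / C\<^sup>2) ^ 1"
    using C P(3) by (intro power_decreasing) (auto simp: divide_le_eq)
  finally show ?thesis by simp
qed

lemma (in isotropic_mixing) deviation_tail_rate:
  defines "\<rho> \<equiv> B * sqrt (real q * ln (real K) / real n)"
  assumes "3 \<le> K" "real q \<le> real n / 2" "\<rho> \<le> 1" "0 < C" "224 * exp 1 \<le> C\<^sup>2"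
  shows "\<exists>T\<in>events. {\<omega>\<in>space M. \<exists>x. dot K x x = 1 \<and>
      (3 * C * \<rho>)\<^sup>2 < dot K (mulv K (deviation \<omega>) x) (mulv K (deviation \<omega>) x)} \<subseteq> T \<and>
    prob T \<le> 448 * exp 1 / C\<^sup>2 + 4 * \<bar>beta_mixing_coeff M X q * real n / real q\<bar>"
proof -
  define R where "R = real q * B\<^sup>2 / real n"
  define P where "P = nat \<lceil>ln (real K)\<rceil>"
  have R: "0 \<le> R" by (simp add: R_def)
  have lnK: "0 < ln (real K)" using \<open>3 \<le> K\<close> by simp
  have \<rho>: "0 < \<rho>" using B_pos q_pos n_pos lnK by (simp add: \<rho>_def)
  have \<rho>2: "\<rho>\<^sup>2 = R * ln (real K)"
    using lnK by (simp add: \<rho>_def R_def power_mult_distrib)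
  have main: "real K * ((16 * (real P)\<^sup>2 * R\<^sup>2 + 80 * real P * R) / (C * \<rho>)\<^sup>2) ^ P
      \<le> 224 * exp 1 / C\<^sup>2"
    unfolding P_def by (rule moment_order_choice) fact+
  let ?\<beta> = "beta_mixing_coeff M X q"
  have "real blocks \<le> real n / real q"
  proof -
    have "real (n div (2 * q)) \<le> real n / (2 * real q)"
      using of_nat_div_le_of_nat[of n "2 * q"] by simp
    moreover have "1 \<le> real n / (2 * real q)" using assms(3) q_pos by (simp add: field_simps)
    ultimately show ?thesis by (simp add: blocks_def)
  qed
  then have "real blocks * ?\<beta> \<le> real n / real q * \<bar>?\<beta>\<bar>"
    by (intro order_trans[OF mult_left_mono mult_right_mono]) auto
  also have "\<dots> = \<bar>?\<beta> * real n / real q\<bar>" by (simp add: abs_mult)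
  finally have mix: "real blocks * ?\<beta> \<le> \<bar>?\<beta> * real n / real q\<bar>" .
  have "0 < C * \<rho>" using \<open>0 < C\<close> \<rho> by simp
  from deviation_tail[OF this, of P] obtain T where T: "T \<in> events"
    "{\<omega>\<in>space M. \<exists>x. dot K x x = 1 \<and>
      (3 * (C * \<rho>))\<^sup>2 < dot K (mulv K (deviation \<omega>) x) (mulv K (deviation \<omega>) x)} \<subseteq> T"
    "prob T \<le> 2 * (real K * ((16 * (real P)\<^sup>2 * R\<^sup>2 + 80 * real P * R) / (C * \<rho>)\<^sup>2) ^ P
      + real blocks * (2 * ?\<beta>))"
    unfolding R_def[symmetric] by blast
  show ?thesis
    using T main mix by (intro bexI[of _ T]) (auto simp: mult.assoc)
qed

section \<open>The orthonormalized basis\<close>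

lemma stationary_distr:
  assumes "strictly_stationary M X" and X: "\<And>i. X i \<in> borel_measurable M"
  shows "distr M borel (X i) = distr M borel (X 1)"
proof -
  let ?P = "\<Pi>\<^sub>M j\<in>{1::int}. borel"
  have meas: "(\<lambda>\<omega>. \<lambda>j\<in>{1::int}. X (j + h) \<omega>) \<in> measurable M ?P" for h
    by (intro measurable_restrict X)
  have marginal: "distr (distr M ?P (\<lambda>\<omega>. \<lambda>j\<in>{1}. X (j + h) \<omega>)) borel (\<lambda>x. x 1)
      = distr M borel (X (1 + h))" for h
    by (subst distr_distr[OF _ meas]) (auto intro!: measurable_component_singleton simp: o_def)
  have "distr M ?P (\<lambda>\<omega>. \<lambda>j\<in>{1}. X (j + 0) \<omega>) = distr M ?P (\<lambda>\<omega>. \<lambda>j\<in>{1}. X (j + (i - 1)) \<omega>)"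
    using assms(1) unfolding strictly_stationary_def by simp
  then show ?thesis using marginal[of 0] marginal[of "i - 1"] by simp
qed

lemma stationary_integral:
  fixes f :: "'x::topological_space \<Rightarrow> real"
  assumes "strictly_stationary M X" and X: "\<And>i. X i \<in> borel_measurable M"
    and f: "f \<in> borel_measurable borel"
  shows "(\<integral>\<omega>. f (X i \<omega>) \<partial>M) = (\<integral>\<omega>. f (X 1 \<omega>) \<partial>M)"
  using integral_distr[OF X f, of i] integral_distr[OF X f, of 1]
    stationary_distr[OF assms(1) X, of i] by simp

lemma weighted_basis_measurable:
  assumes "\<D> n \<subseteq> \<X>" "closed (\<D> n)" "j < K"
    and "b K (Suc j) \<in> borel_measurable (restrict_space borel \<X>)"
  shows "(\<lambda>x. vec_index (weighted_basis b \<D> K n x) j) \<in> borel_measurable borel"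
proof -
  have "b K (Suc j) \<in> borel_measurable (restrict_space borel (\<D> n))"
    by (rule measurable_restrict_mono[OF assms(4,1)])
  then have "(\<lambda>x. b K (Suc j) x * indicator (\<D> n) x) \<in> borel_measurable borel"
    using assms(2) by (subst (asm) borel_measurable_restrict_space_iff) (auto simp: mult.commute)
  then show ?thesis using assms(3) by (simp add: weighted_basis_def)
qed

lemma zeta_Kn_bound:
  assumes "zeta_Kn \<X> b \<D> K n \<noteq> \<infinity>" "x \<in> \<X>"
  shows "dot K (vec_index (weighted_basis b \<D> K n x)) (vec_index (weighted_basis b \<D> K n x))
    \<le> (enn2real (zeta_Kn \<X> b \<D> K n))\<^sup>2"
proof -
  let ?v = "weighted_basis b \<D> K n x"
  have v: "?v \<in> carrier_vec K" by (simp add: weighted_basis_def)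
  have "ennreal (euclidean_norm ?v) \<le> zeta_Kn \<X> b \<D> K n"
    unfolding zeta_Kn_def by (rule SUP_upper[OF assms(2)])
  then have "enn2real (ennreal (euclidean_norm ?v)) \<le> enn2real (zeta_Kn \<X> b \<D> K n)"
    using assms(1) by (intro enn2real_mono) (auto simp: top.not_eq_extremum)
  moreover have nonneg: "0 \<le> scalar_prod ?v ?v" by (simp add: scalar_prod_dot[OF v])
  ultimately have "sqrt (scalar_prod ?v ?v) \<le> enn2real (zeta_Kn \<X> b \<D> K n)"
    by (simp add: euclidean_norm_def)
  then have "(sqrt (scalar_prod ?v ?v))\<^sup>2 \<le> (enn2real (zeta_Kn \<X> b \<D> K n))\<^sup>2"
    using nonneg by (intro power_mono) auto
  then show ?thesis using nonneg by (simp add: scalar_prod_dot[OF v])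
qed

definition orthonormalized_fun ::
  "'a measure \<Rightarrow> (int \<Rightarrow> 'a \<Rightarrow> 'x) \<Rightarrow> (nat \<Rightarrow> nat \<Rightarrow> 'x \<Rightarrow> real) \<Rightarrow> (nat \<Rightarrow> 'x set)
    \<Rightarrow> nat \<Rightarrow> nat \<Rightarrow> 'x \<Rightarrow> nat \<Rightarrow> real" where
  "orthonormalized_fun M X b \<D> K n x =
     mulv K (entries (inv_sqrt_mat (basis_gram M X b \<D> K n))) (vec_index (weighted_basis b \<D> K n x))"

lemma basis_gram_carrier: "basis_gram M X b \<D> K n \<in> carrier_mat K K"
  by (simp add: basis_gram_def second_moment_mat_def)

lemma basis_gram_sym: "sym_mat K (entries (basis_gram M X b \<D> K n))"
  by (simp add: sym_mat_def entries_def basis_gram_def second_moment_mat_def mult.commute)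

text \<open>Boundedness comes from \<open>|S b|\<^sup>2 \<le> |b|\<^sup>2 / \<lambda>\<^sub>m\<^sub>i\<^sub>n\<close>, isotropy from
\<open>E (S b \<bullet> y)\<^sup>2 = (S y) \<bullet> G (S y) = |y|\<^sup>2\<close> at time 1 and from stationarity at other times.\<close>

lemma orthonormalized_isotropic_mixing:
  fixes X :: "int \<Rightarrow> 'a \<Rightarrow> 'x::euclidean_space"
  assumes M: "prob_space M" and X: "\<And>i. X i \<in> borel_measurable M"
    and X_values: "\<And>i \<omega>. \<omega> \<in> space M \<Longrightarrow> X i \<omega> \<in> \<X>"
    and D: "\<D> n \<subseteq> \<X>" "closed (\<D> n)"
    and b: "\<And>j. 1 \<le> j \<Longrightarrow> j \<le> K \<Longrightarrow> b K j \<in> borel_measurable (restrict_space borel \<X>)"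
    and pos: "0 < lambda_min (basis_gram M X b \<D> K n)"
    and stat: "strictly_stationary M X"
    and fin: "zeta_Kn \<X> b \<D> K n \<noteq> \<infinity>"
    and dims: "0 < K" "0 < q" "0 < n"
  shows "isotropic_mixing M X (orthonormalized_fun M X b \<D> K n) K n q
    (enn2real (zeta_Kn \<X> b \<D> K n) * lambda_Kn M X b \<D> K n)"
proof -
  interpret prob_space M by (rule M)
  let ?G = "basis_gram M X b \<D> K n" and ?h = "\<lambda>x. vec_index (weighted_basis b \<D> K n x)"
  let ?V = "orthonormalized_fun M X b \<D> K n"
  define S where "S = entries (inv_sqrt_mat ?G)"
  define Z where "Z = enn2real (zeta_Kn \<X> b \<D> K n)"
  define L where "L = lambda_Kn M X b \<D> K n"
  note S = inv_sqrt_mat_properties[OF basis_gram_carrier basis_gram_sym pos, folded S_def]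
  have V: "?V x = mulv K S (?h x)" for x by (simp add: orthonormalized_fun_def S_def)
  have h: "(\<lambda>x. ?h x j) \<in> borel_measurable borel" if "j < K" for j
    by (rule weighted_basis_measurable[where \<D> = \<D> and n = n and K = K and b = b])
      (use D b[of "Suc j"] that in auto)
  have hX: "(\<lambda>\<omega>. ?h (X i \<omega>) j) \<in> borel_measurable M" if "j < K" for i j
    using measurable_compose[OF X h[OF that]] by simp
  have hZ: "dot K (?h (X i \<omega>)) (?h (X i \<omega>)) \<le> Z\<^sup>2" if "\<omega> \<in> space M" for i \<omega>
    unfolding Z_def by (rule zeta_Kn_bound[OF fin X_values[OF that]])
  have Vm: "(\<lambda>x. ?V x a) \<in> borel_measurable borel" if "a < K" for a
    unfolding V mulv_def using h by (intro borel_measurable_sum borel_measurable_times) auto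
  have L: "0 < L" "L\<^sup>2 = 1 / lambda_min ?G"
    using pos by (simp_all add: L_def lambda_Kn_def powr_minus_divide powr_half_sqrt power_divide)
  have bounded: "dot K (?V (X i \<omega>)) (?V (X i \<omega>)) \<le> (Z * L)\<^sup>2" if "\<omega> \<in> space M" for i \<omega>
  proof -
    have "dot K (?V (X i \<omega>)) (?V (X i \<omega>)) \<le> L\<^sup>2 * dot K (?h (X i \<omega>)) (?h (X i \<omega>))"
      unfolding V L(2) by (rule S(4))
    also have "\<dots> \<le> L\<^sup>2 * Z\<^sup>2" using hZ[OF that] by (intro mult_left_mono) auto
    finally show ?thesis by (simp add: power_mult_distrib mult.commute)
  qed
  have int: "integrable M (\<lambda>\<omega>. ?h (X 1 \<omega>) a * ?h (X 1 \<omega>) c)" if ac: "a < K" "c < K" for a c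
  proof (rule integrable_const_bound[of _ "Z\<^sup>2"])
    show "AE \<omega> in M. norm (?h (X 1 \<omega>) a * ?h (X 1 \<omega>) c) \<le> Z\<^sup>2"
    proof (rule AE_I2)
      fix \<omega> assume w: "\<omega> \<in> space M"
      have "\<bar>?h (X 1 \<omega>) j\<bar> \<le> \<bar>Z\<bar>" if "j < K" for j
      proof -
        have "?h (X 1 \<omega>) j * ?h (X 1 \<omega>) j \<le> dot K (?h (X 1 \<omega>)) (?h (X 1 \<omega>))"
          unfolding dot_def using that by (intro member_le_sum) auto
        then have "(?h (X 1 \<omega>) j)\<^sup>2 \<le> Z\<^sup>2" using hZ[OF w, of 1] by (simp add: power2_eq_square)
        then show ?thesis by (simp only: abs_le_square_iff)
      qed
      then have "\<bar>?h (X 1 \<omega>) a\<bar> * \<bar>?h (X 1 \<omega>) c\<bar> \<le> \<bar>Z\<bar> * \<bar>Z\<bar>"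
        using ac by (intro mult_mono) auto
      then show "norm (?h (X 1 \<omega>) a * ?h (X 1 \<omega>) c) \<le> Z\<^sup>2"
        by (simp add: abs_mult power2_eq_square)
    qed
  qed (use hX ac in simp)
  have gram: "(\<integral>\<omega>. (dot K (?h (X 1 \<omega>)) y)\<^sup>2 \<partial>M) = qform K (entries ?G) y" for y
  proof -
    have "(dot K (?h (X 1 \<omega>)) y)\<^sup>2
        = (\<Sum>a<K. \<Sum>c<K. y a * y c * (?h (X 1 \<omega>) a * ?h (X 1 \<omega>) c))" for \<omega>
      by (simp add: dot_def power2_eq_square sum_product algebra_simps)
    then have "(\<integral>\<omega>. (dot K (?h (X 1 \<omega>)) y)\<^sup>2 \<partial>M)
        = (\<integral>\<omega>. (\<Sum>a<K. \<Sum>c<K. y a * y c * (?h (X 1 \<omega>) a * ?h (X 1 \<omega>) c)) \<partial>M)"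
      by simp
    also have "\<dots> = (\<Sum>a<K. \<integral>\<omega>. (\<Sum>c<K. y a * y c * (?h (X 1 \<omega>) a * ?h (X 1 \<omega>) c)) \<partial>M)"
      by (intro Bochner_Integration.integral_sum Bochner_Integration.integrable_sum
          integrable_mult_right int) auto
    also have "\<dots> = (\<Sum>a<K. \<Sum>c<K. \<integral>\<omega>. y a * y c * (?h (X 1 \<omega>) a * ?h (X 1 \<omega>) c) \<partial>M)"
      by (intro sum.cong refl Bochner_Integration.integral_sum integrable_mult_right int) auto
    also have "\<dots> = (\<Sum>a<K. \<Sum>c<K. y a * y c * (\<integral>\<omega>. ?h (X 1 \<omega>) a * ?h (X 1 \<omega>) c \<partial>M))"
      by simp
    also have "\<dots> = qform K (entries ?G) y"
      by (simp add: qform_def dot_def mulv_def entries_def basis_gram_def second_moment_mat_def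
          sum_distrib_left mult_ac)
    finally show ?thesis .
  qed
  have isotropic1: "(\<integral>\<omega>. (dot K (?V (X 1 \<omega>)) y)\<^sup>2 \<partial>M) = dot K y y" for y
    using gram[of "mulv K S y"] S(3)[of y] by (simp add: V dot_mulv_sym[OF S(2)])
  have isotropic: "(\<integral>\<omega>. (dot K (?V (X i \<omega>)) y)\<^sup>2 \<partial>M) = dot K y y" for i y
  proof -
    have "(\<lambda>x. (dot K (?V x) y)\<^sup>2) \<in> borel_measurable borel"
      unfolding dot_def
      by (intro borel_measurable_power borel_measurable_sum borel_measurable_times Vm) auto
    from stationary_integral[OF stat X this, of i] show ?thesis by (simp add: isotropic1)
  qed
  have "0 < Z * L"
  proof (rule ccontr)
    assume "\<not> 0 < Z * L"
    moreover have "0 \<le> Z" by (simp add: Z_def)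
    ultimately have "Z = 0" using L(1) by (simp add: zero_less_mult_iff)
    define e where "e = (\<lambda>i::nat. if i = 0 then 1 else (0::real))"
    have e: "dot K e e = 1" using dims by (simp add: e_def dot_unit_vector)
    have "(dot K (?V (X 1 \<omega>)) e)\<^sup>2 = 0" if "\<omega> \<in> space M" for \<omega>
    proof (rule antisym)
      have "dot K (?V (X 1 \<omega>)) (?V (X 1 \<omega>)) \<le> 0"
        using bounded[OF that, of 1] \<open>Z = 0\<close> by simp
      then show "(dot K (?V (X 1 \<omega>)) e)\<^sup>2 \<le> 0"
        using dot_Cauchy_Schwarz[of K "?V (X 1 \<omega>)" e] unfolding e by linarith
    qed simp
    then have "(\<integral>\<omega>. (dot K (?V (X 1 \<omega>)) e)\<^sup>2 \<partial>M) = (\<integral>\<omega>. 0 \<partial>M)"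
      by (intro Bochner_Integration.integral_cong) auto
    then show False using isotropic1[of e] e by simp
  qed
  then show ?thesis
    using X Vm bounded isotropic dims unfolding Z_def L_def
    by unfold_locales auto
qed

lemma design_deviation_norm_le:
  assumes iso: "isotropic_mixing M X (orthonormalized_fun M X b \<D> K n) K n q B"
    and pos: "0 < lambda_min (basis_gram M X b \<D> K n)" and "0 \<le> t"
    and le: "\<And>x. dot K x x = 1 \<Longrightarrow>
      dot K (mulv K (isotropic_mixing.deviation X (orthonormalized_fun M X b \<D> K n) n \<omega>) x)
            (mulv K (isotropic_mixing.deviation X (orthonormalized_fun M X b \<D> K n) n \<omega>) x) \<le> t\<^sup>2"
  shows "\<bar>spectral_norm ((1 / real n) \<cdot>\<^sub>m (transpose_mat (orthonormalized_design M X b \<D> K n \<omega>)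
    * orthonormalized_design M X b \<D> K n \<omega>) - 1\<^sub>m K)\<bar> \<le> t"
proof -
  interpret isotropic_mixing M X "orthonormalized_fun M X b \<D> K n" K n q B by (rule iso)
  let ?V = "orthonormalized_fun M X b \<D> K n" and ?B = "orthonormalized_design M X b \<D> K n \<omega>"
  let ?A = "(1 / real n) \<cdot>\<^sub>m (transpose_mat ?B * ?B) - 1\<^sub>m K"
  have V: "vec_index (orthonormalized_basis M X b \<D> K n x) a = ?V x a" if "a < K" for x a
    unfolding orthonormalized_basis_def orthonormalized_fun_def
    by (rule mult_mat_vec_mulv[OF inv_sqrt_mat_properties(1)[OF basis_gram_carrier basis_gram_sym pos]
          _ that]) (simp add: weighted_basis_def)
  have B: "?B \<in> carrier_mat n K" by (simp add: orthonormalized_design_def mat_of_rows_def)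
  have Bi: "?B $$ (i, a) = ?V (X (1 + int i) \<omega>) a" if "i < n" "a < K" for i a
    using that V by (simp add: orthonormalized_design_def mat_of_rows_index)
  have entry: "entries ?A a c = deviation \<omega> a c" if ac: "a < K" "c < K" for a c
  proof -
    have "(\<Sum>i<n. ?B $$ (i, a) * ?B $$ (i, c))
        = (\<Sum>i\<in>{1..int n}. ?V (X i \<omega>) a * ?V (X i \<omega>) c)"
      using ac
      by (intro sum.reindex_bij_witness[of _ "\<lambda>i. nat (i - 1)" "\<lambda>i. 1 + int i"]) (auto simp: Bi)
    moreover have "(transpose_mat ?B * ?B) $$ (a, c) = (\<Sum>i<n. ?B $$ (i, a) * ?B $$ (i, c))"
      using B ac by (simp add: scalar_prod_def lessThan_atLeast0)
    ultimately show ?thesis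
      using B ac by (simp add: entries_def deviation_def outer_sum_def)
  qed
  have eq: "mulv K (entries ?A) x a = mulv K (deviation \<omega>) x a" if "a < K" for x a
    using entry that by (simp add: mulv_def)
  have A: "?A \<in> carrier_mat K K" using B by auto
  show ?thesis
  proof (rule spectral_norm_le[OF A K_pos \<open>0 \<le> t\<close>])
    fix x assume "dot K x x = 1"
    then show "dot K (mulv K (entries ?A) x) (mulv K (entries ?A) x) \<le> t\<^sup>2"
      using le[of x] dot_cong[OF eq[of _ x] eq[of _ x]] by simp
  qed
qed

section \<open>Stochastic orders and the rate\<close>

text \<open>The tail events of a supremum such as the spectral norm are covered by measurable sets of small
probability instead of being measured directly: monotonicity of the measure asks for measurability of
the larger set only.\<close>

lemma (in prob_space) big_O_p_small_o_p_of_tail: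
  assumes tail: "\<And>\<epsilon>. 0 < \<epsilon> \<Longrightarrow> \<exists>C>0. \<forall>\<^sub>F n in sequentially.
      \<exists>T\<in>events. {\<omega>\<in>space M. C * r n < \<bar>Z n \<omega>\<bar>} \<subseteq> T \<and> prob T < \<epsilon>"
    and r: "r \<longlonglongrightarrow> 0"
  shows "big_O_p M Z r" "small_o_p M Z (\<lambda>_. 1)"
proof -
  have less: "prob S < \<epsilon>" if "T \<in> events" "S \<subseteq> T" "prob T < \<epsilon>" for S T \<epsilon>
    using finite_measure_mono[OF that(2,1)] that(3) by linarith
  show "big_O_p M Z r"
    unfolding big_O_p_def
  proof (intro allI impI)
    fix \<epsilon> :: real assume "0 < \<epsilon>"
    from tail[OF this] obtain C where C: "C > 0" "\<forall>\<^sub>F n in sequentially.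
      \<exists>T\<in>events. {\<omega>\<in>space M. C * r n < \<bar>Z n \<omega>\<bar>} \<subseteq> T \<and> prob T < \<epsilon>" by blast
    from C(2) have "\<forall>\<^sub>F n in sequentially. prob {\<omega>\<in>space M. C * r n < \<bar>Z n \<omega>\<bar>} < \<epsilon>"
      by eventually_elim (use less in blast)
    then show "\<exists>C>0. \<forall>\<^sub>F n in sequentially. prob {\<omega>\<in>space M. C * r n < \<bar>Z n \<omega>\<bar>} < \<epsilon>"
      using C(1) by blast
  qed
  show "small_o_p M Z (\<lambda>_. 1)"
    unfolding small_o_p_def
  proof (intro allI impI, rule tendstoI)
    fix e \<epsilon> :: real assume e: "0 < e" "0 < \<epsilon>"
    from tail[OF e(2)] obtain C where C: "C > 0" "\<forall>\<^sub>F n in sequentially.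
      \<exists>T\<in>events. {\<omega>\<in>space M. C * r n < \<bar>Z n \<omega>\<bar>} \<subseteq> T \<and> prob T < \<epsilon>" by blast
    have "(\<lambda>n. C * r n) \<longlonglongrightarrow> C * 0" by (intro tendsto_intros r)
    then have "\<forall>\<^sub>F n in sequentially. C * r n < e"
      using e(1) by (intro order_tendstoD(2)) auto
    with C(2) show "\<forall>\<^sub>F n in sequentially.
        dist (prob {\<omega>\<in>space M. e * 1 < \<bar>Z n \<omega>\<bar>}) 0 < \<epsilon>"
    proof eventually_elim
      case (elim n)
      then obtain T where T: "T \<in> events" "{\<omega>\<in>space M. C * r n < \<bar>Z n \<omega>\<bar>} \<subseteq> T" "prob T < \<epsilon>"
        by blast
      have "{\<omega>\<in>space M. e * 1 < \<bar>Z n \<omega>\<bar>} \<subseteq> T" using T(2) elim(2) by auto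
      then show ?case using less[OF T(1) _ T(3)] by simp
    qed
  qed
qed

theorem lemma2p2:
  fixes M :: "'a measure"
    and X :: "int \<Rightarrow> 'a \<Rightarrow> 'x::euclidean_space"
    and \<X> :: "'x set"
    and \<D> :: "nat \<Rightarrow> 'x set"
    and b :: "nat \<Rightarrow> nat \<Rightarrow> 'x \<Rightarrow> real"
    and K q :: "nat \<Rightarrow> nat"
  assumes "prob_space M"
    and X_measurable: "\<And>i. X i \<in> borel_measurable M"
    and X_values: "\<And>i \<omega>. \<omega> \<in> space M \<Longrightarrow> X i \<omega> \<in> \<X>"
    and D_subset: "\<And>n. n \<ge> 1 \<Longrightarrow> \<D> n \<subseteq> \<X>"
    and D_compact: "\<And>n. n \<ge> 1 \<Longrightarrow> compact (\<D> n)"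
    and D_convex: "\<And>n. n \<ge> 1 \<Longrightarrow> convex (\<D> n)"
    and D_interior: "\<And>n. n \<ge> 1 \<Longrightarrow> interior (\<D> n) \<noteq> {}"
    and D_mono: "\<And>n. n \<ge> 1 \<Longrightarrow> \<D> n \<subseteq> \<D> (Suc n)"
    and K_pos: "\<And>n. n \<ge> 1 \<Longrightarrow> K n \<ge> 1"
    and K_at_top: "filterlim K at_top sequentially"
    and b_measurable:
      "\<And>k j. 1 \<le> j \<Longrightarrow> j \<le> k \<Longrightarrow> b k j \<in> borel_measurable (restrict_space borel \<X>)"
    and lambda_min_pos: "\<And>n. n \<ge> 1 \<Longrightarrow> lambda_min (basis_gram M X b \<D> (K n) n) > 0"
    and stationary: "strictly_stationary M X"
    and mixing: "beta_mixing M X"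
    and q_bounds: "\<forall>\<^sub>F n in sequentially. 1 \<le> q n \<and> real (q n) \<le> real n / 2"
    and q_mixing: "(\<lambda>n. beta_mixing_coeff M X (q n) * real n / real (q n)) \<longlonglongrightarrow> 0"
    and rate_tendsto:
      "(\<lambda>n. zeta_Kn \<X> b \<D> (K n) n *
             ennreal (lambda_Kn M X b \<D> (K n) n * sqrt (real (q n) * ln (real (K n)) / real n)))
         \<longlonglongrightarrow> 0"
  shows
    "let B = (\<lambda>n. orthonormalized_design M X b \<D> (K n) n);
         deviation = (\<lambda>n \<omega>.
           spectral_norm ((1 / real n) \<cdot>\<^sub>m (transpose_mat (B n \<omega>) * B n \<omega>) - 1\<^sub>m (K n)));
         rate = (\<lambda>n. enn2real (zeta_Kn \<X> b \<D> (K n) n) * lambda_Kn M X b \<D> (K n) n *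
           sqrt (real (q n) * ln (real (K n)) / real n))
     in big_O_p M deviation rate \<and> small_o_p M deviation (\<lambda>n. 1)"
proof -
  interpret prob_space M by fact
  define Z where "Z n = zeta_Kn \<X> b \<D> (K n) n" for n
  define L where "L n = lambda_Kn M X b \<D> (K n) n" for n
  define root where "root n = sqrt (real (q n) * ln (real (K n)) / real n)" for n
  define rate where "rate n = enn2real (Z n) * L n * root n" for n
  define dev where "dev n \<omega> = spectral_norm ((1 / real n) \<cdot>\<^sub>m
      (transpose_mat (orthonormalized_design M X b \<D> (K n) n \<omega>)
        * orthonormalized_design M X b \<D> (K n) n \<omega>) - 1\<^sub>m (K n))" for n \<omega>
  have lim: "(\<lambda>n. Z n * ennreal (L n * root n)) \<longlonglongrightarrow> 0"
    using rate_tendsto by (simp add: Z_def L_def root_def)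
  have K3: "\<forall>\<^sub>F n in sequentially. 3 \<le> K n"
    using K_at_top unfolding filterlim_at_top by blast
  have basics: "\<forall>\<^sub>F n in sequentially. 1 \<le> n \<and> 1 \<le> q n \<and> real (q n) \<le> real n / 2 \<and> 3 \<le> K n"
    using K3 q_bounds eventually_ge_at_top[of 1] by eventually_elim auto
  have L_pos: "0 < L n" if "1 \<le> n" for n
    using lambda_min_pos[OF that] by (simp add: L_def lambda_Kn_def)
  have root_pos: "0 < root n" if "1 \<le> n" "1 \<le> q n" "3 \<le> K n" for n
    using that by (simp add: root_def)
  have rate_eq: "enn2real (Z n * ennreal (L n * root n)) = rate n"
    if "1 \<le> n" "1 \<le> q n" "3 \<le> K n" for n
    using L_pos[OF that(1)] root_pos[OF that] by (simp add: enn2real_mult rate_def)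
  have "(\<lambda>n. enn2real (Z n * ennreal (L n * root n))) \<longlonglongrightarrow> 0"
    using lim by (intro tendsto_enn2real) auto
  then have rate0: "rate \<longlonglongrightarrow> 0"
    by (rule Lim_transform_eventually) (use basics in eventually_elim, simp add: rate_eq)
  have finite_zeta: "\<forall>\<^sub>F n in sequentially. Z n \<noteq> \<infinity>"
  proof -
    have "\<forall>\<^sub>F n in sequentially. Z n * ennreal (L n * root n) < 1"
      using lim by (rule order_tendstoD(2)) simp
    with basics show ?thesis
    proof eventually_elim
      case (elim n)
      then have "0 < L n * root n" using L_pos root_pos by simp
      then show ?case using elim(2) by (auto simp: ennreal_top_mult split: if_splits)
    qed
  qed
  have rate1: "\<forall>\<^sub>F n in sequentially. rate n < 1"
    using rate0 by (rule order_tendstoD(2)) simp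
  have tail: "\<exists>C>0. \<forall>\<^sub>F n in sequentially.
      \<exists>T\<in>events. {\<omega>\<in>space M. C * rate n < \<bar>dev n \<omega>\<bar>} \<subseteq> T \<and> prob T < \<epsilon>" if "0 < \<epsilon>" for \<epsilon>
  proof -
    \<comment> \<open>Large enough for \<open>448 e / C\<^sup>2 < \<epsilon> / 2\<close> and for the hypothesis \<open>224 e \<le> C\<^sup>2\<close> of the tail bound.\<close>
    define A where "A = 448 * exp 1 * (1 + 2 / \<epsilon>)"
    define C where "C = sqrt A"
    have A: "448 * exp 1 \<le> A" "448 * exp 1 * 2 < A * \<epsilon>"
      using \<open>0 < \<epsilon>\<close> by (simp_all add: A_def field_simps)
    then have "0 < A" using exp_gt_zero[of 1] by linarith
    then have C: "0 < C" "C\<^sup>2 = A" by (simp_all add: C_def)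
    have "448 * exp 1 < \<epsilon> / 2 * A" using A(2) by (simp add: mult.commute)
    then have small: "448 * exp 1 / C\<^sup>2 < \<epsilon> / 2"
      unfolding C(2) using \<open>0 < A\<close> by (simp only: pos_divide_less_eq)
    have large: "224 * exp 1 \<le> C\<^sup>2"
      unfolding C(2) using A(1) exp_gt_zero[of "1::real"] by linarith
    have "(\<lambda>n. 4 * \<bar>beta_mixing_coeff M X (q n) * real n / real (q n)\<bar>) \<longlonglongrightarrow> 4 * \<bar>0\<bar>"
      by (intro tendsto_intros q_mixing)
    then have "\<forall>\<^sub>F n in sequentially.
        4 * \<bar>beta_mixing_coeff M X (q n) * real n / real (q n)\<bar> < \<epsilon> / 2"
      using \<open>0 < \<epsilon>\<close> by (intro order_tendstoD(2)) auto
    with basics finite_zeta rate1 have "\<forall>\<^sub>F n in sequentially.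
      \<exists>T\<in>events. {\<omega>\<in>space M. 3 * C * rate n < \<bar>dev n \<omega>\<bar>} \<subseteq> T \<and> prob T < \<epsilon>"
    proof eventually_elim
      case (elim n)
      let ?V = "orthonormalized_fun M X b \<D> (K n) n"
      have iso: "isotropic_mixing M X ?V (K n) n (q n) (enn2real (Z n) * L n)"
        unfolding Z_def L_def
        by (rule orthonormalized_isotropic_mixing[where \<X> = \<X>])
          (use elim X_measurable X_values D_subset[of n] compact_imp_closed[OF D_compact[of n]]
             b_measurable lambda_min_pos[of n] stationary in \<open>auto simp: Z_def intro: prob_space_axioms\<close>)
      interpret iso: isotropic_mixing M X ?V "K n" n "q n" "enn2real (Z n) * L n" by (rule iso)
      have rate_root: "enn2real (Z n) * L n * sqrt (real (q n) * ln (real (K n)) / real n) = rate n"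
        by (simp add: rate_def root_def)
      have r: "0 \<le> 3 * C * rate n"
        using C(1) L_pos[of n] root_pos[of n] elim by (simp add: rate_def less_imp_le)
      from iso.deviation_tail_rate[of C] elim C(1) large
      obtain T where T: "T \<in> events" "{\<omega>\<in>space M. \<exists>x. dot (K n) x x = 1 \<and> (3 * C * rate n)\<^sup>2
            < dot (K n) (mulv (K n) (iso.deviation \<omega>) x) (mulv (K n) (iso.deviation \<omega>) x)} \<subseteq> T"
          "prob T \<le> 448 * exp 1 / C\<^sup>2
             + 4 * \<bar>beta_mixing_coeff M X (q n) * real n / real (q n)\<bar>"
        unfolding rate_root by auto
      have "{\<omega>\<in>space M. 3 * C * rate n < \<bar>dev n \<omega>\<bar>} \<subseteq> T"
      proof (rule subsetI, rule ccontr)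
        fix \<omega> assume w: "\<omega> \<in> {\<omega>\<in>space M. 3 * C * rate n < \<bar>dev n \<omega>\<bar>}" "\<omega> \<notin> T"
        have "\<bar>dev n \<omega>\<bar> \<le> 3 * C * rate n"
          unfolding dev_def
        proof (rule design_deviation_norm_le[OF iso _ r])
          show "0 < lambda_min (basis_gram M X b \<D> (K n) n)" using elim lambda_min_pos by blast
          fix x assume "dot (K n) x x = 1"
          then show "dot (K n) (mulv (K n) (iso.deviation \<omega>) x) (mulv (K n) (iso.deviation \<omega>) x)
              \<le> (3 * C * rate n)\<^sup>2"
            using T(2) w by (auto simp: not_less[symmetric])
        qed
        then show False using w(1) by simp
      qed
      moreover have "prob T < \<epsilon>" using T(3) small elim by linarith
      ultimately show ?case using T(1) by blast
    qed
    then show ?thesis using C(1) by (intro exI[of _ "3 * C"]) auto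
  qed
  from big_O_p_small_o_p_of_tail[of rate dev, OF tail rate0]
  show ?thesis
    unfolding Let_def dev_def[abs_def] rate_def[abs_def] Z_def L_def root_def by blast
qed

end
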